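(* There exist constants $C_1,C_2>0$, depending only on $\varpi_0,\eta_0,\varkappa_0$ (and not on $\Gamma,\Omega,a,b,c,d$), such that for any simply connected discrete domain $\Omega$ and any four distinct boundary points $a,b,c,d\in\partial\Omega$ listed counterclockwise, $$C_1\le \mathrm L_\Omega([ab]_\Omega;[cd]_\Omega)\cdot\mathrm L_\Omega([bc]_\Omega;[da]_\Omega)\le C_2.$$
   Context: **Graph.** $(\Gamma;E^\Gamma)$ is an infinite undirected weighted planar graph embedded in $\mathbb C$ so that all edges are straight segments; $\Gamma\subset\mathbb C$ denotes the vertex set. Each edge $e$ carries a weight $\mathrm w_e>0$, and $\mu_v:=\sum_{(vv')\in E^\Gamma}\mathrm w_{vv'}$. Standing assumptions, with fixed constants $\varpi_0>0$, $\eta_0>0$, $\varkappa_0\ge1$: (a) $\mathrm w_e\ge\varpi_0$ for all edges and $\mu_v\le\varpi_0^{-1}$ for all vertices; (b) at each vertex all angles between neighboring edges do not exceed $\pi-\eta_0$; (c) for each vertex $v$, $\max_{(vv')\in E^\Gamma}|v'-v|\le\varkappa_0 r_v$, where $r_v:=\min_{(vv')\in E^\Gamma}|v'-v|$; (d) $\Gamma$ has no accumulation points in $\mathbb C$. **Discrete domains.** A discrete domain $\Omega=\mathrm{Int}\,\Omega\cup\partial\Omega$ is given by a finite (bounded) connected subgraph $(V^\Omega;E^\Omega_{\mathrm{int}})$ of $\Gamma$ containing all edges of $\Gamma$ between vertices of $V^\Omega$. One sets $\mathrm{Int}\,\Omega:=V^\Omega$; $E^\Omega_{\mathrm{bd}}$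 is the set of oriented edges $(a_{\mathrm{int}}a)$ of $\Gamma$ with $a_{\mathrm{int}}\in V^\Omega$, $a\notin V^\Omega$; $\partial\Omega$ is the set of pairs $(a;(a_{\mathrm{int}}a))$ with $(a_{\mathrm{int}}a)\in E^\Omega_{\mathrm{bd}}$. Boundary points are thus boundary edges, but are denoted by their outer endpoint $a$. $E^\Omega:=E^\Omega_{\mathrm{int}}\cup E^\Omega_{\mathrm{bd}}$. $\Omega$ is simply connected if for any cycle in $E^\Omega_{\mathrm{int}}$ all edges of $\Gamma$ surrounded by it belong to $E^\Omega_{\mathrm{int}}$; then $\partial\Omega$ is naturally cyclically ordered (counterclockwise around $\Omega$). For $a,b\in\partial\Omega$, the boundary arc $[ab]_\Omega\subset\partial\Omega$ is the set of boundary points met when going counterclockwise along $\partial\Omega$ from $a$ to $b$, including $a$ and $b$. **Discrete extremal length.** For $g:E^\Omega\to[0,+\infty)$ put $A_g(\Omega):=\sum_{e\in E^\Omega}\mathrm w_e g_e^2$ and, for a path $\gamma$, $L_g(\gamma):=\sum_{e\in\gamma}g_e$. Then $\mathrm L_\Omega([ab]_\Omega;[cd]_\Omega):=\sup_g [\inf_\gamma L_g(\gamma)]^2/A_g(\Omega)$, where the infimum is over all lattice paths connecting $[ab]_\Omega$ and $[cd]_\Omega$ inside $\Omega$ and the supremum is over all $g$ with $0<A_g(\Omega)<+\infty$. *)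

theory Defs
  imports "HOL-Analysis.Analysis"
begin

section \<open>Straight-line planar graphs in the complex plane\<close>

text \<open>Undirected edges are two-element sets of vertices: since all edges are straight segments,
  there are neither loops nor multiple edges.\<close>

definition nbrs :: "complex set set \<Rightarrow> complex \<Rightarrow> complex set" where
  "nbrs E v = {v'. {v, v'} \<in> E}"

definition vertex_weight :: "complex set set \<Rightarrow> (complex set \<Rightarrow> real) \<Rightarrow> complex \<Rightarrow> real" where
  "vertex_weight E w v = (\<Sum>v'\<in>nbrs E v. w {v, v'})"

definition vertex_radius :: "complex set set \<Rightarrow> complex \<Rightarrow> real" where
  "vertex_radius E v = Min ((\<lambda>v'. dist v' v) ` nbrs E v)"

text \<open>The angle by which the direction of \<open>x\<close> has to be rotated counterclockwise to become the
  direction of \<open>y\<close>, taken in \<open>(0, 2\<pi>]\<close>. Equal directions are at angle \<open>2\<pi>\<close>, so that every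
  other edge at a vertex comes before the edge one started from.\<close>

definition ccw_angle :: "complex \<Rightarrow> complex \<Rightarrow> real" where
  "ccw_angle x y = (if Arg2pi (y / x) = 0 then 2 * pi else Arg2pi (y / x))"

text \<open>The neighbour of \<open>v\<close> that follows \<open>v'\<close> in the counterclockwise order around \<open>v\<close>.\<close>

definition next_nbr :: "complex set set \<Rightarrow> complex \<Rightarrow> complex \<Rightarrow> complex" where
  "next_nbr E v v' = arg_min_on (\<lambda>x. ccw_angle (v' - v) (x - v)) (nbrs E v)"

text \<open>The assumptions \<open>finite_nbrs\<close> and \<open>nbrs_nonempty\<close> make the sum, the minimum and the maximum
  over the edges at a vertex meaningful.\<close>

locale admissible_graph =
  fixes \<Gamma> :: "complex set" and E :: "complex set set" and w :: "complex set \<Rightarrow> real"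
    and \<omega>\<^sub>0 \<eta>\<^sub>0 \<kappa>\<^sub>0 :: real
  assumes infinite_vertices: "infinite \<Gamma>"
    and edges: "\<And>e. e \<in> E \<Longrightarrow> \<exists>u v. u \<in> \<Gamma> \<and> v \<in> \<Gamma> \<and> u \<noteq> v \<and> e = {u, v}"
    and finite_nbrs: "\<And>v. v \<in> \<Gamma> \<Longrightarrow> finite (nbrs E v)"
    and nbrs_nonempty: "\<And>v. v \<in> \<Gamma> \<Longrightarrow> nbrs E v \<noteq> {}"
    and planar_vertex: "\<And>u v. {u, v} \<in> E \<Longrightarrow> closed_segment u v \<inter> \<Gamma> = {u, v}"
    and planar_edges: "\<And>u v u' v'. {u, v} \<in> E \<Longrightarrow> {u', v'} \<in> E \<Longrightarrow> {u, v} \<noteq> {u', v'} \<Longrightarrow>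
      closed_segment u v \<inter> closed_segment u' v' = {u, v} \<inter> {u', v'}"
    and weight_pos: "\<And>e. e \<in> E \<Longrightarrow> w e > 0"
    and weight_lower: "\<And>e. e \<in> E \<Longrightarrow> w e \<ge> \<omega>\<^sub>0"
    and vertex_weight_upper: "\<And>v. v \<in> \<Gamma> \<Longrightarrow> vertex_weight E w v \<le> inverse \<omega>\<^sub>0"
    and angles: "\<And>v v'. v \<in> \<Gamma> \<Longrightarrow> v' \<in> nbrs E v \<Longrightarrow>
      ccw_angle (v' - v) (next_nbr E v v' - v) \<le> pi - \<eta>\<^sub>0"
    and edge_lengths: "\<And>v. v \<in> \<Gamma> \<Longrightarrow>
      Max ((\<lambda>v'. dist v' v) ` nbrs E v) \<le> \<kappa>\<^sub>0 * vertex_radius E v"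
    and no_accumulation: "\<And>z. \<not> z islimpt \<Gamma>"


section \<open>Discrete domains\<close>

text \<open>A discrete domain is determined by its set \<open>V\<close> of interior vertices, because all edges of
  the graph between them belong to the domain. A boundary point \<open>(a; (a_int a))\<close> is encoded as the
  oriented edge \<open>(a_int, a)\<close>.\<close>

definition int_edges :: "complex set set \<Rightarrow> complex set \<Rightarrow> complex set set" where
  "int_edges E V = {e \<in> E. e \<subseteq> V}"

definition bd_points :: "complex set set \<Rightarrow> complex set \<Rightarrow> (complex \<times> complex) set" where
  "bd_points E V = {(u, a). u \<in> V \<and> a \<notin> V \<and> {u, a} \<in> E}"

definition dom_edges :: "complex set set \<Rightarrow> complex set \<Rightarrow> complex set set" where
  "dom_edges E V = int_edges E V \<union> (\<lambda>(u, a). {u, a}) ` bd_points E V"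

definition walk :: "complex set set \<Rightarrow> complex list \<Rightarrow> bool" where
  "walk F vs \<longleftrightarrow> vs \<noteq> [] \<and> successively (\<lambda>x y. {x, y} \<in> F) vs"

definition discrete_domain :: "complex set \<Rightarrow> complex set set \<Rightarrow> complex set \<Rightarrow> bool" where
  "discrete_domain \<Gamma> E V \<longleftrightarrow> V \<subseteq> \<Gamma> \<and> finite V \<and> V \<noteq> {} \<and>
     (\<forall>u\<in>V. \<forall>v\<in>V. \<exists>vs. walk (int_edges E V) vs \<and> hd vs = u \<and> last vs = v)"

definition graph_cycle :: "complex set set \<Rightarrow> complex list \<Rightarrow> bool" where
  "graph_cycle F vs \<longleftrightarrow> 3 \<le> length vs \<and> distinct vs \<and> walk F vs \<and> {last vs, hd vs} \<in> F"

definition cycle_curve :: "complex list \<Rightarrow> complex set" where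
  "cycle_curve vs =
     (\<Union>i<length vs. closed_segment (vs ! i) (vs ! ((i + 1) mod length vs)))"

definition simply_connected_domain :: "complex set \<Rightarrow> complex set set \<Rightarrow> complex set \<Rightarrow> bool" where
  "simply_connected_domain \<Gamma> E V \<longleftrightarrow> discrete_domain \<Gamma> E V \<and>
     (\<forall>vs. graph_cycle (int_edges E V) vs \<longrightarrow>
        (\<forall>u v. {u, v} \<in> E \<and> open_segment u v \<subseteq> inside (cycle_curve vs) \<longrightarrow>
           {u, v} \<in> int_edges E V))"

text \<open>Going counterclockwise around the domain, with the exterior on the right-hand side: an interior
  edge is traversed, a boundary edge is visited and one returns to its interior endpoint; in both
  cases one then takes the next edge counterclockwise around the current vertex.\<close>

fun contour_step ::
  "complex set set \<Rightarrow> complex set \<Rightarrow> complex \<times> complex \<Rightarrow> complex \<times> complex" where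
  "contour_step E V (u, v) = (if v \<in> V then (v, next_nbr E v u) else (u, next_nbr E u v))"

definition bd_succ ::
  "complex set set \<Rightarrow> complex set \<Rightarrow> complex \<times> complex \<Rightarrow> complex \<times> complex" where
  "bd_succ E V p =
     (contour_step E V ^^ (LEAST n. 0 < n \<and> (contour_step E V ^^ n) p \<in> bd_points E V)) p"

definition bd_arc :: "complex set set \<Rightarrow> complex set \<Rightarrow>
    complex \<times> complex \<Rightarrow> complex \<times> complex \<Rightarrow> (complex \<times> complex) set" where
  "bd_arc E V a b = {(bd_succ E V ^^ k) a | k. k \<le> (LEAST n. (bd_succ E V ^^ n) a = b)}"

text \<open>The four points are met in this order before the first return to \<open>a\<close>.\<close>

definition listed_ccw :: "complex set set \<Rightarrow> complex set \<Rightarrow> complex \<times> complex \<Rightarrow>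
    complex \<times> complex \<Rightarrow> complex \<times> complex \<Rightarrow> complex \<times> complex \<Rightarrow> bool" where
  "listed_ccw E V a b c d \<longleftrightarrow>
     (\<exists>i j k. 0 < i \<and> i < j \<and> j < k \<and> (\<forall>m. 0 < m \<and> m \<le> k \<longrightarrow> (bd_succ E V ^^ m) a \<noteq> a) \<and>
        (bd_succ E V ^^ i) a = b \<and> (bd_succ E V ^^ j) a = c \<and> (bd_succ E V ^^ k) a = d)"


section \<open>Discrete extremal length\<close>

text \<open>A lattice path joins the outer endpoint of a boundary edge in \<open>A\<close> to the outer endpoint of a
  boundary edge in \<open>B\<close>; it contains these two boundary edges and otherwise interior edges only.\<close>

definition connecting_paths :: "complex set set \<Rightarrow> complex set \<Rightarrow>
    (complex \<times> complex) set \<Rightarrow> (complex \<times> complex) set \<Rightarrow> complex list set" where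
  "connecting_paths E V A B =
     {[a] @ vs @ [b] | a vs b. walk (int_edges E V) vs \<and> (hd vs, a) \<in> A \<and> (last vs, b) \<in> B}"

definition path_length :: "(complex set \<Rightarrow> real) \<Rightarrow> complex list \<Rightarrow> real" where
  "path_length g vs = (\<Sum>i<length vs - 1. g {vs ! i, vs ! Suc i})"

definition metric_area ::
  "complex set set \<Rightarrow> (complex set \<Rightarrow> real) \<Rightarrow> complex set \<Rightarrow> (complex set \<Rightarrow> real) \<Rightarrow> real" where
  "metric_area E w V g = (\<Sum>e\<in>dom_edges E V. w e * (g e)\<^sup>2)"

text \<open>Infimum and supremum are taken in \<open>[0, \<infinity>]\<close>. The area is a finite sum, so only its
  positivity has to be required.\<close>

definition extremal_length :: "complex set set \<Rightarrow> (complex set \<Rightarrow> real) \<Rightarrow> complex set \<Rightarrow>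
    (complex \<times> complex) set \<Rightarrow> (complex \<times> complex) set \<Rightarrow> ennreal" where
  "extremal_length E w V A B =
     (SUP g \<in> {g. (\<forall>e\<in>dom_edges E V. 0 \<le> g e) \<and> 0 < metric_area E w V g}.
        (INF \<gamma> \<in> connecting_paths E V A B. ennreal (path_length g \<gamma>))\<^sup>2 /
        ennreal (metric_area E w V g))"

end

theory Submission
  imports Defs
begin

text \<open>
  Extremal length between two arcs is the effective resistance of an electrical network. For a planar network,
  the resistance between two opposite boundary arcs and the resistance of the dual network between the two other
  arcs have product one. Here a domain and its dual network resemble each other: the weights lie between
  \<open>\<omega>\<^sub>0\<close> and \<open>1 / \<omega>\<^sub>0\<close>, and the faces have a bounded number of edges, because the angles stay
  away from \<open>\<pi>\<close>. So the two extremal lengths have a product of order one. The proof follows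
  the two halves of the duality on the graph itself.

  Upper bound. In a metric \<open>g1\<close> let the distance of the arcs \<open>[ab]\<close> and \<open>[cd]\<close> be
  \<open>l1\<close>. The edges that cross a level \<open>t < l1\<close> of the distance from \<open>[ab]\<close>
  separate these arcs, so the faces at these edges form a chain from \<open>[bc]\<close> to \<open>[da]\<close>, and
  a lattice path runs along the boundaries of these faces (\<open>path_along_cut\<close>). In a second metric \<open>g2\<close> this
  path has at least the length \<open>l2\<close> of a shortest one. Integration over \<open>t\<close> bounds \<open>l1 * l2\<close>
  by the sum of \<open>g1 e * g2 e'\<close> over all pairs of edges of a common face (\<open>product_of_lengths_le\<close>). The
  bound by the areas of the metrics then comes from the Cauchy-Schwarz inequality and from the bound on the
  size of faces (\<open>bounded_face_labelling\<close>): a face is convex, each of its corners is exposed by one of finitely many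
  fixed directions, and no direction exposes two corners.

  Lower bound. Let the potential \<open>h\<close> be harmonic with values zero on \<open>[bc]\<close> and one on \<open>[da]\<close>. With
  the metric \<open>\<bar>dh\<bar>\<close>, the extremal length between these arcs is at least the inverse of the
  energy. A path from \<open>[ab]\<close> to \<open>[cd]\<close> meets all paths from \<open>[bc]\<close> to \<open>[da]\<close>
  (\<open>arc_walks_meet\<close>), so the whole current passes through its vertices. Hence its length is at least of the order of the energy
  if an edge is as long as the currents at its end points are strong, and the area of that metric is at most of
  the same order.

  Planarity enters through winding numbers. The winding number of a closed walk around the face on the right of
  an oriented edge does not change along the contour of the face, it jumps across an edge by the net number of
  passages of the walk, and in a simply connected domain it vanishes on the outer side
  (\<open>face_wind_domain\<close>). From these rules alone it follows that the boundary is a single contour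
  (\<open>boundary_one_contour\<close>) and that interlaced paths meet (\<open>interlaced_walks_meet\<close>).
\<close>

section \<open>Plane geometry of crossing segments\<close>

definition cross2 :: "complex \<Rightarrow> complex \<Rightarrow> real" where
  "cross2 x y = Re x * Im y - Im x * Re y"

lemma cross2_linear [simp]:
  "cross2 (x + x') y = cross2 x y + cross2 x' y"
  "cross2 x (y + y') = cross2 x y + cross2 x y'"
  "cross2 (x - x') y = cross2 x y - cross2 x' y"
  "cross2 x (y - y') = cross2 x y - cross2 x y'"
  "cross2 (- x) y = - cross2 x y"
  "cross2 x (- y) = - cross2 x y"
  "cross2 (of_real r * x) y = r * cross2 x y"
  "cross2 x (of_real r * y) = r * cross2 x y"
  "cross2 x x = 0"
  "cross2 0 x = 0"
  "cross2 x 0 = 0"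
  by (simp_all add: cross2_def algebra_simps)

lemma cross2_scaleR [simp]:
  "cross2 (r *\<^sub>R x) y = r * cross2 x y"
  "cross2 x (r *\<^sub>R y) = r * cross2 x y"
  by (simp_all add: cross2_def algebra_simps)

lemma cross2_swap: "cross2 y x = - cross2 x y"
  by (simp add: cross2_def)

lemma cross2_rotate:
  "cross2 x (\<i> * x) = (cmod x)\<^sup>2"
  "cross2 (- \<i> * x) x = (cmod x)\<^sup>2"
  unfolding cmod_power2 by (simp_all add: cross2_def power2_eq_square)

lemma cross2_cramer:
  assumes "cross2 x y \<noteq> 0"
  shows "z = of_real (cross2 z y / cross2 x y) * x + of_real (cross2 x z / cross2 x y) * y"
proof -
  have "of_real (cross2 x y) * z = of_real (cross2 z y) * x + of_real (cross2 x z) * y"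
    by (simp add: complex_eq_iff cross2_def algebra_simps)
  moreover have "complex_of_real (cross2 x y) \<noteq> 0" using assms by simp
  ultimately show ?thesis
    by (simp add: field_simps)
qed

lemma continuous_on_cross2 [continuous_intros]:
  assumes "continuous_on S f" "continuous_on S g"
  shows "continuous_on S (\<lambda>x. cross2 (f x) (g x))"
  unfolding cross2_def by (intro continuous_intros assms)

lemma Im_divide_cross2: "Im (y / x) = cross2 x y / (cmod x)\<^sup>2"
  by (simp add: Im_divide cross2_def cmod_power2 mult.commute)

lemma cross2_zero_collinear:
  assumes "cross2 x y = 0" "x \<noteq> 0"
  obtains r where "y = of_real r * x"
proof
  have "Im (y / x) = 0" using assms by (simp add: Im_divide_cross2)
  hence "y / x = of_real (Re (y / x))" by (simp add: complex_eq_iff)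
  thus "y = of_real (Re (y / x)) * x" using assms by (simp add: field_simps)
qed

lemma point_in_closed_segment:
  fixes c d :: complex
  assumes "0 \<le> t" "t \<le> 1"
  shows "c + of_real t * (d - c) \<in> closed_segment c d"
  unfolding in_segment using assms
  by (intro exI[of _ t]) (simp add: scaleR_conv_of_real algebra_simps)

lemma segments_cross:
  fixes a b c d :: complex
  assumes "cross2 (b - a) (c - a) < 0" "cross2 (b - a) (d - a) > 0"
    and "cross2 (d - c) (a - c) * cross2 (d - c) (b - c) < 0"
  shows "closed_segment a b \<inter> closed_segment c d \<noteq> {}"
proof -
  define C1 where "C1 = cross2 (b - a) (c - a)"
  define C2 where "C2 = cross2 (b - a) (d - a)"
  define D1 where "D1 = cross2 (d - c) (a - c)"
  define D2 where "D2 = cross2 (d - c) (b - c)"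
  define K where "K = C2 - C1"
  have KD: "K = D1 - D2"
    unfolding K_def C1_def C2_def D1_def D2_def by (simp add: cross2_def algebra_simps)
  have Kpos: "K > 0" using assms unfolding K_def C1_def C2_def by simp
  have *: "D1 > 0 \<and> D2 < 0"
    using assms(3) Kpos KD unfolding D1_def[symmetric] D2_def[symmetric]
    by (auto simp: mult_less_0_iff)
  define P where "P = c + of_real (- C1 / K) * (d - c)"
  have "of_real K * (c - a) = of_real C1 * (d - c) + of_real D1 * (b - a)"
    unfolding K_def C1_def C2_def D1_def by (simp add: complex_eq_iff cross2_def algebra_simps)
  hence "c - a = (of_real C1 * (d - c) + of_real D1 * (b - a)) / of_real K"
    using Kpos by (simp add: field_simps)
  hence P2: "P = a + of_real (D1 / K) * (b - a)"
    unfolding P_def using Kpos by (simp add: field_simps)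
  have "P \<in> closed_segment c d"
    unfolding P_def
    using Kpos assms(1,2) unfolding C1_def[symmetric] C2_def[symmetric] K_def
    by (intro point_in_closed_segment) (auto simp: divide_simps)
  moreover have "P \<in> closed_segment a b"
    unfolding P2
    using Kpos * KD by (intro point_in_closed_segment) (auto simp: divide_simps)
  ultimately show ?thesis by blast
qed

text \<open>A corner with one leg on either side of a segment, at an interior point of the segment, still blocks the view
  after a small motion of the end point. Lines of sight in a face are therefore stable under limits, too.\<close>

lemma blocked_view_stable:
  fixes x y z p q :: complex
  assumes z: "z \<in> open_segment x y"
    and p: "cross2 (y - x) (p - x) > 0" and q: "cross2 (y - x) (q - x) < 0"
  obtains e where "e > 0"
    "\<And>y'. dist y' y < e \<Longrightarrow> closed_segment x y' \<inter> (closed_segment z p \<union> closed_segment z q) \<noteq> {}"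
proof -
  obtain u where u: "0 < u" "u < 1" "z = (1 - u) *\<^sub>R x + u *\<^sub>R y" and xy: "x \<noteq> y"
    using z by (auto simp: in_segment)
  have zx: "z - x = of_real u * (y - x)" using u by (simp add: scaleR_conv_of_real algebra_simps)
  have xz: "x - z = - (of_real u * (y - x))" using zx by (simp add: algebra_simps)
  have yz: "y - z = of_real (1 - u) * (y - x)" using u by (simp add: scaleR_conv_of_real algebra_simps)
  define f where "f = (\<lambda>y'. cross2 (y' - x) (p - x))"
  define g where "g = (\<lambda>y'. cross2 (y' - x) (q - x))"
  define h where "h = (\<lambda>y'. cross2 (p - z) (y' - z))"
  define k where "k = (\<lambda>y'. cross2 (q - z) (y' - z))"
  define l where "l = (\<lambda>y'. cross2 (y' - x) (\<i> * (y - x)))"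
  have pz: "cross2 (p - z) (y - x) = - cross2 (y - x) (p - x)"
  proof -
    have "p - z = (p - x) - (z - x)" by simp
    hence "cross2 (p - z) (y - x) = cross2 (p - x) (y - x) - cross2 (z - x) (y - x)"
      by (metis cross2_linear(3))
    thus ?thesis unfolding zx by (simp only: cross2_linear(7,9)) (simp only: cross2_swap[of "p - x"])
  qed
  have qz: "cross2 (q - z) (y - x) = - cross2 (y - x) (q - x)"
  proof -
    have "q - z = (q - x) - (z - x)" by simp
    hence "cross2 (q - z) (y - x) = cross2 (q - x) (y - x) - cross2 (z - x) (y - x)"
      by (metis cross2_linear(3))
    thus ?thesis unfolding zx by (simp only: cross2_linear(7,9)) (simp only: cross2_swap[of "q - x"])
  qed
  have hy: "h y < 0"
    unfolding h_def yz cross2_linear(8) pz using u p by (intro mult_pos_neg) linarith+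
  have ky: "k y > 0"
    unfolding k_def yz cross2_linear(8) qz using u q by (intro mult_pos_pos) linarith+
  have ly: "l y > 0"
    unfolding l_def using xy by (simp only: cross2_rotate) simp
  have "open {y'. f y' > 0 \<and> g y' < 0 \<and> h y' < 0 \<and> k y' > 0 \<and> l y' > 0}"
    unfolding f_def g_def h_def k_def l_def
    by (intro open_Collect_conj open_Collect_less continuous_intros)
  moreover have "y \<in> {y'. f y' > 0 \<and> g y' < 0 \<and> h y' < 0 \<and> k y' > 0 \<and> l y' > 0}"
    using p q hy ky ly unfolding f_def g_def by auto
  ultimately obtain e0 where e0: "e0 > 0"
    "\<And>y'. dist y' y < e0 \<Longrightarrow> f y' > 0 \<and> g y' < 0 \<and> h y' < 0 \<and> k y' > 0 \<and> l y' > 0"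
    unfolding open_dist by blast
  define e where "e = min e0 ((1 - u) * dist x y)"
  show ?thesis
  proof (rule that)
    show "e > 0" using e0 u xy by (simp add: e_def)
    fix y' assume d: "dist y' y < e"
    hence s: "f y' > 0" "g y' < 0" "h y' < 0" "k y' > 0" "l y' > 0"
      using e0(2) unfolding e_def by auto
    have hx: "cross2 (p - z) (x - z) > 0"
      unfolding xz cross2_linear(6,8) pz using mult_pos_pos[OF u(1) p] by linarith
    have kx: "cross2 (q - z) (x - z) < 0"
      unfolding xz cross2_linear(6,8) qz using mult_pos_neg[OF u(1) q] by linarith
    have zs: "cross2 (y' - x) (z - x) = u * cross2 (y' - x) (y - x)"
      unfolding zx by (rule cross2_linear(8))
    \<comment> \<open>The view is blocked by the leg on the side to which the end point has moved, and by the corner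
      itself if the end point has stayed on the line.\<close>
    show "closed_segment x y' \<inter> (closed_segment z p \<union> closed_segment z q) \<noteq> {}"
    proof (cases "cross2 (y' - x) (y - x)" "0::real" rule: linorder_cases)
      case less
      have "closed_segment x y' \<inter> closed_segment z p \<noteq> {}"
        by (rule segments_cross)
          (use zs less s hx u in \<open>auto simp: f_def h_def mult_pos_neg simp del: cross2_linear\<close>)
      thus ?thesis by blast
    next
      case greater
      have "closed_segment x y' \<inter> closed_segment q z \<noteq> {}"
      proof (rule segments_cross)
        show "cross2 (y' - x) (q - x) < 0" using s by (simp add: g_def)
        show "0 < cross2 (y' - x) (z - x)" unfolding zs using u greater by simp
        have "cross2 (z - q) (x - q) = - cross2 (q - z) (x - z)"
          by (simp add: cross2_def algebra_simps)
        moreover have "cross2 (z - q) (y' - q) = - cross2 (q - z) (y' - z)"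
          by (simp add: cross2_def algebra_simps)
        ultimately show "cross2 (z - q) (x - q) * cross2 (z - q) (y' - q) < 0"
          using kx s(4) by (auto simp: k_def mult_neg_pos simp del: cross2_linear)
      qed
      thus ?thesis by (simp add: closed_segment_commute Int_Un_distrib)
    next
      case equal
      have "cross2 (y - x) (y' - x) = 0" using equal cross2_swap[of "y - x" "y' - x"] by simp
      then obtain r where r: "y' - x = of_real r * (y - x)"
        using cross2_zero_collinear xy by (metis eq_iff_diff_eq_0)
      have "r > 0"
      proof -
        have "l y' = r * (cmod (y - x))\<^sup>2" unfolding l_def r by (simp only: cross2_linear(7) cross2_rotate)
        thus ?thesis using s(5) by (simp add: zero_less_mult_iff)
      qed
      have "r \<ge> u"
      proof -
        have "y' - y = of_real (r - 1) * (y - x)" using r by (simp add: algebra_simps)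
        hence "dist y' y = \<bar>r - 1\<bar> * dist x y"
          by (metis dist_norm dist_commute norm_mult norm_of_real)
        hence "\<bar>r - 1\<bar> * dist x y < (1 - u) * dist x y" using d by (simp add: e_def)
        hence "\<bar>r - 1\<bar> < 1 - u" by (rule mult_right_less_imp_less) simp
        thus ?thesis by linarith
      qed
      have "z \<in> closed_segment x y'"
      proof -
        have "z = x + of_real (u / r) * (y' - x)" unfolding r using zx \<open>r > 0\<close> by (simp add: algebra_simps)
        moreover have "x + of_real (u / r) * (y' - x) \<in> closed_segment x y'"
          using \<open>r \<ge> u\<close> \<open>r > 0\<close> u by (intro point_in_closed_segment) auto
        ultimately show ?thesis by (simp only:)
      qed
      thus ?thesis by auto
    qed
  qed
qed

section \<open>The rotation at a vertex\<close>

lemma ccw_angle_bounds: "0 < ccw_angle x y" "ccw_angle x y \<le> 2 * pi"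
  using Arg2pi_ge_0[of "y / x"] Arg2pi_lt_2pi[of "y / x"] by (auto simp: ccw_angle_def)

lemma ccw_angle_less_pi_iff:
  assumes "x \<noteq> 0"
  shows "ccw_angle x y < pi \<longleftrightarrow> cross2 x y > 0"
proof -
  have "ccw_angle x y < pi \<longleftrightarrow> 0 < Arg2pi (y / x) \<and> Arg2pi (y / x) < pi"
    using Arg2pi_ge_0[of "y / x"] pi_gt_zero by (auto simp: ccw_angle_def)
  also have "\<dots> \<longleftrightarrow> cross2 x y > 0"
    unfolding Arg2pi_lt_pi Im_divide_cross2 using assms by (simp add: zero_less_divide_iff)
  finally show ?thesis .
qed

lemma cis_ccw_angle:
  assumes "x \<noteq> 0" "y \<noteq> 0"
  obtains r where "r > 0" "y = of_real r * cis (ccw_angle x y) * x"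
proof
  show "cmod (y / x) > 0" using assms by simp
  have "cis (ccw_angle x y) = exp (\<i> * of_real (Arg2pi (y / x)))"
    by (auto simp: ccw_angle_def cis_conv_exp cis_2pi simp flip: cis_conv_exp)
  hence "of_real (cmod (y / x)) * cis (ccw_angle x y) = y / x"
    using Arg2pi_eq[of "y / x"] by simp
  thus "y = of_real (cmod (y / x)) * cis (ccw_angle x y) * x" using assms by (simp add: field_simps)
qed

text \<open>Counterclockwise angles in \<open>(0, 2\<pi>]\<close> add up as long as the first one does not overtake the second.\<close>

lemma ccw_angle_sum:
  assumes "x \<noteq> 0" "y \<noteq> 0" "z \<noteq> 0" "ccw_angle x y < ccw_angle x z"
  shows "ccw_angle y z = ccw_angle x z - ccw_angle x y"
proof -
  have ny: "Arg2pi (y / x) = ccw_angle x y"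
    using assms(4) ccw_angle_bounds(2)[of x z] by (auto simp: ccw_angle_def split: if_splits)
  have yzd: "z / y = (z / x) / (y / x)" using assms by (simp add: field_simps)
  show ?thesis
  proof (cases "Arg2pi (z / x) = 0")
    case False
    hence nz: "Arg2pi (z / x) = ccw_angle x z" by (simp add: ccw_angle_def)
    have "Arg2pi (z / y) = ccw_angle x z - ccw_angle x y"
      unfolding yzd using Arg2pi_divide[of "y / x" "z / x"] assms ny nz by simp
    thus ?thesis using assms(4) by (simp add: ccw_angle_def)
  next
    case True
    have nyp: "Arg2pi (y / x) > 0" using ny ccw_angle_bounds(1)[of x y] by simp
    have "Arg2pi (z / x) - Arg2pi (y / x) = Arg2pi ((z / x) / (y / x)) - 2 * pi"
      using Arg2pi_diff[of "z / x" "y / x"] assms True nyp Arg2pi_ge_0[of "(z/x)/(y/x)"] by (auto split: if_splits)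
    hence "Arg2pi (z / y) = 2 * pi - ccw_angle x y" unfolding yzd using True ny by simp
    moreover have "ccw_angle x z = 2 * pi" using True by (simp add: ccw_angle_def)
    moreover have "2 * pi - ccw_angle x y > 0" using ny Arg2pi_lt_2pi[of "y/x"] by simp
    ultimately show ?thesis unfolding ccw_angle_def[of y z] by auto
  qed
qed

lemma ccw_angle_eq_same_direction:
  assumes "x \<noteq> 0" "y \<noteq> 0" "z \<noteq> 0" "ccw_angle x y = ccw_angle x z"
  obtains r where "r > 0" "z = of_real r * y"
proof -
  obtain s where s: "s > 0" "y = of_real s * cis (ccw_angle x y) * x"
    by (rule cis_ccw_angle[OF assms(1,2)])
  obtain t where t: "t > 0" "z = of_real t * cis (ccw_angle x z) * x"
    by (rule cis_ccw_angle[OF assms(1,3)])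
  have "z = of_real (t / s) * y" using s t assms(4) by (simp add: field_simps)
  thus ?thesis using that[of "t / s"] s t by simp
qed

context admissible_graph
begin

lemma edge_vertices: "{u, v} \<in> E \<Longrightarrow> u \<in> \<Gamma> \<and> v \<in> \<Gamma> \<and> u \<noteq> v"
  using edges[of "{u, v}"] by (auto simp: doubleton_eq_iff)

lemma in_nbrs_iff: "x \<in> nbrs E v \<longleftrightarrow> {v, x} \<in> E"
  by (simp add: nbrs_def)

lemma nbr_neq: "x \<in> nbrs E v \<Longrightarrow> x \<noteq> v"
  using edge_vertices by (auto simp: in_nbrs_iff)

lemma nbr_same_direction:
  assumes "x \<in> nbrs E v" "y \<in> nbrs E v" "y - v = of_real r * (x - v)" "r > 0"
  shows "x = y"
proof (rule ccontr)
  assume "x \<noteq> y"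
  have e: "{v, x} \<in> E" "{v, y} \<in> E" using assms by (auto simp: in_nbrs_iff)
  have ne: "x \<noteq> v" "y \<noteq> v" using assms nbr_neq by auto
  have int: "closed_segment v x \<inter> closed_segment v y = {v, x} \<inter> {v, y}"
    using planar_edges[OF e] \<open>x \<noteq> y\<close> by (auto simp: doubleton_eq_iff)
  show False
  proof (cases "r \<le> 1")
    case True
    have "y = v + of_real r * (x - v)" using assms(3) by (simp add: algebra_simps)
    hence "y \<in> closed_segment v x" using point_in_closed_segment[of r v x] True assms(4) by simp
    thus False using int ne \<open>x \<noteq> y\<close> by auto
  next
    case False
    have "x = v + of_real (1 / r) * (y - v)" using assms(3,4) by (simp add: field_simps)
    hence "x \<in> closed_segment v y" using point_in_closed_segment[of "1 / r" v y] False assms(4) by simp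
    thus False using int ne \<open>x \<noteq> y\<close> by auto
  qed
qed

lemma next_nbr_in: "v \<in> \<Gamma> \<Longrightarrow> next_nbr E v u \<in> nbrs E v"
  unfolding next_nbr_def by (rule arg_min_if_finite(1)[OF finite_nbrs nbrs_nonempty])

lemma next_nbr_min:
  assumes "v \<in> \<Gamma>" "x \<in> nbrs E v"
  shows "ccw_angle (u - v) (next_nbr E v u - v) \<le> ccw_angle (u - v) (x - v)"
  using arg_min_if_finite(2)[OF finite_nbrs nbrs_nonempty, OF assms(1,1), of "\<lambda>x. ccw_angle (u - v) (x - v)"] assms
  unfolding next_nbr_def by (meson not_le)

lemma nbr_vertices: "u \<in> nbrs E v \<Longrightarrow> u \<in> \<Gamma> \<and> v \<in> \<Gamma>"
  using edge_vertices by (auto simp: in_nbrs_iff)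

lemma next_nbr_cross:
  assumes "u \<in> nbrs E v" "\<eta>\<^sub>0 > 0"
  shows "cross2 (u - v) (next_nbr E v u - v) > 0"
  using angles[of v u] assms nbr_vertices[OF assms(1)] nbr_neq[OF assms(1)]
  by (subst ccw_angle_less_pi_iff[symmetric]) auto

text \<open>The rotation at a vertex is used from here on only through signs of cross products: the next neighbour lies to
  the left, and the convex cone up to it is free of edges.\<close>

lemma next_nbr_empty_cone:
  assumes "u \<in> nbrs E v" "x \<in> nbrs E v" "\<eta>\<^sub>0 > 0"
  shows "\<not> (cross2 (u - v) (x - v) > 0 \<and> cross2 (x - v) (next_nbr E v u - v) > 0)"
proof
  define w where "w = next_nbr E v u"
  assume "cross2 (u - v) (x - v) > 0 \<and> cross2 (x - v) (next_nbr E v u - v) > 0"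
  hence a: "cross2 (u - v) (x - v) > 0" "cross2 (x - v) (w - v) > 0" by (auto simp: w_def)
  have v: "v \<in> \<Gamma>" using nbr_vertices[OF assms(1)] by simp
  have w: "w \<in> nbrs E v" unfolding w_def by (rule next_nbr_in[OF v])
  have nz: "u - v \<noteq> 0" "x - v \<noteq> 0" "w - v \<noteq> 0" using nbr_neq assms w by auto
  have 1: "ccw_angle (u - v) (x - v) < pi" using ccw_angle_less_pi_iff[OF nz(1)] a by simp
  have 2: "ccw_angle (x - v) (w - v) < pi" using ccw_angle_less_pi_iff[OF nz(2)] a by simp
  have 3: "ccw_angle (u - v) (w - v) \<le> ccw_angle (u - v) (x - v)"
    unfolding w_def by (rule next_nbr_min[OF v assms(2)])
  show False
  proof (cases "ccw_angle (u - v) (w - v) = ccw_angle (u - v) (x - v)")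
    case True
    then obtain r where "x - v = of_real r * (w - v)"
      using ccw_angle_eq_same_direction[OF nz(1,3,2)] by metis
    thus False using a(2) by (simp only: cross2_linear(7,9))
  next
    case False
    hence "ccw_angle (w - v) (x - v) = ccw_angle (u - v) (x - v) - ccw_angle (u - v) (w - v)"
      using ccw_angle_sum[OF nz(1,3,2)] 3 by simp
    hence "ccw_angle (w - v) (x - v) < pi" using 1 ccw_angle_bounds(1)[of "u - v" "w - v"] by simp
    hence "cross2 (w - v) (x - v) > 0" using ccw_angle_less_pi_iff[OF nz(3)] by simp
    thus False using a(2) cross2_swap[of "w - v" "x - v"] by linarith
  qed
qed

lemma next_nbr_inj:
  assumes "u \<in> nbrs E v" "u' \<in> nbrs E v" "next_nbr E v u = next_nbr E v u'" "\<eta>\<^sub>0 > 0"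
  shows "u = u'"
proof -
  let ?w = "next_nbr E v u"
  have c: "cross2 (u - v) (?w - v) > 0" "cross2 (u' - v) (?w - v) > 0"
    using next_nbr_cross[OF assms(1,4)] next_nbr_cross[OF assms(2,4)] assms(3) by auto
  have "\<not> cross2 (u - v) (u' - v) > 0"
    using next_nbr_empty_cone[OF assms(1,2,4)] c by blast
  moreover have "\<not> cross2 (u' - v) (u - v) > 0"
    using next_nbr_empty_cone[OF assms(2,1,4)] c assms(3) by auto
  ultimately have z: "cross2 (u - v) (u' - v) = 0" using cross2_swap[of "u - v" "u' - v"] by linarith
  have nz: "u - v \<noteq> 0" using nbr_neq assms by auto
  obtain r where r: "u' - v = of_real r * (u - v)" using cross2_zero_collinear[OF z nz] .
  have "cross2 (u' - v) (?w - v) = r * cross2 (u - v) (?w - v)" unfolding r by (rule cross2_linear(7))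
  hence "r > 0" using c by (simp add: zero_less_mult_iff del: cross2_linear)
  thus ?thesis using nbr_same_direction[OF assms(1,2) r] by simp
qed

text \<open>The rotation is a single cycle: if it stayed in a proper subset, then a pair of neighbours inside and outside of
  the subset with the smallest angle could be improved by rotating the first one.\<close>

lemma next_nbr_transitive:
  assumes S: "S \<subseteq> nbrs E v" "u \<in> S" "\<And>x. x \<in> S \<Longrightarrow> next_nbr E v x \<in> S" and "\<eta>\<^sub>0 > 0"
  shows "S = nbrs E v"
proof (rule ccontr)
  assume "S \<noteq> nbrs E v"
  then obtain y where y: "y \<in> nbrs E v - S" using S by blast
  have v: "v \<in> \<Gamma>" using nbr_vertices S by blast
  let ?P = "S \<times> (nbrs E v - S)"
  let ?f = "\<lambda>(a, b). ccw_angle (a - v) (b - v)"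
  have fin: "finite ?P" using finite_nbrs[OF v] S by (meson finite_Diff finite_SigmaI finite_subset)
  have ne: "?P \<noteq> {}" using y S by blast
  obtain a b where ab: "arg_min_on ?f ?P = (a, b)" by (cases "arg_min_on ?f ?P")
  have m: "(a, b) \<in> ?P" "\<And>a' b'. (a', b') \<in> ?P \<Longrightarrow> ?f (a, b) \<le> ?f (a', b')"
    using arg_min_if_finite[OF fin ne, of ?f] ab by (auto simp: not_less)
  define w where "w = next_nbr E v a"
  have w: "w \<in> S" "w \<in> nbrs E v" using S m(1) unfolding w_def by auto
  have nz: "a - v \<noteq> 0" "b - v \<noteq> 0" "w - v \<noteq> 0" using nbr_neq m(1) w S by auto
  have le: "ccw_angle (a - v) (w - v) \<le> ccw_angle (a - v) (b - v)"
    unfolding w_def by (rule next_nbr_min[OF v]) (use m in auto)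
  have "ccw_angle (a - v) (w - v) \<noteq> ccw_angle (a - v) (b - v)"
  proof
    assume eq: "ccw_angle (a - v) (w - v) = ccw_angle (a - v) (b - v)"
    obtain r where "r > 0" "b - v = of_real r * (w - v)"
      by (rule ccw_angle_eq_same_direction[OF nz(1,3,2) eq])
    hence "w = b" using nbr_same_direction w m(1) by blast
    thus False using w m by auto
  qed
  hence lt: "ccw_angle (a - v) (w - v) < ccw_angle (a - v) (b - v)" using le by simp
  have "ccw_angle (w - v) (b - v) < ccw_angle (a - v) (b - v)"
    using ccw_angle_sum[OF nz(1,3,2) lt] ccw_angle_bounds(1)[of "a - v" "w - v"] by simp
  thus False using m(2)[of w b] w m(1) by auto
qed

text \<open>The angles being less than \<open>\<pi>\<close>, the edges at a vertex do not fit into a half-plane: otherwise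
  the most counterclockwise one would have no successor.\<close>

lemma nbr_left_of_direction:
  assumes v: "v \<in> \<Gamma>" and D: "D \<noteq> 0" and "\<eta>\<^sub>0 > 0"
  obtains u where "u \<in> nbrs E v" "cross2 D (u - v) > 0"
proof -
  have "\<exists>u\<in>nbrs E v. cross2 D (u - v) > 0"
  proof (rule ccontr)
    assume "\<not> ?thesis"
    hence H: "cross2 D (u - v) \<le> 0" if "u \<in> nbrs E v" for u using that by (meson not_le)
    let ?f = "\<lambda>u. Arg2pi ((u - v) / (- D))"
    define u where "u = arg_min_on (\<lambda>u. - ?f u) (nbrs E v)"
    have u: "u \<in> nbrs E v" unfolding u_def
      by (rule arg_min_if_finite(1)[OF finite_nbrs[OF v] nbrs_nonempty[OF v]])
    define w where "w = next_nbr E v u"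
    have w: "w \<in> nbrs E v" unfolding w_def by (rule next_nbr_in[OF v])
    have le: "?f w \<le> ?f u"
      using arg_min_if_finite(2)[OF finite_nbrs[OF v] nbrs_nonempty[OF v], of "\<lambda>u. - ?f u"] w
      unfolding u_def by (meson neg_le_iff_le not_le)
    have up: "?f x \<le> pi" if "x \<in> nbrs E v" for x
      unfolding Arg2pi_le_pi Im_divide_cross2 using H[OF that]
      by (simp add: divide_nonpos_nonneg del: cross2_linear(3,4))
    have nz: "u - v \<noteq> 0" "w - v \<noteq> 0" using nbr_neq u w by auto
    have "(u - v) / (w - v) = ((u - v) / (- D)) / ((w - v) / (- D))"
      using D nz by (simp add: divide_simps)
    hence "Arg2pi ((u - v) / (w - v)) = ?f u - ?f w"
      using Arg2pi_divide[of "(w - v) / (- D)" "(u - v) / (- D)"] nz D le by simp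
    hence "Arg2pi ((u - v) / (w - v)) \<le> pi" using up[OF u] Arg2pi_ge_0[of "(w - v) / (- D)"] by linarith
    hence "cross2 (w - v) (u - v) \<ge> 0"
      unfolding Arg2pi_le_pi Im_divide_cross2 using nz by (simp add: zero_le_divide_iff)
    thus False using next_nbr_cross[OF u \<open>\<eta>\<^sub>0 > 0\<close>] cross2_swap[of "u - v" "w - v"] unfolding w_def by linarith
  qed
  thus ?thesis using that by blast
qed

end

section \<open>Faces seen from their edges\<close>

(* Expanding cross products bilinearly is useful in the elementary computations above only. *)
declare cross2_linear [simp del] cross2_scaleR [simp del]

definition support :: "complex set set \<Rightarrow> complex set" where
  "support F = (\<Union>e\<in>F. convex hull e)"

text \<open>For small positive \<open>\<epsilon>\<close> this point is just to the right of the midpoint, when the edge is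
  traversed from \<open>u\<close> to \<open>v\<close>. It serves as a base point of the face on that side.\<close>

definition right_germ :: "complex \<Rightarrow> complex \<Rightarrow> real \<Rightarrow> complex" where
  "right_germ u v \<epsilon> = (u + v) / 2 - \<i> * of_real \<epsilon> * (v - u)"

lemma closed_support: "finite F \<Longrightarrow> (\<And>e. e \<in> F \<Longrightarrow> finite e) \<Longrightarrow> closed (support F)"
  unfolding support_def
  using compact_imp_closed[OF compact_convex_hull[OF finite_imp_compact]] by (intro closed_UN) auto

lemma half_way: "(u + v) / 2 = v + of_real (1/2) * (u - v)" for u v :: complex
  by (rule complex_eqI) (simp_all add: field_simps)

lemma connected_component_convex:
  fixes x y :: "'a::real_normed_vector"
  assumes "convex K" "K \<subseteq> S" "x \<in> K" "y \<in> K"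
  shows "connected_component S x y"
  using connected_component_maximal[of x K S] assms convex_connected[of K] by auto

lemma tendsto_right_germ: "((\<lambda>\<epsilon>. right_germ u v \<epsilon>) \<longlongrightarrow> (u + v) / 2) (at_right 0)"
proof -
  have "((\<lambda>\<epsilon>. right_germ u v \<epsilon>) \<longlongrightarrow> (u + v) / 2 - \<i> * of_real 0 * (v - u)) (at_right 0)"
    unfolding right_germ_def by (intro tendsto_intros)
  thus ?thesis by simp
qed

context admissible_graph
begin

lemma edge_hull:
  assumes "e \<in> E" obtains p q where "e = {p, q}" "p \<noteq> q" "p \<in> \<Gamma>" "q \<in> \<Gamma>" "convex hull e = closed_segment p q"
  using edges[OF assms] by (metis segment_convex_hull)

lemma closed_support_edges: "finite F \<Longrightarrow> F \<subseteq> E \<Longrightarrow> closed (support F)"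
  using closed_support edges by (metis finite.emptyI finite.insertI subsetD)

lemma midpoint_not_in_support:
  assumes "{u, v} \<in> E" "F \<subseteq> E - {{u, v}}"
  shows "(u + v) / 2 \<notin> support F"
proof
  assume "(u + v) / 2 \<in> support F"
  then obtain e where e: "e \<in> F" "(u + v) / 2 \<in> convex hull e" by (auto simp: support_def)
  moreover have "e \<in> E" using e assms by auto
  then obtain p q where pq: "e = {p, q}" "convex hull e = closed_segment p q" by (rule edge_hull)
  have "closed_segment u v \<inter> closed_segment p q = {u, v} \<inter> {p, q}"
    using planar_edges[of u v p q] e pq assms by auto
  moreover have m: "(u + v) / 2 \<in> closed_segment u v"
    using midpoint_in_closed_segment[of u v]
    by (simp add: midpoint_def scaleR_conv_of_real mult.commute)
  ultimately have "(u + v) / 2 \<in> {u, v}" using e(2) unfolding pq(2) by blast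
  moreover have "u \<noteq> v" using edge_vertices assms by blast
  ultimately show False by (auto simp: field_simps)
qed

lemma right_germ_not_on_edge:
  assumes "u \<noteq> v" "\<epsilon> \<noteq> 0"
  shows "right_germ u v \<epsilon> \<notin> closed_segment u v"
proof
  assume "right_germ u v \<epsilon> \<in> closed_segment u v"
  then obtain t where "right_germ u v \<epsilon> = (1 - t) *\<^sub>R u + t *\<^sub>R v" by (auto simp: in_segment)
  hence "right_germ u v \<epsilon> - u = of_real t * (v - u)" by (simp add: scaleR_conv_of_real algebra_simps)
  hence 1: "cross2 (v - u) (right_germ u v \<epsilon> - u) = 0" by (simp only: cross2_linear(8,9) mult_zero_right)
  have "right_germ u v \<epsilon> - u = of_real (1/2) * (v - u) - of_real \<epsilon> * (\<i> * (v - u))"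
    by (simp add: right_germ_def field_simps)
  hence "cross2 (v - u) (right_germ u v \<epsilon> - u) = - \<epsilon> * (cmod (v - u))\<^sup>2"
    by (simp only: cross2_linear(4,8,9) cross2_rotate mult_zero_right diff_0 mult_minus_left)
  thus False using 1 assms by simp
qed

lemma right_germ_stable:
  assumes e: "{u, v} \<in> E" and F: "finite F" "F \<subseteq> E" and X: "open X" "(u + v) / 2 \<in> X"
  shows "\<exists>\<epsilon>\<^sub>0>0. \<forall>\<epsilon> \<epsilon>'. 0 < \<epsilon> \<and> \<epsilon> < \<epsilon>\<^sub>0 \<and> 0 < \<epsilon>' \<and> \<epsilon>' < \<epsilon>\<^sub>0 \<longrightarrow>
    connected_component (X - support F) (right_germ u v \<epsilon>) (right_germ u v \<epsilon>')"
proof -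
  have uv: "u \<noteq> v" using edge_vertices e by auto
  have "open (X - support (F - {{u, v}}))"
    using X closed_support_edges[of "F - {{u, v}}"] F by auto
  moreover have "(u + v) / 2 \<in> X - support (F - {{u, v}})"
    using midpoint_not_in_support[OF e, of "F - {{u,v}}"] X F by auto
  ultimately obtain r where r: "r > 0" "ball ((u + v) / 2) r \<subseteq> X - support (F - {{u, v}})"
    by (meson open_contains_ball)
  define \<epsilon>\<^sub>0 where "\<epsilon>\<^sub>0 = r / cmod (v - u)"
  define K where "K = right_germ u v ` {0<..<\<epsilon>\<^sub>0}"
  have "convex K"
  proof -
    have "right_germ u v ` {0<..<\<epsilon>\<^sub>0} = (\<lambda>z. (u + v) / 2 + z) ` ((\<lambda>\<epsilon>. \<epsilon> *\<^sub>R (- \<i> * (v - u))) ` {0<..<\<epsilon>\<^sub>0})"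
      by (auto simp: right_germ_def scaleR_conv_of_real image_image intro!: image_cong)
    moreover have "linear (\<lambda>\<epsilon>::real. \<epsilon> *\<^sub>R (- \<i> * (v - u)))" by (intro linearI) (auto simp: algebra_simps)
    ultimately show ?thesis unfolding K_def
      using convex_translation[OF convex_linear_image[OF _ convex_real_interval(8)]] by simp
  qed
  moreover have "K \<subseteq> X - support F"
  proof
    fix z assume "z \<in> K"
    then obtain \<epsilon> where z: "z = right_germ u v \<epsilon>" "0 < \<epsilon>" "\<epsilon> < \<epsilon>\<^sub>0" by (auto simp: K_def)
    have "dist z ((u + v) / 2) = \<epsilon> * cmod (v - u)"
      using z by (simp add: right_germ_def dist_norm norm_mult)
    also have "\<dots> < r" using z uv by (simp add: \<epsilon>\<^sub>0_def field_simps)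
    finally have "z \<in> X - support (F - {{u, v}})" using r by (auto simp: dist_commute)
    moreover have "z \<notin> closed_segment u v" using right_germ_not_on_edge[OF uv] z by auto
    ultimately show "z \<in> X - support F" by (auto simp: support_def segment_convex_hull)
  qed
  ultimately have "connected_component (X - support F) (right_germ u v \<epsilon>) (right_germ u v \<epsilon>')"
    if "0 < \<epsilon> \<and> \<epsilon> < \<epsilon>\<^sub>0 \<and> 0 < \<epsilon>' \<and> \<epsilon>' < \<epsilon>\<^sub>0" for \<epsilon> \<epsilon>'
    using connected_component_convex[of K "X - support F" "right_germ u v \<epsilon>" "right_germ u v \<epsilon>'"] that
    unfolding K_def by (simp del: cross2_linear)
  note conn = this
  have "\<epsilon>\<^sub>0 > 0" using r uv by (simp add: \<epsilon>\<^sub>0_def)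
  thus ?thesis using conn by (intro exI[of _ \<epsilon>\<^sub>0] conjI allI impI) auto
qed

text \<open>The closed part of the edge from \<open>v\<close> to beyond its midpoint has a positive distance from all edges that do not
  end in \<open>v\<close>, and those that end in \<open>v\<close> avoid the cone. Three quarters of the edge are enough to pass the midpoint.\<close>

lemma empty_strip:
  assumes u: "u \<in> nbrs E v" and F: "finite F" "F \<subseteq> E"
    and cone: "\<And>y s t. y \<in> nbrs E v \<Longrightarrow> s > 0 \<Longrightarrow> t > 0 \<Longrightarrow> y - v \<noteq> of_real s * (u - v) + of_real t * n"
  shows "\<exists>\<delta>>0. \<forall>s t. 0 < s \<and> s \<le> 3/4 \<and> 0 < t \<and> t < \<delta> \<longrightarrow>
    v + of_real s * (u - v) + of_real t * n \<notin> support F"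
proof -
  define F' where "F' = {e \<in> F. v \<notin> e}"
  define S where "S = closed_segment v (v + of_real (3/4) * (u - v))"
  have uv: "u \<noteq> v" "{v, u} \<in> E" using u nbr_neq by (auto simp: in_nbrs_iff)
  have Sin: "S \<subseteq> closed_segment v u - {u}"
  proof
    fix z assume "z \<in> S"
    then obtain a where a: "0 \<le> a" "a \<le> 1" "z = (1 - a) *\<^sub>R v + a *\<^sub>R (v + of_real (3/4) * (u - v))"
      by (auto simp: S_def in_segment)
    hence z: "z = v + of_real (3/4 * a) * (u - v)" by (simp add: scaleR_conv_of_real algebra_simps)
    hence "z \<in> closed_segment v u" using point_in_closed_segment[of "3/4*a" v u] a by simp
    moreover have "z \<noteq> u"
    proof
      assume "z = u"
      hence "of_real (1 - 3/4 * a) * (u - v) = 0" using z by (simp add: algebra_simps)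
      thus False using uv a by (auto simp: complex_eq_iff)
    qed
    ultimately show "z \<in> closed_segment v u - {u}" by simp
  qed
  have "S \<inter> support F' = {}"
  proof (rule ccontr)
    assume "S \<inter> support F' \<noteq> {}"
    then obtain z e where z: "z \<in> S" "e \<in> F'" "z \<in> convex hull e" by (auto simp: support_def)
    have "e \<in> E" using z F by (auto simp: F'_def)
    then obtain p q where pq: "e = {p, q}" "convex hull e = closed_segment p q" by (rule edge_hull)
    have ne: "{v, u} \<noteq> {p, q}" using z pq by (auto simp: F'_def)
    have "z \<in> {v, u} \<inter> {p, q}"
      using planar_edges[of v u p q] uv \<open>e \<in> E\<close> pq ne z Sin by auto
    thus False using z Sin pq by (auto simp: F'_def)
  qed
  moreover have "closed (support F')" using closed_support_edges[of F'] F by (auto simp: F'_def)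
  moreover have "compact S" by (simp add: S_def)
  ultimately obtain d where d: "d > 0" "\<And>x y. x \<in> S \<Longrightarrow> y \<in> support F' \<Longrightarrow> d \<le> dist x y"
    using separate_compact_closed by meson
  define \<delta> where "\<delta> = d / (cmod n + 1)"
  have "v + of_real s * (u - v) + of_real t * n \<notin> support F"
    if st: "0 < s" "s \<le> 3/4" "0 < t" "t < \<delta>" for s t
  proof
    define z where "z = v + of_real s * (u - v) + of_real t * n"
    assume "v + of_real s * (u - v) + of_real t * n \<in> support F"
    then obtain e where e: "e \<in> F" "z \<in> convex hull e" by (auto simp: support_def z_def)
    show False
    proof (cases "v \<in> e")
      case False
      hence "z \<in> support F'" using e by (auto simp: support_def F'_def)
      moreover have "v + of_real s * (u - v) \<in> S"
      proof -
        have "v + of_real (s / (3/4)) * ((v + of_real (3/4) * (u - v)) - v) \<in> S"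
          unfolding S_def by (rule point_in_closed_segment) (use st in auto)
        moreover have "of_real (s / (3/4)) * ((v + of_real (3/4) * (u - v)) - v) = of_real s * (u - v)"
          by simp
        ultimately show ?thesis by (simp only:)
      qed
      ultimately have "d \<le> dist (v + of_real s * (u - v)) z" using d by blast
      also have "\<dots> = t * cmod n" using st by (simp add: z_def dist_norm norm_mult)
      also have "\<dots> \<le> t * (cmod n + 1)" using st by (simp add: algebra_simps)
      also have "\<dots> < d" using st unfolding \<delta>_def by (simp add: field_simps add_pos_nonneg)
      finally show False by simp
    next
      case True
      have "e \<in> E" using e F by auto
      then obtain p q where pq: "e = {p, q}" "convex hull e = closed_segment p q" by (rule edge_hull)
      obtain y where y: "e = {v, y}" using True pq by (auto simp: insert_commute)
      hence yn: "y \<in> nbrs E v" using \<open>e \<in> E\<close> by (simp add: in_nbrs_iff)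
      have "z \<in> closed_segment v y" using e y by (simp add: segment_convex_hull)
      then obtain a where a: "0 \<le> a" "a \<le> 1" "z = (1 - a) *\<^sub>R v + a *\<^sub>R y" by (auto simp: in_segment)
      have za: "z - v = of_real a * (y - v)" using a by (simp add: scaleR_conv_of_real algebra_simps)
      have zn: "z - v = of_real s * (u - v) + of_real t * n" by (simp add: z_def)
      have "a \<noteq> 0"
      proof
        assume "a = 0"
        hence "of_real s * (u - v) + of_real t * n = 0" using za zn by simp
        hence "u - v = of_real (1 + s) * (u - v) + of_real t * n" by (simp add: algebra_simps)
        thus False using cone[OF u, of "1 + s" t] st by simp
      qed
      hence "y - v = of_real (s / a) * (u - v) + of_real (t / a) * n"
        using za zn by (simp add: field_simps)
      thus False using cone[OF yn, of "s / a" "t / a"] st a \<open>a \<noteq> 0\<close> by simp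
    qed
  qed
  moreover have "\<delta> > 0" using d by (simp add: \<delta>_def add_nonneg_pos)
  ultimately show ?thesis by blast
qed

lemma next_nbr_cone:
  assumes u: "u \<in> nbrs E v" and y: "y \<in> nbrs E v" and "s > 0" "t > 0" and eta: "\<eta>\<^sub>0 > 0"
  shows "y - v \<noteq> of_real s * (u - v) + of_real t * (next_nbr E v u - v)"
proof
  define w where "w = next_nbr E v u"
  assume a: "y - v = of_real s * (u - v) + of_real t * (next_nbr E v u - v)"
  have c: "cross2 (u - v) (w - v) > 0" unfolding w_def by (rule next_nbr_cross[OF u eta])
  have "cross2 (u - v) (y - v) = t * cross2 (u - v) (w - v)"
    unfolding a w_def[symmetric] by (simp only: cross2_linear(2,8,9) mult_zero_right add_0)
  moreover have "cross2 (y - v) (w - v) = s * cross2 (u - v) (w - v)"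
    unfolding a w_def[symmetric] by (simp only: cross2_linear(1,7,9) mult_zero_right add_0_right)
  ultimately show False
    using next_nbr_empty_cone[OF u y eta] c assms by (simp add: w_def del: cross2_linear)
qed

text \<open>Turning counterclockwise from \<open>u\<close> to the next neighbour of \<open>v\<close>, one keeps the same face on the right: the
  empty strips along the two edges overlap near \<open>v\<close>, and each contains the base points at its edge.\<close>

lemma corner_sector_full:
  assumes u: "u \<in> nbrs E v" and x: "x = next_nbr E v u" and F: "finite F" "F \<subseteq> E"
    and X: "convex X" "u \<in> X" "v \<in> X" "x \<in> X" and eta: "\<eta>\<^sub>0 > 0"
  shows "\<exists>\<epsilon>\<^sub>0>0. \<forall>\<epsilon>. 0 < \<epsilon> \<and> \<epsilon> < \<epsilon>\<^sub>0 \<longrightarrow>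
    connected_component (X - support F) (right_germ u v \<epsilon>) (right_germ v x \<epsilon>) \<and>
    connected_component (X - support F) (right_germ u v \<epsilon>)
      (v + (of_real \<epsilon> * (u - v) + of_real \<epsilon> * (x - v)))"
proof -
  have c: "cross2 (u - v) (x - v) > 0" unfolding x by (rule next_nbr_cross[OF u eta])
  have wn: "x \<in> nbrs E v" unfolding x using next_nbr_in nbr_vertices[OF u] by blast
  have ne: "u \<noteq> v" "x \<noteq> v" using nbr_neq u wn by auto
  obtain d1 where d1: "d1 > 0" "\<And>s t. 0 < s \<and> s \<le> 3/4 \<and> 0 < t \<and> t < d1 \<Longrightarrow>
      v + of_real s * (u - v) + of_real t * (x - v) \<notin> support F"
    using empty_strip[OF u F, of "x - v"] next_nbr_cone[OF u _ _ _ eta] unfolding x by blast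
  obtain d2 where d2: "d2 > 0" "\<And>s t. 0 < s \<and> s \<le> 3/4 \<and> 0 < t \<and> t < d2 \<Longrightarrow>
      v + of_real s * (x - v) + of_real t * (u - v) \<notin> support F"
  proof -
    have "y - v \<noteq> of_real s * (x - v) + of_real t * (u - v)"
      if "y \<in> nbrs E v" "s > 0" "t > 0" for y s t
      using next_nbr_cone[OF u that(1,3,2) eta] unfolding x by (simp add: add.commute)
    from empty_strip[OF wn F this] show ?thesis using that by blast
  qed
  define \<delta> where "\<delta> = min (min d1 d2) (1/4)"
  \<comment> \<open>Coordinates with origin \<open>v\<close> and the two edges as axes. The first strip \<open>K1\<close> follows the edge to
    \<open>u\<close>, the second strip \<open>K2\<close> the edge to \<open>x\<close>; \<open>A\<close>, \<open>B\<close> and \<open>A'\<close>, \<open>B'\<close>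
    are the coordinates of the normals of these edges.\<close>
  define f where "f = (\<lambda>(s::real, t::real). v + (of_real s * (u - v) + of_real t * (x - v)))"
  define K1 where "K1 = f ` ({0<..3/4} \<times> {0<..<\<delta>})"
  define K2 where "K2 = f ` ({0<..<\<delta>} \<times> {0<..3/4})"
  have dpos: "\<delta> > 0" using d1 d2 by (simp add: \<delta>_def)
  have lin: "linear (\<lambda>(s::real, t::real). of_real s * (u - v) + of_real t * (x - v))"
    by (rule linearI) (auto simp: algebra_simps scaleR_conv_of_real)
  have conv: "convex (f ` (A \<times> B))" if "convex A" "convex B" for A B
  proof -
    have "f ` (A \<times> B) = (\<lambda>z. v + z) ` ((\<lambda>(s::real, t::real). of_real s * (u - v) + of_real t * (x - v)) ` (A \<times> B))"
      by (auto simp: f_def image_image intro!: image_cong)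
    thus ?thesis
      using convex_translation[OF convex_linear_image[OF lin convex_Times[OF that]], of v] by simp
  qed
  have fX: "f (s, t) \<in> X" if "0 \<le> s" "0 \<le> t" "s + t \<le> 1" for s t
  proof -
    have "f (s, t) = (1 - s - t) *\<^sub>R v + s *\<^sub>R u + t *\<^sub>R x"
      by (simp add: f_def scaleR_conv_of_real algebra_simps)
    moreover have "(1 - s - t) *\<^sub>R v + s *\<^sub>R u + t *\<^sub>R x \<in> X"
    proof -
      have "(1 - s - t) *\<^sub>R v + s *\<^sub>R u + t *\<^sub>R x \<in> convex hull {v, u, x}"
        unfolding convex_hull_3 using that
        by (intro CollectI exI[of _ "1 - s - t"] exI[of _ s] exI[of _ t]) auto
      thus ?thesis using hull_minimal[of "{v, u, x}" X convex] X by auto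
    qed
    ultimately show ?thesis by simp
  qed
  have K: "K1 \<subseteq> X - support F" "K2 \<subseteq> X - support F"
  proof -
    have "f (s, t) \<in> X - support F" if "0 < s" "s \<le> 3/4" "0 < t" "t < \<delta>" for s t
      using fX[of s t] d1(2)[of s t] that by (simp add: \<delta>_def f_def add.assoc)
    thus "K1 \<subseteq> X - support F" by (auto simp: K1_def)
    have "f (s, t) \<in> X - support F" if "0 < t" "t \<le> 3/4" "0 < s" "s < \<delta>" for s t
      using fX[of s t] d2(2)[of t s] that by (simp add: \<delta>_def f_def algebra_simps)
    thus "K2 \<subseteq> X - support F" by (auto simp: K2_def)
  qed
  have "\<delta> \<le> 1/4" by (simp add: \<delta>_def)
  hence z: "f (\<delta>/2, \<delta>/2) \<in> K1" "f (\<delta>/2, \<delta>/2) \<in> K2"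
    unfolding K1_def K2_def using dpos by (auto intro!: imageI)
  define c0 where "c0 = cross2 (u - v) (x - v)"
  have c0: "c0 > 0" using c by (simp add: c0_def)
  define A where "A = cross2 (\<i> * (u - v)) (x - v) / c0"
  define B where "B = cross2 (u - v) (\<i> * (u - v)) / c0"
  have "\<i> * (u - v) = of_real A * (u - v) + of_real B * (x - v)"
    unfolding A_def B_def c0_def by (rule cross2_cramer) (use c in simp)
  note eq1 = this
  have g1: "right_germ u v \<epsilon> = f (1/2 + \<epsilon> * A, \<epsilon> * B)" for \<epsilon>
  proof -
    have "right_germ u v \<epsilon> = v + (of_real (1/2) * (u - v) + of_real \<epsilon> * (\<i> * (u - v)))"
      unfolding right_germ_def half_way[of u v] by algebra
    also have "\<dots> = f (1/2 + \<epsilon> * A, \<epsilon> * B)" unfolding eq1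
      by (simp only: f_def prod.case of_real_add of_real_mult) algebra
    finally show ?thesis .
  qed
  define A' where "A' = cross2 (- \<i> * (x - v)) (x - v) / c0"
  define B' where "B' = cross2 (u - v) (- \<i> * (x - v)) / c0"
  have "- \<i> * (x - v) = of_real A' * (u - v) + of_real B' * (x - v)"
    unfolding A'_def B'_def c0_def by (rule cross2_cramer) (use c in simp)
  note eq2 = this
  have g2: "right_germ v x \<epsilon> = f (\<epsilon> * A', 1/2 + \<epsilon> * B')" for \<epsilon>
  proof -
    have "right_germ v x \<epsilon> = v + (of_real (1/2) * (x - v) + of_real \<epsilon> * (- \<i> * (x - v)))"
      unfolding right_germ_def add.commute[of v x] half_way[of x v] by algebra
    also have "\<dots> = f (\<epsilon> * A', 1/2 + \<epsilon> * B')" unfolding eq2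
      by (simp only: f_def prod.case of_real_add of_real_mult) algebra
    finally show ?thesis .
  qed
  have Bpos: "B > 0" unfolding B_def cross2_rotate using c0 ne by simp
  have Apos: "A' > 0" unfolding A'_def cross2_rotate using c0 ne by simp
  define \<epsilon>\<^sub>0 where "\<epsilon>\<^sub>0 = min (min (min (\<delta> / B) \<delta>) (\<delta> / A')) (min (1 / (4 * (\<bar>A\<bar> + 1))) (1 / (4 * (\<bar>B'\<bar> + 1))))"
  have bound: "\<bar>\<epsilon> * a\<bar> < 1/4" if "0 < \<epsilon>" "\<epsilon> < 1 / (4 * (\<bar>a\<bar> + 1))" for \<epsilon> a :: real
  proof -
    have "0 < 4 * (\<bar>a\<bar> + 1)" using abs_ge_zero[of a] by (simp add: add_nonneg_pos)
    hence "\<epsilon> * (4 * (\<bar>a\<bar> + 1)) < 1" using that(2) by (simp only: pos_less_divide_eq)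
    moreover have "\<bar>\<epsilon> * a\<bar> = \<epsilon> * \<bar>a\<bar>" using that by (simp add: abs_mult)
    moreover have "\<epsilon> * (4 * (\<bar>a\<bar> + 1)) = 4 * (\<epsilon> * \<bar>a\<bar>) + 4 * \<epsilon>" by (simp add: algebra_simps)
    ultimately show ?thesis using that(1) by linarith
  qed
  have fin: "connected_component (X - support F) (right_germ u v \<epsilon>) (right_germ v x \<epsilon>) \<and>
    connected_component (X - support F) (right_germ u v \<epsilon>)
      (v + (of_real \<epsilon> * (u - v) + of_real \<epsilon> * (x - v)))"
    if e: "0 < \<epsilon>" "\<epsilon> < \<epsilon>\<^sub>0" for \<epsilon>
  proof -
    have "\<epsilon> < 1 / (4 * (\<bar>A\<bar> + 1))" "\<epsilon> < 1 / (4 * (\<bar>B'\<bar> + 1))"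
      using e(2) unfolding \<epsilon>\<^sub>0_def by linarith+
    hence "\<bar>\<epsilon> * A\<bar> < 1/4" "\<bar>\<epsilon> * B'\<bar> < 1/4" by (auto intro: bound[OF e(1)] simp only:)
    moreover have "\<epsilon> * B < \<delta>" "\<epsilon> * A' < \<delta>" using e Apos Bpos by (auto simp: \<epsilon>\<^sub>0_def pos_less_divide_eq)
    ultimately have "right_germ u v \<epsilon> \<in> K1" "right_germ v x \<epsilon> \<in> K2"
      unfolding K1_def K2_def g1 g2 using e Apos Bpos by (auto intro!: imageI)
    note g = this
    have cv: "convex K1" "convex K2"
      unfolding K1_def K2_def by (intro conv convex_real_interval)+
    have "\<epsilon> < \<delta>" using e(2) unfolding \<epsilon>\<^sub>0_def by linarith
    hence "(\<epsilon>, \<epsilon>) \<in> {0<..3/4} \<times> {0<..<\<delta>}" using e(1) \<open>\<delta> \<le> 1/4\<close> by auto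
    hence "f (\<epsilon>, \<epsilon>) \<in> K1" unfolding K1_def by (rule imageI)
    hence c1: "connected_component (X - support F) (right_germ u v \<epsilon>) (f (\<epsilon>, \<epsilon>))"
      by (rule connected_component_convex[OF cv(1) K(1) g(1)])
    have "connected_component (X - support F) (right_germ u v \<epsilon>) (f (\<delta>/2, \<delta>/2))"
      by (rule connected_component_convex[OF cv(1) K(1) g(1) z(1)])
    moreover have "connected_component (X - support F) (f (\<delta>/2, \<delta>/2)) (right_germ v x \<epsilon>)"
      by (rule connected_component_convex[OF cv(2) K(2) z(2) g(2)])
    ultimately show ?thesis using c1 connected_component_trans unfolding f_def by fastforce
  qed
  have "\<epsilon>\<^sub>0 > 0" using Apos Bpos dpos by (simp add: \<epsilon>\<^sub>0_def add_nonneg_pos)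
  thus ?thesis using fin by (intro exI[of _ \<epsilon>\<^sub>0] conjI allI impI) auto
qed

lemma corner_sector:
  assumes u: "u \<in> nbrs E v" and x: "x = next_nbr E v u" and F: "finite F" "F \<subseteq> E"
    and X: "convex X" "u \<in> X" "v \<in> X" "x \<in> X" and eta: "\<eta>\<^sub>0 > 0"
  shows "\<exists>\<epsilon>\<^sub>0>0. \<forall>\<epsilon>. 0 < \<epsilon> \<and> \<epsilon> < \<epsilon>\<^sub>0 \<longrightarrow>
    connected_component (X - support F) (right_germ u v \<epsilon>) (right_germ v x \<epsilon>)"
  using corner_sector_full[OF assms] by auto

end

section \<open>Winding numbers of closed walks\<close>

definition turn :: "complex \<Rightarrow> complex \<Rightarrow> complex \<Rightarrow> real" where
  "turn x y z = Arg ((y - z) / (x - z)) / (2 * pi)"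

definition steps :: "'a list \<Rightarrow> ('a \<times> 'a) list" where
  "steps xs = zip xs (tl xs)"

definition wind :: "complex list \<Rightarrow> complex \<Rightarrow> real" where
  "wind xs z = (\<Sum>(x, y)\<leftarrow>steps xs. turn x y z)"

definition walk_trace :: "complex list \<Rightarrow> complex set" where
  "walk_trace xs = (\<Union>(x, y)\<in>set (steps xs). closed_segment x y)"

lemma steps_simps [simp]:
  "steps [] = []" "steps [x] = []" "steps (x # y # zs) = (x, y) # steps (y # zs)"
  by (simp_all add: steps_def)

lemma steps_append: "steps (as @ y # bs) = steps (as @ [y]) @ steps (y # bs)"
  by (induction as rule: induct_list012) auto

lemma steps_rev: "steps (rev xs) = rev (map prod.swap (steps xs))"
proof (induction xs rule: induct_list012)
  case (3 x y zs)
  have "steps (rev (x # y # zs)) = steps (rev zs @ [y]) @ steps [y, x]"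
    using steps_append[of "rev zs" y "[x]"] by simp
  thus ?case using 3 by simp
qed auto

lemma set_steps_subset: "(x, y) \<in> set (steps xs) \<Longrightarrow> x \<in> set xs \<and> y \<in> set xs"
  unfolding steps_def using set_zip_leftD set_zip_rightD by (metis list.set_sel(2) tl_Nil)

lemma walk_simps:
  "walk F [x]" "walk F (x # y # zs) \<longleftrightarrow> {x, y} \<in> F \<and> walk F (y # zs)" "\<not> walk F []"
  by (simp_all add: walk_def)

lemma walk_iff_steps: "walk F xs \<longleftrightarrow> xs \<noteq> [] \<and> (\<forall>(x, y)\<in>set (steps xs). {x, y} \<in> F)"
  by (induction xs rule: induct_list012) (auto simp: walk_simps)

lemma walk_append: "walk F (as @ y # bs) \<longleftrightarrow> walk F (as @ [y]) \<and> walk F (y # bs)"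
  unfolding walk_iff_steps steps_append[of as y bs] by auto

lemma walk_rev: "walk F (rev xs) \<longleftrightarrow> walk F xs"
  unfolding walk_iff_steps steps_rev by (auto simp: insert_commute)

lemma wind_append: "wind (as @ y # bs) z = wind (as @ [y]) z + wind (y # bs) z"
  unfolding wind_def steps_append[of as y bs] by simp

lemma not_on_segment_quotient:
  fixes x y z :: complex
  assumes "z \<notin> closed_segment x y"
  shows "x \<noteq> z" "y \<noteq> z" "(y - z) / (x - z) \<notin> \<real>\<^sub>\<le>\<^sub>0"
proof -
  show xz: "x \<noteq> z" and "y \<noteq> z" using assms by auto
  show "(y - z) / (x - z) \<notin> \<real>\<^sub>\<le>\<^sub>0"
  proof
    assume "(y - z) / (x - z) \<in> \<real>\<^sub>\<le>\<^sub>0"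
    then obtain r where r: "(y - z) / (x - z) = of_real r" "r \<le> 0"
      by (auto elim!: nonpos_Reals_cases)
    have "y - z = ((y - z) / (x - z)) * (x - z)" using xz by simp
    hence "y - z = of_real r * (x - z)" unfolding r(1) .
    hence "z * of_real (1 - r) = y - of_real r * x" by (simp add: algebra_simps)
    moreover have "complex_of_real (1 - r) \<noteq> 0" using r by (simp only: of_real_eq_0_iff)
    ultimately have "z = (y - of_real r * x) / of_real (1 - r)" by (simp add: field_simps)
    also have "\<dots> = x + of_real (1 / (1 - r)) * (y - x)"
      using \<open>complex_of_real (1 - r) \<noteq> 0\<close> by (simp add: field_simps)
    also have "\<dots> \<in> closed_segment x y" using r by (intro point_in_closed_segment) auto
    finally show False using assms by simp
  qed
qed

lemma isCont_turn:
  assumes "z \<notin> closed_segment x y"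
  shows "isCont (turn x y) z"
  unfolding turn_def
  using not_on_segment_quotient[OF assms]
  by (intro continuous_intros continuous_within_compose3[OF continuous_at_Arg]) auto

lemma isCont_wind:
  assumes "z \<notin> walk_trace xs"
  shows "isCont (wind xs) z"
  using assms
proof (induction xs rule: induct_list012)
  case (3 x y zs)
  have "wind (x # y # zs) = (\<lambda>z. turn x y z + wind (y # zs) z)" by (auto simp: wind_def)
  moreover have "isCont (turn x y) z" "isCont (wind (y # zs)) z"
    using 3 by (auto simp: walk_trace_def intro: isCont_turn)
  ultimately show ?case by simp
next
  case 1
  have "wind [] = (\<lambda>z. 0)" by (auto simp: wind_def)
  thus ?case by simp
next
  case (2 x)
  have "wind [x] = (\<lambda>z. 0)" by (auto simp: wind_def)
  thus ?case by simp
qed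

lemma set_subset_walk_trace: "length xs \<ge> 2 \<Longrightarrow> set xs \<subseteq> walk_trace xs"
proof (induction xs rule: induct_list012)
  case (3 x y zs)
  show ?case
  proof (cases zs)
    case (Cons a as)
    hence "set (y # zs) \<subseteq> walk_trace (y # zs)" using 3 by simp
    thus ?thesis by (auto simp: walk_trace_def)
  qed (auto simp: walk_trace_def)
qed auto

text \<open>The angles add up to the argument of the quotient of the last and the first point, both seen from \<open>z\<close>. For a
  closed walk this quotient is one, so that its winding number is an integer, and is constant on components.\<close>

lemma cis_wind:
  assumes "xs \<noteq> []" "z \<notin> set xs"
  shows "cis (2 * pi * wind xs z) = sgn ((last xs - z) / (hd xs - z))"
  using assms
proof (induction xs rule: induct_list012)
  case (3 x y zs)
  have nz: "(y - z) / (x - z) \<noteq> 0" "y - z \<noteq> 0" using 3 by auto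
  have "cis (2 * pi * wind (x # y # zs) z) = cis (2 * pi * turn x y z) * cis (2 * pi * wind (y # zs) z)"
    by (simp add: wind_def cis_mult algebra_simps)
  also have "cis (2 * pi * turn x y z) = sgn ((y - z) / (x - z))"
    unfolding turn_def using cis_Arg[OF nz(1)] by simp
  also have "cis (2 * pi * wind (y # zs) z) = sgn ((last (y # zs) - z) / (y - z))"
    using 3 by simp
  also have "sgn ((y - z) / (x - z)) * sgn ((last (y # zs) - z) / (y - z)) = sgn ((last (y # zs) - z) / (x - z))"
    unfolding sgn_mult[symmetric] using nz by simp
  finally show ?case by simp
qed (auto simp: wind_def)

lemma wind_integer:
  assumes "xs \<noteq> []" "hd xs = last xs" "z \<notin> walk_trace xs"
  shows "wind xs z \<in> \<int>"
proof (cases "length xs \<ge> 2")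
  case True
  hence z: "z \<notin> set xs" using set_subset_walk_trace assms by blast
  hence "last xs - z \<noteq> 0" using assms by auto
  hence "cis (2 * pi * wind xs z) = 1" using cis_wind[OF assms(1) z] assms(2) by simp
  hence "cos (2 * pi * wind xs z) = 1" by (metis cis.sel(1) one_complex.sel(1))
  then obtain n :: int where "2 * pi * wind xs z = real_of_int n * 2 * pi" unfolding cos_one_2pi_int by blast
  hence "wind xs z = n" by simp
  thus ?thesis by simp
next
  case False
  hence "length xs = 1" using assms(1) by (cases xs; cases "tl xs") auto
  then obtain x where "xs = [x]" by (auto simp: length_Suc_conv)
  thus ?thesis by (simp add: wind_def)
qed

lemma wind_constant:
  assumes "xs \<noteq> []" "hd xs = last xs" "connected_component (- walk_trace xs) z z'"
  shows "wind xs z = wind xs z'"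
proof -
  obtain S where S: "connected S" "S \<subseteq> - walk_trace xs" "z \<in> S" "z' \<in> S"
    using assms(3) unfolding connected_component_def by blast
  have "continuous_on S (wind xs)"
    using S(2) isCont_wind by (intro continuous_at_imp_continuous_on) auto
  moreover have "\<exists>e>0. \<forall>y. y \<in> S \<and> wind xs y \<noteq> wind xs x \<longrightarrow> e \<le> norm (wind xs y - wind xs x)"
    if "x \<in> S" for x
  proof (intro exI[of _ 1] conjI allI impI)
    fix y assume y: "y \<in> S \<and> wind xs y \<noteq> wind xs x"
    have "wind xs y - wind xs x \<in> \<int>"
      using wind_integer[OF assms(1,2)] y that S(2) by (intro Ints_diff) auto
    thus "1 \<le> norm (wind xs y - wind xs x)" using y Ints_nonzero_abs_ge1 by force
  qed simp
  ultimately have "wind xs constant_on S" by (rule continuous_discrete_range_constant[OF S(1)])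
  thus ?thesis using S unfolding constant_on_def by auto
qed

lemma turn_at_infinity: "((\<lambda>z. turn x y z) \<longlongrightarrow> 0) at_infinity"
proof -
  have "filterlim (\<lambda>z. x - z) at_infinity at_infinity"
  proof -
    have "\<exists>b. \<forall>z::complex. b \<le> norm z \<longrightarrow> Z \<le> norm (x - z)" for Z
    proof (rule exI[of _ "Z + norm x"], intro allI impI)
      fix z :: complex assume "Z + norm x \<le> norm z"
      thus "Z \<le> norm (x - z)" using norm_triangle_ineq2[of z x] norm_minus_commute[of x z] by linarith
    qed
    thus ?thesis
      unfolding filterlim_at_infinity_conv_norm_at_top filterlim_at_top eventually_at_infinity by (intro allI)
  qed
  hence "((\<lambda>z. 1 + (y - x) / (x - z)) \<longlongrightarrow> 1 + 0) at_infinity"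
    by (intro tendsto_add tendsto_const tendsto_divide_0[OF tendsto_const])
  hence "((\<lambda>z. Arg (1 + (y - x) / (x - z))) \<longlongrightarrow> Arg (1 + 0)) at_infinity"
    by (rule tendsto_Arg) auto
  hence "((\<lambda>z. Arg (1 + (y - x) / (x - z)) / (2 * pi)) \<longlongrightarrow> Arg (1 + 0) / (2 * pi)) at_infinity"
    by (rule tendsto_divide[OF _ tendsto_const]) auto
  moreover have "eventually (\<lambda>z. Arg (1 + (y - x) / (x - z)) / (2 * pi) = turn x y z) at_infinity"
  proof -
    have "1 + (y - x) / (x - z) = (y - z) / (x - z)" if "norm x + 1 \<le> norm z" for z
    proof -
      have "x \<noteq> z" using that by auto
      thus ?thesis by (simp add: field_simps)
    qed
    thus ?thesis unfolding eventually_at_infinity turn_def by metis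
  qed
  ultimately show ?thesis by (simp add: tendsto_cong)
qed

lemma wind_at_infinity: "((\<lambda>z. wind xs z) \<longlongrightarrow> 0) at_infinity"
proof (induction xs rule: induct_list012)
  case (3 x y zs)
  have "((\<lambda>z. turn x y z + wind (y # zs) z) \<longlongrightarrow> 0 + 0) at_infinity"
    by (intro tendsto_add turn_at_infinity 3)
  thus ?case by (simp add: wind_def)
qed (auto simp: wind_def)

text \<open>Far away the walk is seen under small angles only.\<close>

lemma wind_unbounded_component:
  assumes xs: "xs \<noteq> []" "hd xs = last xs"
    and unb: "\<not> bounded (connected_component_set (- walk_trace xs) z)"
  shows "wind xs z = 0"
proof -
  have "eventually (\<lambda>z. dist (wind xs z) 0 < 1) at_infinity"
    using wind_at_infinity by (rule tendstoD) simp
  then obtain R where R: "\<And>z. norm z \<ge> R \<Longrightarrow> \<bar>wind xs z\<bar> < 1"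
    unfolding eventually_at_infinity by auto
  obtain z' where z': "connected_component (- walk_trace xs) z z'" "norm z' \<ge> R"
  proof -
    have "\<exists>z'\<in>connected_component_set (- walk_trace xs) z. \<not> norm z' \<le> R"
      using unb unfolding bounded_iff by blast
    thus ?thesis using that by (auto simp: not_le intro: less_imp_le)
  qed
  have "z' \<notin> walk_trace xs" using z'(1) connected_component_in by blast
  hence "wind xs z' \<in> \<int>" by (rule wind_integer[OF xs])
  hence "wind xs z' = 0" using R[OF z'(2)] Ints_nonzero_abs_ge1 by force
  thus ?thesis using wind_constant[OF xs z'(1)] by simp
qed

lemma turn_swap:
  assumes "z \<notin> closed_segment x y"
  shows "turn y x z = - turn x y z"
proof -
  have nz: "(y - z) / (x - z) \<notin> \<real>\<^sub>\<le>\<^sub>0" "x \<noteq> z" "y \<noteq> z" using not_on_segment_quotient[OF assms] by auto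
  have "(x - z) / (y - z) = inverse ((y - z) / (x - z))" by simp
  moreover have "(y - z) / (x - z) \<in> \<real> \<Longrightarrow> Arg ((y - z) / (x - z)) = 0"
    using nz(1) by (auto simp: Arg_real complex_nonpos_Reals_iff complex_is_Real_iff)
  ultimately have "Arg ((x - z) / (y - z)) = - Arg ((y - z) / (x - z))"
    using Arg_inverse[of "(y - z) / (x - z)"] by (metis minus_zero)
  thus ?thesis unfolding turn_def by simp
qed

text \<open>Close to the edge its end points are seen in almost opposite directions. The signed angle between them tends to
  \<open>-\<pi>\<close> on the right-hand side and to \<open>\<pi>\<close> on the left-hand side, which makes one full turn.\<close>

lemma turn_right_limit:
  assumes "u \<noteq> v"
  shows "((\<lambda>\<epsilon>. turn u v (right_germ u v \<epsilon>)) \<longlongrightarrow> - (1/2)) (at_right 0)"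
proof -
  define q where "q = (\<lambda>\<epsilon>::real. (1/2 + \<i> * of_real \<epsilon>) / (1/2 - \<i> * of_real \<epsilon>))"
  have nz: "1/2 - \<i> * complex_of_real \<epsilon> \<noteq> 0" for \<epsilon> by (auto simp: complex_eq_iff)
  have eq: "turn u v (right_germ u v \<epsilon>) = (Arg (q \<epsilon>) - pi) / (2 * pi)" if e: "\<epsilon> > 0" for \<epsilon>
  proof -
    have a: "v - right_germ u v \<epsilon> = (v - u) * (1/2 + \<i> * of_real \<epsilon>)"
      by (simp add: right_germ_def field_simps)
    have b: "u - right_germ u v \<epsilon> = - ((v - u) * (1/2 - \<i> * of_real \<epsilon>))"
      by (simp add: right_germ_def field_simps)
    have "(v - right_germ u v \<epsilon>) / (u - right_germ u v \<epsilon>) = - q \<epsilon>"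
      unfolding a b q_def using assms by simp
    moreover have "Im (q \<epsilon>) > 0"
    proof -
      have "q \<epsilon> = (1/2 + \<i> * of_real \<epsilon>) * (1/2 + \<i> * of_real \<epsilon>) / of_real (1/4 + \<epsilon>\<^sup>2)"
      proof -
        have "(1/2 - \<i> * of_real \<epsilon>) * (1/2 + \<i> * of_real \<epsilon>) = complex_of_real (1/4 + \<epsilon>\<^sup>2)"
          by (simp add: complex_eq_iff power2_eq_square)
        moreover have "1/2 + \<i> * complex_of_real \<epsilon> \<noteq> 0" by (auto simp: complex_eq_iff)
        moreover have "q \<epsilon> = (1/2 + \<i> * of_real \<epsilon>) * (1/2 + \<i> * of_real \<epsilon>) /
            ((1/2 - \<i> * of_real \<epsilon>) * (1/2 + \<i> * of_real \<epsilon>))"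
          unfolding q_def using \<open>1/2 + \<i> * complex_of_real \<epsilon> \<noteq> 0\<close>
          by (rule mult_divide_mult_cancel_right[symmetric])
        ultimately show ?thesis by (simp only:)
      qed
      hence "Im (q \<epsilon>) = \<epsilon> / (1/4 + \<epsilon>\<^sup>2)" by (simp add: Im_divide_of_real)
      moreover have "0 < 1/4 + \<epsilon>\<^sup>2" by (simp add: add_pos_nonneg)
      ultimately show ?thesis using e by simp
    qed
    moreover have "q \<epsilon> \<noteq> 0" using \<open>Im (q \<epsilon>) > 0\<close> by auto
    ultimately have "Arg ((v - right_germ u v \<epsilon>) / (u - right_germ u v \<epsilon>)) = Arg (q \<epsilon>) - pi"
      using Arg_minus[of "q \<epsilon>"] Arg_pos_iff[of "q \<epsilon>"] by auto
    thus ?thesis by (simp add: turn_def)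
  qed
  have "(q \<longlongrightarrow> (1/2 + \<i> * of_real 0) / (1/2 - \<i> * of_real 0)) (at_right 0)"
    unfolding q_def by (intro tendsto_intros nz)
  hence "(q \<longlongrightarrow> 1) (at_right 0)" by simp
  hence "((\<lambda>\<epsilon>. (Arg (q \<epsilon>) - pi) / (2 * pi)) \<longlongrightarrow> (Arg 1 - pi) / (2 * pi)) (at_right 0)"
    by (intro tendsto_intros) auto
  hence "((\<lambda>\<epsilon>. (Arg (q \<epsilon>) - pi) / (2 * pi)) \<longlongrightarrow> - (1/2)) (at_right 0)" by simp
  moreover have "eventually (\<lambda>\<epsilon>. (Arg (q \<epsilon>) - pi) / (2 * pi) = turn u v (right_germ u v \<epsilon>)) (at_right 0)"
    using eq by (auto simp: eventually_at_right_field intro!: exI[of _ 1])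
  ultimately show ?thesis by (simp add: tendsto_cong)
qed

lemma turn_left_limit:
  assumes "u \<noteq> v"
  shows "((\<lambda>\<epsilon>. turn u v (right_germ v u \<epsilon>)) \<longlongrightarrow> 1/2) (at_right 0)"
proof -
  have "((\<lambda>\<epsilon>. - turn v u (right_germ v u \<epsilon>)) \<longlongrightarrow> - (- (1/2))) (at_right 0)"
    by (intro tendsto_minus turn_right_limit) (use assms in auto)
  moreover have "- turn v u (right_germ v u \<epsilon>) = turn u v (right_germ v u \<epsilon>)" if "\<epsilon> > 0" for \<epsilon>
  proof -
    have "right_germ v u \<epsilon> \<notin> closed_segment v u"
    proof
      assume "right_germ v u \<epsilon> \<in> closed_segment v u"
      then obtain t where "right_germ v u \<epsilon> = (1 - t) *\<^sub>R v + t *\<^sub>R u" by (auto simp: in_segment)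
      hence "right_germ v u \<epsilon> - v = of_real t * (u - v)" by (simp add: scaleR_conv_of_real algebra_simps)
      moreover have "right_germ v u \<epsilon> - v = of_real (1/2) * (u - v) - of_real \<epsilon> * (\<i> * (u - v))"
        by (simp add: right_germ_def field_simps)
      ultimately have "(of_real (1/2) - of_real \<epsilon> * \<i> - of_real t) * (u - v) = 0" by (simp add: algebra_simps)
      hence "of_real (1/2) - of_real \<epsilon> * \<i> - of_real t = 0" using assms by simp
      thus False using that by (simp add: complex_eq_iff)
    qed
    thus ?thesis using turn_swap[of "right_germ v u \<epsilon>" v u] by simp
  qed
  hence "eventually (\<lambda>\<epsilon>. - turn v u (right_germ v u \<epsilon>) = turn u v (right_germ v u \<epsilon>)) (at_right 0)"
    by (auto simp: eventually_at_right_field intro!: exI[of _ 1])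
  ultimately show ?thesis by (simp add: tendsto_cong)
qed

text \<open>Only the passages of the walk along this edge contribute to the jump; the angles of the other steps are continuous at
  the midpoint.\<close>

lemma wind_jump_limit:
  assumes uv: "u \<noteq> v"
    and other: "\<And>x y. (x, y) \<in> set (steps xs) \<Longrightarrow> (x, y) = (u, v) \<or> (x, y) = (v, u) \<or> (u + v) / 2 \<notin> closed_segment x y"
  shows "((\<lambda>\<epsilon>. wind xs (right_germ v u \<epsilon>) - wind xs (right_germ u v \<epsilon>)) \<longlongrightarrow>
    real (count_list (steps xs) (u, v)) - real (count_list (steps xs) (v, u))) (at_right 0)"
  using other
proof (induction xs rule: induct_list012)
  case (3 x y zs)
  define m where "m = (u + v) / 2"
  have IH: "((\<lambda>\<epsilon>. wind (y # zs) (right_germ v u \<epsilon>) - wind (y # zs) (right_germ u v \<epsilon>)) \<longlongrightarrow>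
    real (count_list (steps (y # zs)) (u, v)) - real (count_list (steps (y # zs)) (v, u))) (at_right 0)"
    by (rule 3) (use 3(3) in auto)
  have "((\<lambda>\<epsilon>. turn x y (right_germ v u \<epsilon>) - turn x y (right_germ u v \<epsilon>)) \<longlongrightarrow>
     (if (x, y) = (u, v) then 1 else 0) - (if (x, y) = (v, u) then 1 else 0)) (at_right 0)"
  proof -
    consider "(x, y) = (u, v)" | "(x, y) = (v, u)" "(x, y) \<noteq> (u, v)" |
      "(x, y) \<noteq> (u, v)" "(x, y) \<noteq> (v, u)" "m \<notin> closed_segment x y"
      using 3(3)[of x y] by (auto simp: m_def)
    thus ?thesis
    proof cases
      case 1
      thus ?thesis using tendsto_diff[OF turn_left_limit[OF uv] turn_right_limit[OF uv]] uv by simp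
    next
      case 2
      thus ?thesis
        using tendsto_diff[OF turn_right_limit[OF uv[symmetric]] turn_left_limit[OF uv[symmetric]]] uv by simp
    next
      case 3
      have "((\<lambda>\<epsilon>. turn x y (right_germ v u \<epsilon>)) \<longlongrightarrow> turn x y m) (at_right 0)"
        using isCont_tendsto_compose[OF isCont_turn[OF 3(3)]] tendsto_right_germ[of v u]
        by (simp add: m_def add.commute)
      moreover have "((\<lambda>\<epsilon>. turn x y (right_germ u v \<epsilon>)) \<longlongrightarrow> turn x y m) (at_right 0)"
        using isCont_tendsto_compose[OF isCont_turn[OF 3(3)]] tendsto_right_germ[of u v]
        by (simp add: m_def)
      ultimately have "((\<lambda>\<epsilon>. turn x y (right_germ v u \<epsilon>) - turn x y (right_germ u v \<epsilon>)) \<longlongrightarrow>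
          turn x y m - turn x y m) (at_right 0)" by (rule tendsto_diff)
      moreover have "turn x y m - turn x y m =
          (if (x, y) = (u, v) then 1 else 0) - (if (x, y) = (v, u) then 1 else (0::real))"
        unfolding if_not_P[OF 3(1)] if_not_P[OF 3(2)] by (simp only: diff_self)
      ultimately show ?thesis by (rule tendsto_eq_rhs)
    qed
  qed
  note sum = tendsto_add[OF this IH]
  have split: "(\<lambda>\<epsilon>. wind (x # y # zs) (right_germ v u \<epsilon>) - wind (x # y # zs) (right_germ u v \<epsilon>)) =
      (\<lambda>\<epsilon>. (turn x y (right_germ v u \<epsilon>) - turn x y (right_germ u v \<epsilon>)) +
      (wind (y # zs) (right_germ v u \<epsilon>) - wind (y # zs) (right_germ u v \<epsilon>)))"
    by (rule ext) (simp add: wind_def)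
  have "((\<lambda>\<epsilon>. wind (x # y # zs) (right_germ v u \<epsilon>) - wind (x # y # zs) (right_germ u v \<epsilon>)) \<longlongrightarrow>
      ((if (x, y) = (u, v) then 1 else 0) - (if (x, y) = (v, u) then 1 else 0)) +
      (real (count_list (steps (y # zs)) (u, v)) - real (count_list (steps (y # zs)) (v, u)))) (at_right 0)"
    unfolding split by (rule sum)
  moreover have cnt: "real (if P then n + 1 else n) = (if P then 1 else 0) + real n" for P n by simp
  have "((if (x, y) = (u, v) then 1 else 0) - (if (x, y) = (v, u) then 1 else 0)) +
      (real (count_list (steps (y # zs)) (u, v)) - real (count_list (steps (y # zs)) (v, u))) =
      real (count_list (steps (x # y # zs)) (u, v)) - real (count_list (steps (x # y # zs)) (v, u))"
    unfolding steps_simps(3) count_list.simps cnt by (rule add_diff_add[symmetric])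
  ultimately show ?case by (rule tendsto_eq_rhs)
qed (auto simp: wind_def)

text \<open>The winding number is constant close to the edge, so that the limit is its value on the face to the right of the
  edge from \<open>u\<close> to \<open>v\<close>.\<close>

definition face_wind :: "complex list \<Rightarrow> complex \<Rightarrow> complex \<Rightarrow> real" where
  "face_wind xs u v = Lim (at_right 0) (\<lambda>\<epsilon>. wind xs (right_germ u v \<epsilon>))"

lemma eventually_at_right_0I:
  fixes P :: "real \<Rightarrow> bool"
  assumes "e > 0" "\<And>x. 0 < x \<Longrightarrow> x < e \<Longrightarrow> P x"
  shows "eventually P (at_right 0)"
  unfolding eventually_at_right_field using assms by blast

context admissible_graph
begin

definition walk_edges :: "complex list \<Rightarrow> complex set set" where
  "walk_edges xs = (\<lambda>(x, y). {x, y}) ` set (steps xs)"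

lemma walk_trace_eq_support: "walk_trace xs = support (walk_edges xs)"
  unfolding walk_trace_def support_def walk_edges_def image_image
  by (rule SUP_cong) (auto simp: segment_convex_hull)

lemma finite_walk_edges: "finite (walk_edges xs)"
  by (simp add: walk_edges_def)

lemma walk_edges_subset: "walk F xs \<Longrightarrow> walk_edges xs \<subseteq> F"
  unfolding walk_edges_def walk_iff_steps by auto

lemma closed_walk_trace: "walk E xs \<Longrightarrow> closed (walk_trace xs)"
  unfolding walk_trace_eq_support by (rule closed_support_edges[OF finite_walk_edges walk_edges_subset])

lemma face_wind_eventually:
  assumes xs: "walk E xs" "hd xs = last xs" and e: "{u, v} \<in> E"
  shows "eventually (\<lambda>\<epsilon>. wind xs (right_germ u v \<epsilon>) = face_wind xs u v) (at_right 0)"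
proof -
  have ne: "xs \<noteq> []" using xs by (auto simp: walk_def)
  obtain e0 where e0: "e0 > 0" "\<And>\<epsilon> \<epsilon>'. 0 < \<epsilon> \<and> \<epsilon> < e0 \<and> 0 < \<epsilon>' \<and> \<epsilon>' < e0 \<Longrightarrow>
    connected_component (UNIV - support (walk_edges xs)) (right_germ u v \<epsilon>) (right_germ u v \<epsilon>')"
    using right_germ_stable[OF e finite_walk_edges walk_edges_subset[OF xs(1)] open_UNIV] by auto
  define c where "c = wind xs (right_germ u v (e0 / 2))"
  have ev: "eventually (\<lambda>\<epsilon>. wind xs (right_germ u v \<epsilon>) = c) (at_right 0)"
  proof (rule eventually_at_right_0I[OF e0(1)])
    fix \<epsilon> :: real assume "0 < \<epsilon>" "\<epsilon> < e0"
    hence "connected_component (- walk_trace xs) (right_germ u v \<epsilon>) (right_germ u v (e0 / 2))"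
      using e0(2)[of \<epsilon> "e0/2"] e0(1) by (simp add: walk_trace_eq_support Compl_eq_Diff_UNIV)
    thus "wind xs (right_germ u v \<epsilon>) = c" unfolding c_def by (rule wind_constant[OF ne xs(2)])
  qed
  have "((\<lambda>\<epsilon>. wind xs (right_germ u v \<epsilon>)) \<longlongrightarrow> c) (at_right 0)"
    by (rule tendsto_eventually[OF ev])
  hence "face_wind xs u v = c" unfolding face_wind_def by (intro tendsto_Lim) auto
  thus ?thesis using ev by simp
qed

lemma face_wind_corner:
  assumes xs: "walk E xs" "hd xs = last xs" and u: "u \<in> nbrs E v" and eta: "\<eta>\<^sub>0 > 0"
  shows "face_wind xs u v = face_wind xs v (next_nbr E v u)"
proof -
  define x where "x = next_nbr E v u"
  have ne: "xs \<noteq> []" using xs by (auto simp: walk_def)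
  have "x \<in> nbrs E v" unfolding x_def using next_nbr_in nbr_vertices[OF u] by blast
  hence e: "{u, v} \<in> E" "{v, x} \<in> E" using u by (auto simp: in_nbrs_iff insert_commute)
  obtain e0 where e0: "e0 > 0" "\<And>\<epsilon>. 0 < \<epsilon> \<and> \<epsilon> < e0 \<Longrightarrow>
    connected_component (UNIV - support (walk_edges xs)) (right_germ u v \<epsilon>) (right_germ v x \<epsilon>)"
    using corner_sector[OF u x_def finite_walk_edges walk_edges_subset[OF xs(1)], of UNIV] eta by auto
  have "eventually (\<lambda>\<epsilon>. wind xs (right_germ u v \<epsilon>) = wind xs (right_germ v x \<epsilon>)) (at_right 0)"
  proof (rule eventually_at_right_0I[OF e0(1)])
    fix \<epsilon> :: real assume "0 < \<epsilon>" "\<epsilon> < e0"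
    hence "connected_component (- walk_trace xs) (right_germ u v \<epsilon>) (right_germ v x \<epsilon>)"
      using e0(2)[of \<epsilon>] by (simp add: walk_trace_eq_support Compl_eq_Diff_UNIV)
    thus "wind xs (right_germ u v \<epsilon>) = wind xs (right_germ v x \<epsilon>)" by (rule wind_constant[OF ne xs(2)])
  qed
  moreover note face_wind_eventually[OF xs e(1)] face_wind_eventually[OF xs e(2)]
  ultimately have "eventually (\<lambda>\<epsilon>. face_wind xs u v = face_wind xs v x) (at_right (0::real))"
    by eventually_elim simp
  thus ?thesis by (simp add: x_def eventually_const)
qed

lemma midpoint_off_other_edge:
  assumes "{u, v} \<in> E" "{x, y} \<in> E" "{x, y} \<noteq> {u, v}"
  shows "(u + v) / 2 \<notin> closed_segment x y"
  using midpoint_not_in_support[of u v "{{x, y}}"] assms by (auto simp: support_def segment_convex_hull)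

lemma face_wind_jump:
  assumes xs: "walk E xs" "hd xs = last xs" and e: "{u, v} \<in> E"
  shows "face_wind xs v u - face_wind xs u v =
    real (count_list (steps xs) (u, v)) - real (count_list (steps xs) (v, u))"
proof -
  have uv: "u \<noteq> v" using edge_vertices e by blast
  have "((\<lambda>\<epsilon>. wind xs (right_germ v u \<epsilon>) - wind xs (right_germ u v \<epsilon>)) \<longlongrightarrow>
    real (count_list (steps xs) (u, v)) - real (count_list (steps xs) (v, u))) (at_right 0)"
  proof (rule wind_jump_limit[OF uv])
    fix x y assume "(x, y) \<in> set (steps xs)"
    hence "{x, y} \<in> E" using xs(1) unfolding walk_iff_steps by auto
    thus "(x, y) = (u, v) \<or> (x, y) = (v, u) \<or> (u + v) / 2 \<notin> closed_segment x y"
      using midpoint_off_other_edge[OF e, of x y] by (auto simp: doubleton_eq_iff)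
  qed
  moreover have "((\<lambda>\<epsilon>. wind xs (right_germ v u \<epsilon>) - wind xs (right_germ u v \<epsilon>)) \<longlongrightarrow>
    face_wind xs v u - face_wind xs u v) (at_right 0)"
    using face_wind_eventually[OF xs, of v u] face_wind_eventually[OF xs, of u v] e
    by (intro tendsto_diff tendsto_eventually) (auto simp: insert_commute)
  ultimately show ?thesis using tendsto_unique[OF trivial_limit_at_right_real] by metis
qed

text \<open>The half-open edge that ends in a vertex off the walk does not meet the walk, so that the faces at both sides of this edge and
  its end point lie in one component.\<close>

lemma wind_eq_at_free_end:
  assumes xs: "walk E xs" "hd xs = last xs" and e: "{u, a} \<in> E" and a: "a \<notin> set xs"
  shows "face_wind xs u a = wind xs a" "face_wind xs a u = wind xs a"
proof -
  have ne: "xs \<noteq> []" using xs by (auto simp: walk_def)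
  define m where "m = (u + a) / 2"
  have ua: "u \<noteq> a" using edge_vertices e by blast
  have seg: "closed_segment m a \<subseteq> closed_segment u a - {u}"
  proof
    fix z assume "z \<in> closed_segment m a"
    then obtain t where t: "0 \<le> t" "t \<le> 1" "z = (1 - t) *\<^sub>R m + t *\<^sub>R a" by (auto simp: in_segment)
    have z: "z = u + of_real ((1 + t) / 2) * (a - u)"
      using t(3) by (simp add: m_def scaleR_conv_of_real field_simps)
    hence "z \<in> closed_segment u a" using point_in_closed_segment[of "(1 + t) / 2" u a] t by simp
    moreover have "z \<noteq> u"
    proof
      assume "z = u"
      hence "of_real ((1 + t) / 2) * (a - u) = 0" using z by simp
      hence "complex_of_real ((1 + t) / 2) = 0" using ua by simp
      thus False using t(1) by (simp only: of_real_eq_0_iff) simp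
    qed
    ultimately show "z \<in> closed_segment u a - {u}" by simp
  qed
  have off: "closed_segment m a \<subseteq> - walk_trace xs"
  proof (rule ccontr)
    assume "\<not> ?thesis"
    then obtain z x y where z: "z \<in> closed_segment m a" "(x, y) \<in> set (steps xs)" "z \<in> closed_segment x y"
      by (auto simp: walk_trace_def)
    have xy: "{x, y} \<in> E" "x \<noteq> a" "y \<noteq> a"
      using z(2) xs(1) a set_steps_subset[of x y xs] unfolding walk_iff_steps by auto
    have "z \<in> {u, a} \<inter> {x, y}"
      using planar_edges[OF e xy(1)] xy z seg by (auto simp: doubleton_eq_iff)
    thus False using z seg xy by auto
  qed
  have op: "open (- walk_trace xs)" using closed_walk_trace[OF xs(1)] by auto
  have "m \<in> - walk_trace xs" using off by auto
  then obtain r where r: "r > 0" "ball m r \<subseteq> - walk_trace xs" using op by (meson open_contains_ball)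
  have cma: "connected_component (- walk_trace xs) m a"
    by (rule connected_component_convex[OF convex_closed_segment off]) auto
  have near: "wind xs z = wind xs a" if "z \<in> ball m r" for z
  proof -
    have "connected_component (- walk_trace xs) z m"
      by (rule connected_component_convex[OF convex_ball r(2) that]) (use r in auto)
    from wind_constant[OF ne xs(2) connected_component_trans[OF this cma]] show ?thesis .
  qed
  have lim: "face_wind xs p q = wind xs a" if "{p, q} = {u, a}" for p q
  proof -
    have pq: "(p + q) / 2 = m" "{p, q} \<in> E" using that e by (auto simp: m_def doubleton_eq_iff add.commute insert_commute)
    have "eventually (\<lambda>\<epsilon>. dist (right_germ p q \<epsilon>) m < r) (at_right 0)"
      using tendstoD[OF tendsto_right_germ r(1), of p q] pq by simp
    moreover note face_wind_eventually[OF xs pq(2)]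
    ultimately have "eventually (\<lambda>\<epsilon>. face_wind xs p q = wind xs a) (at_right (0::real))"
      by eventually_elim (use near in \<open>auto simp: dist_commute\<close>)
    thus ?thesis by (simp add: eventually_const)
  qed
  show "face_wind xs u a = wind xs a" "face_wind xs a u = wind xs a" using lim by auto
qed

lemma wind_split:
  assumes "ys = as @ x # bs @ x # cs"
  shows "wind ys z = wind (as @ x # cs) z + wind (x # bs @ [x]) z"
proof -
  have "wind ys z = wind (as @ [x]) z + wind ((x # bs) @ x # cs) z"
    unfolding assms using wind_append[of as x "bs @ x # cs"] by simp
  also have "wind ((x # bs) @ x # cs) z = wind (x # bs @ [x]) z + wind (x # cs) z"
    using wind_append[of "x # bs" x cs] by simp
  finally show ?thesis using wind_append[of as x cs] by simp
qed

text \<open>A closed walk is composed of cycles and of edges that are passed to and fro. If a cycle surrounded the outer end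
  of a boundary edge, it would surround this edge, which then were an interior edge.\<close>

lemma wind_outside_simply_connected:
  assumes sc: "simply_connected_domain \<Gamma> E V" and a: "(u, a) \<in> bd_points E V"
    and xs: "walk (int_edges E V) xs" "hd xs = last xs"
  shows "wind xs a = 0"
  using xs
proof (induction "length xs" arbitrary: xs rule: less_induct)
  case less
  have ua: "u \<in> V" "a \<notin> V" "{u, a} \<in> E" using a by (auto simp: bd_points_def)
  have ne: "xs \<noteq> []" using less.prems by (auto simp: walk_def)
  have wE: "walk E xs" using less.prems unfolding walk_iff_steps int_edges_def by auto
  show ?case
  proof (cases "distinct (butlast xs)")
    case False
    then obtain as x bs cs where b: "butlast xs = as @ [x] @ bs @ [x] @ cs"
      using not_distinct_decomp by blast
    define ds where "ds = cs @ [last xs]"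
    have dsne: "ds \<noteq> []" by (simp add: ds_def)
    have xs_eq: "xs = as @ x # bs @ x # ds"
      using append_butlast_last_id[OF ne] b by (simp add: ds_def)
    have w1: "walk (int_edges E V) (as @ [x])" "walk (int_edges E V) (x # bs @ x # ds)"
      using less.prems(1) walk_append[of _ as x "bs @ x # ds"] unfolding xs_eq by auto
    have w2: "walk (int_edges E V) (x # bs @ [x])" "walk (int_edges E V) (x # ds)"
      using w1(2) walk_append[of _ "x # bs" x ds] by auto
    have "wind (x # bs @ [x]) a = 0"
      by (rule less.hyps) (use w2 dsne in \<open>auto simp: xs_eq\<close>)
    moreover have "wind (as @ x # ds) a = 0"
    proof (rule less.hyps)
      show "walk (int_edges E V) (as @ x # ds)" using w1 w2 walk_append[of _ as x ds] by auto
      show "hd (as @ x # ds) = last (as @ x # ds)"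
        using less.prems(2) unfolding xs_eq by (cases as) auto
    qed (simp add: xs_eq)
    ultimately show ?thesis using wind_split[OF xs_eq] by simp
  next
    case True
    define ys where "ys = butlast xs"
    have xs_eq: "xs = ys @ [last xs]" using append_butlast_last_id[OF ne] by (simp add: ys_def)
    show ?thesis
    proof (cases "length ys \<ge> 3")
      case False
      then consider "ys = []" | x where "ys = [x]" | x y where "ys = [x, y]"
        by (cases ys; cases "tl ys"; cases "tl (tl ys)") auto
      thus ?thesis
      proof cases
        case 1
        thus ?thesis using xs_eq by (metis append_Nil list.simps(8) steps_simps(2) sum_list.Nil wind_def)
      next
        case (2 x)
        hence "xs = [x, x]" using xs_eq less.prems(2) by (metis append_Cons append_Nil list.sel(1))
        hence "{x, x} \<in> E" using wE by (simp add: walk_simps)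
        thus ?thesis using edge_vertices by blast
      next
        case (3 x y)
        hence xyx: "xs = [x, y, x]" using xs_eq less.prems(2) by (metis append_Cons append_Nil list.sel(1))
        hence e: "{x, y} \<in> E" "{x, y} \<subseteq> V"
          using less.prems(1) by (auto simp: walk_simps int_edges_def)
        have "a \<notin> {x, y}" using e ua by auto
        hence "{u, a} \<noteq> {x, y}" by auto
        hence "closed_segment u a \<inter> closed_segment x y = {u, a} \<inter> {x, y}"
          by (rule planar_edges[OF ua(3) e(1)])
        hence "a \<notin> closed_segment x y" using \<open>a \<notin> {x, y}\<close> ends_in_segment(2)[of a u] by blast
        hence "turn y x a = - turn x y a" by (rule turn_swap)
        thus ?thesis unfolding xyx wind_def by simp
      qed
    next
      case True': True
      then obtain zs y where zs: "ys = zs @ [y]" by (metis list.size(3) not_numeral_le_zero rev_exhaust)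
      have ys: "ys \<noteq> []" using zs by simp
      obtain l where l: "xs = ys @ [l]" using xs_eq by blast
      have lh: "l = hd ys" using less.prems(2) ys unfolding l by simp
      have wl: "walk (int_edges E V) (zs @ [y])" "walk (int_edges E V) [y, l]"
        using less.prems(1) walk_append[of "int_edges E V" zs y "[l]"] unfolding l zs by auto
      have gc: "graph_cycle (int_edges E V) ys"
        unfolding graph_cycle_def
      proof (intro conjI)
        show "walk (int_edges E V) ys" using wl(1) zs by simp
        show "{last ys, hd ys} \<in> int_edges E V"
          using wl(2) lh zs by (simp add: walk_simps)
        show "distinct ys" using True by (simp add: ys_def)
      qed (use True' in simp)
      have nth: "xs ! i = ys ! i" "xs ! Suc i = ys ! ((i + 1) mod length ys)" if "i < length ys" for i
      proof -
        show "xs ! i = ys ! i" using that unfolding l by (simp add: nth_append)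
        show "xs ! Suc i = ys ! ((i + 1) mod length ys)"
        proof (cases "Suc i = length ys")
          case True
          have "xs ! Suc i = l" unfolding l True by simp
          also have "\<dots> = ys ! 0" using lh ys by (simp add: hd_conv_nth)
          finally show ?thesis using True by simp
        next
          case False
          hence "Suc i < length ys" using that by simp
          thus ?thesis unfolding l by (simp add: nth_append)
        qed
      qed
      have len: "length xs = Suc (length ys)" unfolding l by simp
      have tr: "walk_trace xs = cycle_curve ys"
      proof -
        have "set (steps xs) = (\<lambda>i. (xs ! i, xs ! Suc i)) ` {..<length ys}"
          unfolding steps_def set_zip using len by (auto simp: nth_tl)
        hence "walk_trace xs = (\<Union>i<length ys. closed_segment (xs ! i) (xs ! Suc i))"
          unfolding walk_trace_def by simp
        also have "\<dots> = cycle_curve ys" unfolding cycle_curve_def using nth by auto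
        finally show ?thesis .
      qed
      have segs: "closed_segment u a - {u} \<subseteq> - walk_trace xs"
      proof (rule ccontr)
        assume "\<not> ?thesis"
        then obtain z x y where z: "z \<in> closed_segment u a" "z \<noteq> u" "(x, y) \<in> set (steps xs)" "z \<in> closed_segment x y"
          by (auto simp: walk_trace_def)
        have xy: "{x, y} \<in> E" "{x, y} \<subseteq> V"
          using z(3) less.prems(1) unfolding walk_iff_steps int_edges_def by auto
        have "{u, a} \<noteq> {x, y}" using xy ua by auto
        hence "z \<in> {u, a} \<inter> {x, y}" using planar_edges[OF ua(3) xy(1)] z by auto
        thus False using z xy ua by auto
      qed
      have une: "u \<noteq> a" using ua by auto
      have "a \<in> - walk_trace xs" using segs une by auto
      have "\<not> bounded (connected_component_set (- walk_trace xs) a)"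
      proof
        assume b: "bounded (connected_component_set (- walk_trace xs) a)"
        have "open_segment u a \<subseteq> inside (walk_trace xs)"
        proof
          fix z assume z: "z \<in> open_segment u a"
          have "closed_segment z a \<subseteq> closed_segment u a - {u}"
          proof
            fix y assume "y \<in> closed_segment z a"
            then obtain t where t: "0 \<le> t" "t \<le> 1" "y = (1 - t) *\<^sub>R z + t *\<^sub>R a" by (auto simp: in_segment)
            obtain s where s: "0 < s" "s < 1" "z = (1 - s) *\<^sub>R u + s *\<^sub>R a" using z by (auto simp: in_segment)
            have y: "y = u + of_real (s + t - s * t) * (a - u)"
              using t s by (simp add: scaleR_conv_of_real algebra_simps)
            have "s + t - s * t = s * (1 - t) + t" by (simp add: algebra_simps)
            moreover have "0 \<le> s * (1 - t)" using s t by simp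
            ultimately have pos: "s + t - s * t > 0" using s(1) t(1) by (cases "t = 0") auto
            have "(1 - s) * (1 - t) \<ge> 0" using s t by simp
            hence le: "s + t - s * t \<le> 1" by (simp add: algebra_simps)
            have "y \<in> closed_segment u a" unfolding y using pos le by (intro point_in_closed_segment) auto
            moreover have "y \<noteq> u"
            proof
              assume "y = u"
              hence "of_real (s + t - s * t) * (a - u) = 0" using y by simp
              hence "complex_of_real (s + t - s * t) = 0" using une by simp
              thus False using pos by (simp only: of_real_eq_0_iff)
            qed
            ultimately show "y \<in> closed_segment u a - {u}" by simp
          qed
          hence sub: "closed_segment z a \<subseteq> - walk_trace xs" using segs by blast
          hence "connected_component (- walk_trace xs) z a"
            by (intro connected_component_convex[OF convex_closed_segment sub]) auto
          hence "connected_component_set (- walk_trace xs) z = connected_component_set (- walk_trace xs) a"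
            using connected_component_eq[of a "- walk_trace xs" z] by simp
          thus "z \<in> inside (walk_trace xs)" unfolding inside_def using b sub by auto
        qed
        hence "{u, a} \<in> int_edges E V"
          using sc gc ua(3) unfolding simply_connected_domain_def tr by blast
        thus False using ua by (simp add: int_edges_def)
      qed
      thus ?thesis by (rule wind_unbounded_component[OF ne less.prems(2)])
    qed
  qed
qed

end

section \<open>Iterating a permutation of a finite set\<close>

lemma inj_on_funpow:
  assumes "inj_on f S" "f ` S \<subseteq> S"
  shows "inj_on (f ^^ n) S" "(f ^^ n) ` S \<subseteq> S"
proof -
  show *: "(f ^^ n) ` S \<subseteq> S" for n using assms(2) by (induction n) auto
  show "inj_on (f ^^ n) S"
  proof (induction n)
    case (Suc n)
    have "inj_on f ((f ^^ n) ` S)" using inj_on_subset[OF assms(1) *] .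
    from comp_inj_on[OF Suc this] show ?case by (simp add: comp_def)
  qed simp
qed

lemma funpow_cancel:
  assumes "inj_on f S" "f ` S \<subseteq> S" "x \<in> S" "y \<in> S" "(f ^^ i) x = (f ^^ (i + j)) y"
  shows "x = (f ^^ j) y"
proof (rule inj_onD[OF inj_on_funpow(1)[OF assms(1,2), of i]])
  show "(f ^^ i) x = (f ^^ i) ((f ^^ j) y)" using assms(5) by (simp add: funpow_add)
  show "(f ^^ j) y \<in> S" using inj_on_funpow(2)[OF assms(1,2), of j] assms(4) by auto
qed fact

lemma finite_orbit_returns:
  assumes "inj_on f S" "f ` S \<subseteq> S" "finite S" "x \<in> S"
  obtains n where "n > 0" "(f ^^ n) x = x"
proof -
  have "(\<lambda>n. (f ^^ n) x) ` UNIV \<subseteq> S" using inj_on_funpow(2)[OF assms(1,2)] assms(4) by auto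
  hence "\<not> inj (\<lambda>n. (f ^^ n) x)"
    using finite_subset[OF _ assms(3)] finite_imageD[of "\<lambda>n. (f ^^ n) x" UNIV] by auto
  then obtain i j where ij: "i < j" "(f ^^ i) x = (f ^^ j) x"
    unfolding inj_def by (metis linorder_neqE_nat)
  hence "x = (f ^^ (j - i)) x" using funpow_cancel[OF assms(1,2,4,4), of i "j - i"] by simp
  thus ?thesis using that[of "j - i"] ij by simp
qed

definition period :: "('a \<Rightarrow> 'a) \<Rightarrow> 'a \<Rightarrow> nat" where
  "period f x = (LEAST n. 0 < n \<and> (f ^^ n) x = x)"

lemma period_props:
  assumes "inj_on f S" "f ` S \<subseteq> S" "finite S" "x \<in> S"
  shows "period f x > 0" "(f ^^ period f x) x = x"
    "\<And>n. 0 < n \<Longrightarrow> n < period f x \<Longrightarrow> (f ^^ n) x \<noteq> x"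
    "\<And>i j. i < period f x \<Longrightarrow> j < period f x \<Longrightarrow> (f ^^ i) x = (f ^^ j) x \<Longrightarrow> i = j"
    "\<And>n. \<exists>m < period f x. (f ^^ n) x = (f ^^ m) x"
proof -
  have ex: "\<exists>n. 0 < n \<and> (f ^^ n) x = x" using finite_orbit_returns[OF assms] by metis
  have p: "0 < period f x \<and> (f ^^ period f x) x = x"
    unfolding period_def by (rule LeastI_ex[OF ex])
  show "period f x > 0" "(f ^^ period f x) x = x" using p by auto
  show *: "(f ^^ n) x \<noteq> x" if "0 < n" "n < period f x" for n
    using not_less_Least[of n "\<lambda>n. 0 < n \<and> (f ^^ n) x = x"] that unfolding period_def by auto
  have **: "i = j" if "i \<le> j" "j < period f x" "(f ^^ i) x = (f ^^ j) x" for i j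
  proof (rule ccontr)
    assume "i \<noteq> j"
    moreover have "(f ^^ (j - i)) x = x"
      using funpow_cancel[OF assms(1,2,4,4), of i "j - i"] that by simp
    ultimately show False using *[of "j - i"] that by simp
  qed
  show "i = j" if "i < period f x" "j < period f x" "(f ^^ i) x = (f ^^ j) x" for i j
    using **[of i j] **[of j i] that by (metis linear)
  show "\<exists>m < period f x. (f ^^ n) x = (f ^^ m) x" for n
    using p funpow_mod_eq[of "period f x" f x n] by (metis mod_less_divisor)
qed

lemma steps_snoc: "xs \<noteq> [] \<Longrightarrow> steps (xs @ [y]) = steps xs @ [(last xs, y)]"
  using steps_append[of "butlast xs" "last xs" "[y]"] append_butlast_last_id[of xs]
  by (metis append.assoc append_Cons append_Nil steps_simps(2,3))

lemma walk_snoc: "xs \<noteq> [] \<Longrightarrow> walk F (xs @ [y]) \<longleftrightarrow> walk F xs \<and> {last xs, y} \<in> F"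
  unfolding walk_iff_steps steps_snoc by auto

section \<open>The rotation system of a simply connected domain\<close>

locale planar_domain = admissible_graph +
  fixes V :: "complex set"
  assumes simply_connected: "simply_connected_domain \<Gamma> E V" and eta_pos: "\<eta>\<^sub>0 > 0"
begin

abbreviation "B \<equiv> bd_points E V"
abbreviation "contour \<equiv> contour_step E V"
abbreviation "succ \<equiv> bd_succ E V"
abbreviation "IE \<equiv> int_edges E V"

text \<open>A boundary edge occurs with one orientation only, as a half-edge. With \<open>opp\<close> below fixing the half-edges, the
  contour becomes the composition of an involution and of the rotation.\<close>

definition darts :: "(complex \<times> complex) set" where
  "darts = {(u, v). u \<in> V \<and> {u, v} \<in> E}"

definition rot :: "complex \<times> complex \<Rightarrow> complex \<times> complex" where
  "rot d = (fst d, next_nbr E (fst d) (snd d))"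

definition opp :: "complex \<times> complex \<Rightarrow> complex \<times> complex" where
  "opp d = (if snd d \<in> V then (snd d, fst d) else d)"

lemma contour_eq: "contour d = rot (opp d)"
  by (cases d) (auto simp: rot_def opp_def)

lemma V_props: "V \<subseteq> \<Gamma>" "finite V" "V \<noteq> {}"
  and V_connected: "u \<in> V \<Longrightarrow> v \<in> V \<Longrightarrow> \<exists>vs. walk IE vs \<and> hd vs = u \<and> last vs = v"
  using simply_connected unfolding simply_connected_domain_def discrete_domain_def by auto

lemma darts_iff: "(u, v) \<in> darts \<longleftrightarrow> u \<in> V \<and> v \<in> nbrs E u"
  by (auto simp: darts_def in_nbrs_iff)

lemma finite_darts: "finite darts"
proof -
  have "darts = Sigma V (nbrs E)" by (auto simp: darts_def in_nbrs_iff)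
  thus ?thesis using V_props(1,2) finite_nbrs by (auto intro!: finite_SigmaI)
qed

lemma B_iff: "d \<in> B \<longleftrightarrow> d \<in> darts \<and> snd d \<notin> V"
  by (auto simp: bd_points_def darts_def)

lemma B_subset: "B \<subseteq> darts" and finite_B: "finite B"
  using B_iff finite_darts by (auto intro: finite_subset[of B darts])

lemma fst_in_V: "d \<in> darts \<Longrightarrow> fst d \<in> V"
  by (auto simp: darts_def)

lemma opp_in: "d \<in> darts \<Longrightarrow> opp d \<in> darts"
  by (auto simp: darts_def opp_def insert_commute)

lemma opp_B: "d \<in> B \<Longrightarrow> opp d = d"
  by (auto simp: B_iff opp_def)

lemma opp_int: "d \<in> darts - B \<Longrightarrow> opp d = (snd d, fst d)"
  by (auto simp: B_iff opp_def)

lemma opp_in_int: "d \<in> darts - B \<Longrightarrow> opp d \<in> darts - B"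
  by (auto simp: B_iff opp_def darts_def insert_commute)

lemma opp_opp: "d \<in> darts \<Longrightarrow> opp (opp d) = d"
  by (auto simp: opp_def darts_def)

lemma int_dart_edge: "d \<in> darts - B \<Longrightarrow> {fst d, snd d} \<in> IE \<and> snd d \<in> V"
  by (auto simp: B_iff darts_def int_edges_def)

lemma edge_dart: "{x, y} \<in> IE \<Longrightarrow> (x, y) \<in> darts - B"
  by (auto simp: B_iff darts_def int_edges_def)

lemma rot_in: "d \<in> darts \<Longrightarrow> rot d \<in> darts"
  using V_props(1) next_nbr_in by (cases d) (auto simp: rot_def darts_iff)

lemma inj_rot: "inj_on rot darts"
proof (rule inj_onI)
  fix d d' assume a: "d \<in> darts" "d' \<in> darts" "rot d = rot d'"
  thus "d = d'"
    using next_nbr_inj[of "snd d" "fst d" "snd d'"] eta_pos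
    by (cases d; cases d') (auto simp: rot_def darts_iff)
qed

lemma contour_in: "contour ` darts \<subseteq> darts"
  using rot_in[OF opp_in] contour_eq by (simp add: image_subset_iff)

lemma inj_contour: "inj_on contour darts"
proof (rule inj_onI)
  fix d d' assume a: "d \<in> darts" "d' \<in> darts" "contour d = contour d'"
  hence "opp d = opp d'" unfolding contour_eq using inj_onD[OF inj_rot] opp_in by blast
  thus "d = d'" using opp_opp a by metis
qed

lemmas contour_perm = inj_contour contour_in

lemma contour_pow_in: "d \<in> darts \<Longrightarrow> (contour ^^ n) d \<in> darts"
  using inj_on_funpow(2)[OF contour_perm] by blast

lemma fst_contour: "d \<in> darts - B \<Longrightarrow> fst (contour d) = snd d" "d \<in> B \<Longrightarrow> fst (contour d) = fst d"
  by (auto simp: contour_eq rot_def opp_def B_iff)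

lemma contour_opp: "d \<in> darts \<Longrightarrow> contour (opp d) = rot d"
  unfolding contour_eq using opp_opp by simp

lemma walk_in_V: "walk IE xs \<Longrightarrow> hd xs \<in> V \<Longrightarrow> set xs \<subseteq> V"
proof (induction xs rule: induct_list012)
  case (3 x y zs)
  thus ?case by (auto simp: walk_simps int_edges_def)
qed auto

text \<open>Following the contour for \<open>n\<close> steps traces out a walk in the domain. Its passages are exactly the interior
  darts among these steps, since at a boundary half-edge the contour stays at the same vertex.\<close>

lemma contour_walk:
  assumes p: "p \<in> darts"
  shows "\<exists>xs. walk IE xs \<and> hd xs = fst p \<and> last xs = fst ((contour ^^ n) p) \<and>
    (\<forall>d\<in>darts - B. count_list (steps xs) d = card {i. i < n \<and> (contour ^^ i) p = d})"
proof (induction n)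
  case 0
  show ?case by (intro exI[of _ "[fst p]"]) (auto simp: walk_simps)
next
  case (Suc n)
  then obtain xs where xs: "walk IE xs" "hd xs = fst p" "last xs = fst ((contour ^^ n) p)"
    "\<And>d. d \<in> darts - B \<Longrightarrow> count_list (steps xs) d = card {i. i < n \<and> (contour ^^ i) p = d}" by auto
  define q where "q = (contour ^^ n) p"
  have q: "q \<in> darts" unfolding q_def by (rule contour_pow_in[OF p])
  have ne: "xs \<noteq> []" using xs(1) by (auto simp: walk_def)
  have set_eq: "{i. i < Suc n \<and> (contour ^^ i) p = d} =
      {i. i < n \<and> (contour ^^ i) p = d} \<union> (if q = d then {n} else {})" for d
    by (auto simp: q_def less_Suc_eq)
  have card_eq: "card {i. i < Suc n \<and> (contour ^^ i) p = d} =
      card {i. i < n \<and> (contour ^^ i) p = d} + (if q = d then 1 else 0)" for d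
    unfolding set_eq by (subst card_Un_disjoint) auto
  show ?case
  proof (cases "q \<in> B")
    case True
    hence "last xs = fst ((contour ^^ Suc n) p)" using xs(3) fst_contour(2)[OF True] by (simp add: q_def)
    moreover have "count_list (steps xs) d = card {i. i < Suc n \<and> (contour ^^ i) p = d}"
      if "d \<in> darts - B" for d using xs(4)[OF that] True that unfolding card_eq by auto
    ultimately show ?thesis using xs(1,2) by blast
  next
    case False
    hence qi: "q \<in> darts - B" using q by simp
    have l: "(last xs, snd q) = q" using xs(3) by (simp add: q_def)
    have "walk IE (xs @ [snd q])"
      unfolding walk_snoc[OF ne] using xs(1) int_dart_edge[OF qi] xs(3) by (simp add: q_def)
    moreover have "hd (xs @ [snd q]) = fst p" using xs(2) ne by simp
    moreover have "last (xs @ [snd q]) = fst ((contour ^^ Suc n) p)"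
      using fst_contour(1)[OF qi] by (simp add: q_def)
    moreover have "count_list (steps (xs @ [snd q])) d = card {i. i < Suc n \<and> (contour ^^ i) p = d}"
      if "d \<in> darts - B" for d
      unfolding steps_snoc[OF ne] l card_eq using xs(4)[OF that] by simp
    ultimately show ?thesis by blast
  qed
qed

subsection \<open>Separation\<close>

text \<open>The rules for the winding number around the face at the right of a dart. The contour turns around the outer end of a
  half-edge without changing the face, because both sides of a half-edge have winding number zero.\<close>

lemma face_wind_domain:
  assumes xs: "walk IE xs" "hd xs = last xs" "set xs \<subseteq> V" and d: "d \<in> darts"
  defines "N \<equiv> \<lambda>d. face_wind xs (fst d) (snd d)"
  shows "N (contour d) = N d" "d \<in> B \<Longrightarrow> N d = 0"
    "N (opp d) - N d = real (count_list (steps xs) d) - real (count_list (steps xs) (opp d))"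
proof -
  have wE: "walk E xs" using xs(1) unfolding walk_iff_steps int_edges_def by auto
  obtain u v where uv: "d = (u, v)" by (cases d)
  have e: "u \<in> V" "{u, v} \<in> E" using d uv by (auto simp: darts_def)
  have bd: "face_wind xs u v = 0" "face_wind xs v u = 0" if "d \<in> B"
  proof -
    have v: "v \<notin> set xs" using that uv xs(3) by (auto simp: B_iff)
    have "wind xs v = 0"
      by (rule wind_outside_simply_connected[OF simply_connected _ xs(1,2)]) (use that uv in auto)
    thus "face_wind xs u v = 0" "face_wind xs v u = 0"
      using wind_eq_at_free_end[OF wE xs(2) e(2) v] by auto
  qed
  show "d \<in> B \<Longrightarrow> N d = 0" using bd uv by (simp add: N_def)
  show "N (contour d) = N d"
  proof (cases "d \<in> B")
    case True
    have "v \<in> nbrs E u" using e by (simp add: in_nbrs_iff)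
    hence "face_wind xs u (next_nbr E u v) = face_wind xs v u"
      using face_wind_corner[OF wE xs(2) _ eta_pos] by simp
    thus ?thesis using bd[OF True] True uv by (simp add: N_def B_iff)
  next
    case False
    hence v: "v \<in> V" using d uv by (auto simp: B_iff)
    have "u \<in> nbrs E v" using e by (simp add: in_nbrs_iff insert_commute)
    hence "face_wind xs u v = face_wind xs v (next_nbr E v u)"
      using face_wind_corner[OF wE xs(2) _ eta_pos] by simp
    thus ?thesis using v uv by (simp add: N_def)
  qed
  show "N (opp d) - N d = real (count_list (steps xs) d) - real (count_list (steps xs) (opp d))"
  proof (cases "d \<in> B")
    case False
    hence "opp d = (v, u)" using opp_int d uv by simp
    thus ?thesis using face_wind_jump[OF wE xs(2) e(2)] uv by (simp add: N_def)
  qed (simp add: opp_B)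
qed

text \<open>Suppose that away from a vertex set \<open>P\<close> a closed walk passes the same edges as a part \<open>C\<close> of the
  contour. Then the winding number at the right of a dart, plus one if the dart is in \<open>C\<close>, is unchanged
  when one rotates around a vertex or goes over to the other end of an edge, as long as one stays outside of \<open>P\<close>: the
  jumps of the winding number are cancelled by entering and leaving \<open>C\<close>. On half-edges the winding number vanishes,
  and only membership in \<open>C\<close> remains.\<close>

lemma separation:
  assumes xs: "walk IE xs" "hd xs = last xs" "set xs \<subseteq> V"
    and h1: "\<And>d. d \<in> darts - B \<Longrightarrow> fst d \<notin> P \<Longrightarrow>
      real (count_list (steps xs) d) - real (count_list (steps xs) (opp d)) = of_bool (d \<in> C) - of_bool (opp d \<in> C)"
    and h2: "\<And>d. d \<in> darts \<Longrightarrow> fst (contour d) \<notin> P \<Longrightarrow> contour d \<in> C \<longleftrightarrow> d \<in> C"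
    and q: "q \<in> B" "q' \<in> B" and ys: "walk IE ys" "hd ys = fst q" "last ys = fst q'" "set ys \<inter> P = {}"
  shows "q \<in> C \<longleftrightarrow> q' \<in> C"
proof -
  define N where "N = (\<lambda>d. face_wind xs (fst d) (snd d))"
  define M where "M = (\<lambda>d. N d + of_bool (d \<in> C))"
  have fw: "N (contour d) = N d" "d \<in> B \<Longrightarrow> N d = 0"
    "N (opp d) - N d = real (count_list (steps xs) d) - real (count_list (steps xs) (opp d))"
    if "d \<in> darts" for d
    using face_wind_domain[OF xs that] by (simp_all add: N_def)
  \<comment> \<open>Rotating from \<open>d\<close>, one meets the face on the left of \<open>d\<close>, which is the face on the right of
    \<open>opp d\<close>; this is the contour step from \<open>opp d\<close>.\<close>
  have Mrot: "M (rot d) = M d" if d: "d \<in> darts" "fst d \<notin> P" for d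
  proof -
    have f: "fst (contour (opp d)) \<notin> P" unfolding contour_opp[OF d(1)] using d by (simp add: rot_def)
    have "N (rot d) = N (opp d)"
      using fw(1)[OF opp_in[OF d(1)]] contour_opp[OF d(1)] by (simp add: N_def)
    moreover have "rot d \<in> C \<longleftrightarrow> opp d \<in> C"
      using h2[OF opp_in[OF d(1)] f] contour_opp[OF d(1)] by simp
    moreover have "N (opp d) - N d = of_bool (d \<in> C) - of_bool (opp d \<in> C)"
    proof (cases "d \<in> B")
      case True
      thus ?thesis using opp_B by simp
    next
      case False
      thus ?thesis using fw(3)[OF d(1)] h1[of d] d by simp
    qed
    ultimately show ?thesis unfolding M_def by simp
  qed
  have Mopp: "M (opp d) = M d" if d: "d \<in> darts - B" "fst d \<notin> P" for d
    using fw(3)[of d] h1[OF d] d unfolding M_def by simp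
  have Mvert: "M d = M d'" if d: "d \<in> darts" "d' \<in> darts" "fst d = fst d'" "fst d \<notin> P" for d d'
  proof -
    define x where "x = fst d"
    define S where "S = {y \<in> nbrs E x. M (x, y) = M d}"
    have xV: "x \<in> V" using fst_in_V d by (simp add: x_def)
    have "S = nbrs E x"
    proof (rule next_nbr_transitive[OF _ _ _ eta_pos])
      show "snd d \<in> S" using d(1) by (cases d) (auto simp: S_def x_def darts_iff)
      show "next_nbr E x y \<in> S" if "y \<in> S" for y
      proof -
        have y: "(x, y) \<in> darts" using that xV by (simp add: S_def darts_iff)
        have "M (rot (x, y)) = M d" using Mrot[OF y] that d(4) by (simp add: S_def x_def)
        moreover have "rot (x, y) \<in> darts" by (rule rot_in[OF y])
        ultimately show ?thesis by (simp add: S_def rot_def darts_iff)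
      qed
    qed (simp add: S_def)
    moreover have "snd d' \<in> nbrs E x" using d by (cases d') (auto simp: darts_iff x_def)
    ultimately have "M (x, snd d') = M d" by (auto simp: S_def)
    thus ?thesis using d(3) by (simp add: x_def)
  qed
  have "\<forall>d d'. d \<in> darts \<and> d' \<in> darts \<and> fst d = hd ys \<and> fst d' = last ys \<longrightarrow> M d = M d'"
    using ys(1,4)
  proof (induction ys rule: induct_list012)
    case (2 x)
    thus ?case using Mvert by simp
  next
    case (3 x y zs)
    show ?case
    proof (intro allI impI, elim conjE)
      fix d d' assume d: "d \<in> darts" "d' \<in> darts" "fst d = hd (x # y # zs)" "fst d' = last (x # y # zs)"
      have e: "(x, y) \<in> darts - B" using 3 edge_dart by (simp add: walk_simps)
      have "M d = M (x, y)" using Mvert[of d "(x, y)"] e d 3 by simp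
      also have "\<dots> = M (opp (x, y))" using Mopp[of "(x, y)"] e 3 by simp
      also have "opp (x, y) = (y, x)" using opp_int[OF e] by simp
      also have "M (y, x) = M d'"
      proof -
        have yx: "(y, x) \<in> darts" using opp_in_int[OF e] opp_int[OF e] by simp
        have "\<forall>d d'. d \<in> darts \<and> d' \<in> darts \<and> fst d = hd (y # zs) \<and> fst d' = last (y # zs) \<longrightarrow> M d = M d'"
          by (rule 3(2)) (use 3(3,4) in \<open>auto simp: walk_simps\<close>)
        from this[rule_format, of "(y, x)" d'] show ?thesis using yx d by simp
      qed
      finally show "M d = M d'" .
    qed
  qed (simp add: walk_simps)
  hence "M q = M q'" using q ys(2,3) B_subset by (simp add: subset_iff del: split_paired_All)
  moreover have "N q = 0" "N q' = 0" using fw(2)[of q] fw(2)[of q'] q B_subset by auto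
  ultimately show ?thesis unfolding M_def by (auto split: if_splits simp: of_bool_def)
qed

lemma card_orbit_index:
  assumes "\<And>i j. i < n \<Longrightarrow> j < n \<Longrightarrow> f i = f j \<Longrightarrow> i = (j::nat)"
  shows "card {i. i < n \<and> f i = d} = of_bool (\<exists>i<n. f i = d)"
proof (cases "\<exists>i<n. f i = d")
  case True
  then obtain i where i: "i < n" "f i = d" by blast
  hence "{i. i < n \<and> f i = d} = {i}" using assms by blast
  thus ?thesis using True by simp
qed auto

text \<open>The full contour through \<open>p\<close> is a closed walk with the hypotheses of \<open>separation\<close> for \<open>P = {}\<close>, and the
  domain is connected. So with \<open>p\<close> all boundary points are on this contour.\<close>

lemma boundary_one_contour:
  assumes p: "p \<in> B" and q: "q \<in> B"
  obtains n where "q = (contour ^^ n) p"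
proof -
  have pd: "p \<in> darts" using p B_subset by auto
  note per = period_props[OF contour_perm finite_darts pd]
  define n where "n = period contour p"
  define C where "C = {(contour ^^ i) p |i. i < n}"
  obtain xs where xs: "walk IE xs" "hd xs = fst p" "last xs = fst ((contour ^^ n) p)"
    "\<And>d. d \<in> darts - B \<Longrightarrow> count_list (steps xs) d = card {i. i < n \<and> (contour ^^ i) p = d}"
    using contour_walk[OF pd, of n] by blast
  have cnt: "count_list (steps xs) d = of_bool (d \<in> C)" if "d \<in> darts - B" for d
    unfolding xs(4)[OF that] C_def
    by (subst card_orbit_index) (use per(4) in \<open>auto simp: n_def\<close>)
  have hl: "hd xs = last xs" using xs(2,3) per(2) by (simp add: n_def)
  have "p \<in> C \<longleftrightarrow> q \<in> C"
  proof -
    obtain ys where ys: "walk IE ys" "hd ys = fst p" "last ys = fst q"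
      using V_connected[of "fst p" "fst q"] fst_in_V p q B_subset by blast
    show ?thesis
    proof (rule separation[OF xs(1) hl, where P = "{}" and ys = ys])
      show "set xs \<subseteq> V" using walk_in_V xs fst_in_V[OF pd] by simp
      show "real (count_list (steps xs) d) - real (count_list (steps xs) (opp d)) =
          of_bool (d \<in> C) - of_bool (opp d \<in> C)" if "d \<in> darts - B" for d
        using cnt[OF that] cnt[OF opp_in_int[OF that]] by simp
      show "contour d \<in> C \<longleftrightarrow> d \<in> C" if d: "d \<in> darts" for d
      proof
        assume "d \<in> C"
        then obtain i where "d = (contour ^^ i) p" by (auto simp: C_def)
        hence "contour d = (contour ^^ Suc i) p" by simp
        thus "contour d \<in> C" using per(5)[of "Suc i"] unfolding C_def n_def by auto
      next
        assume "contour d \<in> C"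
        then obtain i where i: "contour d = (contour ^^ i) p" by (auto simp: C_def)
        have "contour d = (contour ^^ (i + n)) p" using i per(2) by (simp add: funpow_add n_def)
        moreover have "i + n = Suc (i + n - 1)" using per(1) by (simp add: n_def)
        ultimately have "contour d = contour ((contour ^^ (i + n - 1)) p)" by (metis funpow.simps(2) o_apply)
        hence "d = (contour ^^ (i + n - 1)) p"
          using inj_onD[OF inj_contour] d contour_pow_in[OF pd] by blast
        thus "d \<in> C" using per(5)[of "i + n - 1"] unfolding C_def n_def by auto
      qed
    qed (use ys p q in auto)
  qed
  moreover have "p \<in> C" using per(1) unfolding C_def n_def by (auto intro!: exI[of _ 0])
  ultimately show ?thesis using that unfolding C_def by auto
qed

text \<open>The contour from \<open>p\<close> to \<open>p'\<close> is closed up by the path \<open>ws\<close> backwards. For this closed walk the set \<open>P\<close> in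
  \<open>separation\<close> is the set of vertices of \<open>ws\<close>. A path that avoids \<open>ws\<close> cannot lead
  from a point of this part of the boundary to a point of the other part.\<close>

lemma interlaced_walks_meet:
  assumes p: "p \<in> B" "p' = (contour ^^ m) p" "p' \<in> B"
    and nr: "\<And>i. 0 < i \<Longrightarrow> i \<le> m \<Longrightarrow> (contour ^^ i) p \<noteq> p"
    and q: "q \<in> B" "q' \<in> B" "\<exists>i. 0 < i \<and> i \<le> m \<and> q = (contour ^^ i) p"
      "\<And>i. 0 < i \<Longrightarrow> i \<le> m \<Longrightarrow> q' \<noteq> (contour ^^ i) p"
    and ws: "walk IE ws" "hd ws = fst p" "last ws = fst p'"
    and ys: "walk IE ys" "hd ys = fst q" "last ys = fst q'"
  shows "set ws \<inter> set ys \<noteq> {}"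
proof
  assume disj: "set ws \<inter> set ys = {}"
  have pd: "p \<in> darts" using p B_subset by auto
  \<comment> \<open>The start \<open>p\<close> is left out of \<open>C\<close> and the end \<open>p'\<close> is included: membership then changes
    only at the contour steps from \<open>p\<close> and from \<open>p'\<close>, which both take place at end points of \<open>ws\<close>.\<close>
  define C where "C = {(contour ^^ i) p |i. 0 < i \<and> i \<le> m}"
  obtain cs where cs: "walk IE cs" "hd cs = fst p" "last cs = fst ((contour ^^ m) p)"
    "\<And>d. d \<in> darts - B \<Longrightarrow> count_list (steps cs) d = card {i. i < m \<and> (contour ^^ i) p = d}"
    using contour_walk[OF pd, of m] by blast
  have inj: "i = j" if "i < m" "j < m" "(contour ^^ i) p = (contour ^^ j) p" for i j
  proof -
    have *: "i = j" if "i \<le> j" "j < m" "(contour ^^ i) p = (contour ^^ j) p" for i j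
    proof (rule ccontr)
      assume "i \<noteq> j"
      moreover have "(contour ^^ (j - i)) p = p"
        using funpow_cancel[OF contour_perm pd pd, of i "j - i"] that by simp
      ultimately show False using nr[of "j - i"] that by simp
    qed
    show ?thesis using *[of i j] *[of j i] that by (metis linear)
  qed
  have cnt: "count_list (steps cs) d = of_bool (d \<in> C)" if d: "d \<in> darts - B" for d
  proof -
    have "(\<exists>i<m. (contour ^^ i) p = d) \<longleftrightarrow> d \<in> C"
    proof
      assume "\<exists>i<m. (contour ^^ i) p = d"
      then obtain i where i: "i < m" "(contour ^^ i) p = d" by blast
      have "i \<noteq> 0" using i p(1) d by (intro notI) simp
      thus "d \<in> C" using i unfolding C_def by auto
    next
      assume "d \<in> C"
      then obtain i where i: "0 < i" "i \<le> m" "d = (contour ^^ i) p" by (auto simp: C_def)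
      have "i \<noteq> m" using i p d by auto
      thus "\<exists>i<m. (contour ^^ i) p = d" using i by (intro exI[of _ i]) auto
    qed
    thus ?thesis unfolding cs(4)[OF d] by (subst card_orbit_index) (use inj in auto)
  qed
  define vs where "vs = rev ws"
  have vs: "walk IE vs" "hd vs = fst p'" "last vs = fst p" "set vs = set ws" "vs \<noteq> []"
    using ws walk_rev[of IE ws] walk_simps(3)[of IE] unfolding vs_def by (auto simp: hd_rev last_rev)
  have csne: "cs \<noteq> []" using cs(1) by (auto simp: walk_def)
  define xs where "xs = butlast cs @ vs"
  have lc: "last cs = hd vs" using cs(3) vs(2) p(2) by simp
  have cs_eq: "cs = butlast cs @ [hd vs]" using lc csne by (metis append_butlast_last_id)
  have xs_eq: "xs = butlast cs @ hd vs # tl vs" using vs(5) by (simp add: xs_def)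
  have st: "steps xs = steps cs @ steps vs"
    unfolding xs_eq steps_append[of "butlast cs" "hd vs" "tl vs"] using cs_eq vs(5) by simp
  have w: "walk IE xs"
    unfolding xs_eq walk_append[of _ "butlast cs" "hd vs" "tl vs"] using cs_eq vs(5) cs(1) vs(1) by simp
  have hdx: "hd xs = fst p"
  proof (cases "butlast cs = []")
    case True
    hence "cs = [hd vs]" using cs_eq by simp
    thus ?thesis using cs(2) True by (simp add: xs_def)
  next
    case False
    thus ?thesis using cs(2) csne by (simp add: xs_def hd_append) (metis hd_append2 cs_eq)
  qed
  have lx: "last xs = fst p" using vs(3,5) by (simp add: xs_def)
  have nc: "count_list (steps vs) d = 0" if "fst d \<notin> set ws \<or> snd d \<notin> set ws" for d
    using that set_steps_subset[of "fst d" "snd d" vs] vs(4) by (auto simp: count_list_0_iff)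
  have "q \<in> C \<longleftrightarrow> q' \<in> C"
  proof (rule separation[OF w, where P = "set ws" and ys = ys])
    show "hd xs = last xs" using hdx lx by simp
    show "set xs \<subseteq> V" using walk_in_V[OF w] hdx fst_in_V[OF pd] by simp
    show "real (count_list (steps xs) d) - real (count_list (steps xs) (opp d)) =
        of_bool (d \<in> C) - of_bool (opp d \<in> C)" if d: "d \<in> darts - B" "fst d \<notin> set ws" for d
      using cnt[OF d(1)] cnt[OF opp_in_int[OF d(1)]] nc[of d] nc[of "opp d"] d opp_int[OF d(1)]
      unfolding st by simp
    show "contour d \<in> C \<longleftrightarrow> d \<in> C" if d: "d \<in> darts" "fst (contour d) \<notin> set ws" for d
    proof
      have pw: "fst p \<in> set ws" "fst p' \<in> set ws"
        using ws by (auto simp: walk_def)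
          (metis hd_in_set, metis last_in_set)
      {
        assume "d \<in> C"
        then obtain i where i: "0 < i" "i \<le> m" "d = (contour ^^ i) p" by (auto simp: C_def)
        have "i \<noteq> m"
        proof
          assume "i = m"
          hence "d = p'" using i p by simp
          thus False using d(2) fst_contour(2)[OF p(3)] pw by simp
        qed
        hence "0 < Suc i \<and> Suc i \<le> m" "contour d = (contour ^^ Suc i) p" using i by auto
        thus "contour d \<in> C" unfolding C_def by blast
      next
        assume "contour d \<in> C"
        then obtain i where i: "0 < i" "i \<le> m" "contour d = (contour ^^ i) p" by (auto simp: C_def)
        then obtain j where j: "i = Suc j" by (cases i) auto
        hence "contour d = contour ((contour ^^ j) p)" using i by simp
        hence dj: "d = (contour ^^ j) p"
          using inj_onD[OF inj_contour] d(1) contour_pow_in[OF pd] by blast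
        have "j \<noteq> 0"
        proof
          assume "j = 0"
          hence "d = p" using dj by simp
          thus False using d(2) fst_contour(2)[OF p(1)] pw by simp
        qed
        thus "d \<in> C" using dj j i unfolding C_def by auto
      }
    qed
  qed (use q ys disj in auto)
  moreover have "q \<in> C" using q(3) unfolding C_def by auto
  moreover have "q' \<notin> C" using q(4) unfolding C_def by auto
  ultimately show False by simp
qed

subsection \<open>Boundary arcs\<close>

definition boundary_gap :: "complex \<times> complex \<Rightarrow> nat" where
  "boundary_gap p = (LEAST n. 0 < n \<and> (contour ^^ n) p \<in> B)"

lemma boundary_gap_props:
  assumes "p \<in> B"
  shows "0 < boundary_gap p" "succ p = (contour ^^ boundary_gap p) p" "succ p \<in> B"
    "\<And>i. 0 < i \<Longrightarrow> i < boundary_gap p \<Longrightarrow> (contour ^^ i) p \<notin> B"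
proof -
  have pd: "p \<in> darts" using assms B_subset by auto
  obtain n where "n > 0" "(contour ^^ n) p = p" by (rule finite_orbit_returns[OF contour_perm finite_darts pd])
  hence "\<exists>n. 0 < n \<and> (contour ^^ n) p \<in> B" using assms by metis
  from LeastI_ex[OF this] have g: "0 < boundary_gap p \<and> (contour ^^ boundary_gap p) p \<in> B" unfolding boundary_gap_def .
  show s: "succ p = (contour ^^ boundary_gap p) p" by (simp add: bd_succ_def boundary_gap_def)
  show "0 < boundary_gap p" "succ p \<in> B" using g s by auto
  show "(contour ^^ i) p \<notin> B" if "0 < i" "i < boundary_gap p" for i
    using not_less_Least[of i "\<lambda>n. 0 < n \<and> (contour ^^ n) p \<in> B"] that unfolding boundary_gap_def by auto
qed

lemma succ_in: "succ ` B \<subseteq> B"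
  using boundary_gap_props(3) by auto

lemma inj_succ: "inj_on succ B"
proof -
  have *: "p = q" if pq: "p \<in> B" "q \<in> B" "succ p = succ q" "boundary_gap p \<le> boundary_gap q" for p q
  proof -
    have d: "p \<in> darts" "q \<in> darts" using pq B_subset by auto
    have "(contour ^^ boundary_gap p) p = (contour ^^ (boundary_gap p + (boundary_gap q - boundary_gap p))) q"
      using pq boundary_gap_props(2) by simp
    hence e: "p = (contour ^^ (boundary_gap q - boundary_gap p)) q"
      by (rule funpow_cancel[OF contour_perm d])
    have "boundary_gap q - boundary_gap p = 0"
    proof (rule ccontr)
      assume "boundary_gap q - boundary_gap p \<noteq> 0"
      moreover have "boundary_gap q - boundary_gap p < boundary_gap q" using boundary_gap_props(1) pq by simp
      ultimately have "(contour ^^ (boundary_gap q - boundary_gap p)) q \<notin> B" using boundary_gap_props(4)[OF pq(2)] by simp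
      thus False using e pq(1) by metis
    qed
    thus ?thesis using e by simp
  qed
  show ?thesis
  proof (rule inj_onI)
    fix p q assume "p \<in> B" "q \<in> B" "succ p = succ q"
    thus "p = q" using *[of p q] *[of q p] by (metis linear)
  qed
qed

lemmas succ_perm = inj_succ succ_in

lemma succ_pow_in: "p \<in> B \<Longrightarrow> (succ ^^ n) p \<in> B"
  using inj_on_funpow(2)[OF succ_perm] by blast

definition position :: "complex \<times> complex \<Rightarrow> nat \<Rightarrow> nat" where
  "position p k = (\<Sum>i<k. boundary_gap ((succ ^^ i) p))"

lemma position_contour: "p \<in> B \<Longrightarrow> (contour ^^ position p k) p = (succ ^^ k) p"
proof (induction k)
  case (Suc k)
  have "(contour ^^ position p (Suc k)) p = (contour ^^ boundary_gap ((succ ^^ k) p)) ((contour ^^ position p k) p)"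
    unfolding position_def by (simp add: funpow_add add.commute)
  thus ?case using Suc boundary_gap_props(2)[OF succ_pow_in[of p k]] by simp
qed (simp add: position_def)

lemma position_mono:
  assumes "p \<in> B" "k < l"
  shows "position p k < position p l"
proof -
  have step: "position p k < position p (Suc k)" for k
    using boundary_gap_props(1)[OF succ_pow_in[OF assms(1)], of k] by (simp add: position_def)
  show ?thesis using lift_Suc_mono_less[of "position p", OF step assms(2)] .
qed

lemma position_ge: "p \<in> B \<Longrightarrow> k \<le> position p k"
proof (induction k)
  case (Suc k)
  thus ?case using position_mono[of p k "Suc k"] by simp
qed simp

text \<open>Between two consecutive boundary points the contour visits no other half-edge.\<close>

lemma contour_hits_succ:
  assumes p: "p \<in> B" and i: "0 < i" "i \<le> position p k" "(contour ^^ i) p \<in> B"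
  shows "\<exists>l. 0 < l \<and> l \<le> k \<and> (contour ^^ i) p = (succ ^^ l) p"
  using i
proof (induction k)
  case 0
  thus ?case by (simp add: position_def)
next
  case (Suc k)
  show ?case
  proof (cases "i \<le> position p k")
    case True
    thus ?thesis using Suc by (meson le_SucI)
  next
    case False
    define j where "j = i - position p k"
    have ij: "i = j + position p k" "0 < j" using False by (auto simp: j_def)
    have e: "(contour ^^ i) p = (contour ^^ j) ((succ ^^ k) p)"
      unfolding ij(1) by (simp add: funpow_add position_contour[OF p])
    have "j \<le> boundary_gap ((succ ^^ k) p)" using Suc.prems(2) ij by (simp add: position_def)
    moreover have "\<not> j < boundary_gap ((succ ^^ k) p)"
      using boundary_gap_props(4)[OF succ_pow_in[OF p], of j k] ij(2) e Suc.prems(3) by auto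
    ultimately have "j = boundary_gap ((succ ^^ k) p)" by simp
    hence "(contour ^^ i) p = (succ ^^ Suc k) p" using e boundary_gap_props(2)[OF succ_pow_in[OF p]] by simp
    thus ?thesis by blast
  qed
qed

lemma period_succ: "p \<in> B \<Longrightarrow> 0 < period succ p" "p \<in> B \<Longrightarrow> (succ ^^ period succ p) p = p"
  "p \<in> B \<Longrightarrow> i < period succ p \<Longrightarrow> j < period succ p \<Longrightarrow> (succ ^^ i) p = (succ ^^ j) p \<Longrightarrow> i = j"
  using period_props[OF succ_perm finite_B] by blast+

lemma boundary_succ_orbit:
  assumes "p \<in> B"
  shows "B = (\<lambda>k. (succ ^^ k) p) ` {..<period succ p}"
proof
  show "(\<lambda>k. (succ ^^ k) p) ` {..<period succ p} \<subseteq> B" using succ_pow_in[OF assms] by auto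
  show "B \<subseteq> (\<lambda>k. (succ ^^ k) p) ` {..<period succ p}"
  proof
    fix q assume q: "q \<in> B"
    obtain n where n: "q = (contour ^^ n) p" by (rule boundary_one_contour[OF assms q])
    have "\<exists>l. q = (succ ^^ l) p"
    proof (cases "n = 0")
      case True
      thus ?thesis using n by (intro exI[of _ 0]) simp
    next
      case False
      thus ?thesis using contour_hits_succ[OF assms _ position_ge[OF assms, of n]] q n by blast
    qed
    then obtain l where "q = (succ ^^ l) p" ..
    moreover obtain m where "m < period succ p" "(succ ^^ l) p = (succ ^^ m) p"
      using period_props(5)[OF succ_perm finite_B assms] by blast
    ultimately show "q \<in> (\<lambda>k. (succ ^^ k) p) ` {..<period succ p}" by auto
  qed
qed

lemma period_succ_shift:
  assumes "p \<in> B"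
  shows "period succ ((succ ^^ s) p) = period succ p"
proof -
  have "(succ ^^ n) ((succ ^^ s) p) = (succ ^^ s) p \<longleftrightarrow> (succ ^^ n) p = p" for n
  proof
    assume "(succ ^^ n) ((succ ^^ s) p) = (succ ^^ s) p"
    hence "(succ ^^ s) p = (succ ^^ (s + n)) p" by (simp add: funpow_add add.commute)
    thus "(succ ^^ n) p = p" using funpow_cancel[OF succ_perm assms assms] by metis
  next
    assume a: "(succ ^^ n) p = p"
    have "(succ ^^ n) ((succ ^^ s) p) = (succ ^^ s) ((succ ^^ n) p)"
      by (metis add.commute comp_apply funpow_add)
    thus "(succ ^^ n) ((succ ^^ s) p) = (succ ^^ s) p" using a by simp
  qed
  thus ?thesis unfolding period_def by simp
qed

lemma arc_eq:
  assumes p: "p \<in> B" and n: "n < period succ p"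
  shows "bd_arc E V p ((succ ^^ n) p) = (\<lambda>m. (succ ^^ m) p) ` {..n}"
proof -
  have "(LEAST m. (succ ^^ m) p = (succ ^^ n) p) = n"
  proof (rule Least_equality)
    show "n \<le> m" if m: "(succ ^^ m) p = (succ ^^ n) p" for m
    proof (rule ccontr)
      assume "\<not> n \<le> m"
      thus False using period_succ(3)[OF p _ n m] n by simp
    qed
  qed simp
  thus ?thesis unfolding bd_arc_def by auto
qed

text \<open>In the enumeration of the boundary that starts at \<open>a\<close>, the four arcs are intervals of indices. The last one ends at
  the period, where \<open>a\<close> is met again.\<close>

lemma four_arcs:
  assumes a: "a \<in> B" and l: "listed_ccw E V a b c d"
  obtains i j k where "0 < i" "i < j" "j < k" "k < period succ a"
    "bd_arc E V a b = (\<lambda>m. (succ ^^ m) a) ` {0..i}" "bd_arc E V b c = (\<lambda>m. (succ ^^ m) a) ` {i..j}"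
    "bd_arc E V c d = (\<lambda>m. (succ ^^ m) a) ` {j..k}" "bd_arc E V d a = (\<lambda>m. (succ ^^ m) a) ` {k..period succ a}"
proof -
  define K where "K = period succ a"
  obtain i j k where ijk: "0 < i" "i < j" "j < k" "\<And>m. 0 < m \<Longrightarrow> m \<le> k \<Longrightarrow> (succ ^^ m) a \<noteq> a"
    "(succ ^^ i) a = b" "(succ ^^ j) a = c" "(succ ^^ k) a = d"
    using l unfolding listed_ccw_def by blast
  have kK: "k < K"
  proof (rule ccontr)
    assume "\<not> k < K"
    thus False using ijk(4)[of K] period_succ(1,2)[OF a] by (simp add: K_def)
  qed
  have arc: "bd_arc E V ((succ ^^ s) a) ((succ ^^ t) a) = (\<lambda>m. (succ ^^ m) a) ` {s..t}"
    if "s \<le> t" "t - s < K" for s t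
  proof -
    have "(succ ^^ t) a = (succ ^^ (t - s)) ((succ ^^ s) a)"
    proof -
      have "(succ ^^ t) a = (succ ^^ (t - s + s)) a" using that by simp
      thus ?thesis unfolding funpow_add by simp
    qed
    hence "bd_arc E V ((succ ^^ s) a) ((succ ^^ t) a) = (\<lambda>m. (succ ^^ m) ((succ ^^ s) a)) ` {..t - s}"
      using arc_eq[OF succ_pow_in[OF a], of "t - s" s] that(2) period_succ_shift[OF a] by (simp add: K_def)
    also have "\<dots> = (\<lambda>m. (succ ^^ (m + s)) a) ` {..t - s}" by (simp add: funpow_add)
    also have "\<dots> = (\<lambda>m. (succ ^^ m) a) ` ((\<lambda>m. m + s) ` {..t - s})" by (simp add: image_image)
    also have "(\<lambda>m. m + s) ` {..t - s} = {s..t}"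
      using that image_add_atLeastAtMost'[of s 0 "t - s"] by (simp add: atMost_atLeast0)
    finally show ?thesis .
  qed
  show ?thesis
  proof (rule that[of i j k])
    show "bd_arc E V a b = (\<lambda>m. (succ ^^ m) a) ` {0..i}" using arc[of 0 i] ijk kK by simp
    show "bd_arc E V b c = (\<lambda>m. (succ ^^ m) a) ` {i..j}" using arc[of i j] ijk kK by simp
    show "bd_arc E V c d = (\<lambda>m. (succ ^^ m) a) ` {j..k}" using arc[of j k] ijk kK by simp
    show "bd_arc E V d a = (\<lambda>m. (succ ^^ m) a) ` {k..period succ a}"
      using arc[of k K] ijk kK period_succ(2)[OF a] by (simp add: K_def)
  qed (use ijk kK in \<open>auto simp: K_def\<close>)
qed

text \<open>If none of the four end points coincide, they are interlaced along the contour from \<open>p\<close> on, where \<open>p\<close> is the one with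
  index \<open>s\<close>; this covers also the end points that are met after the return to \<open>a\<close>.\<close>

lemma arc_walks_meet:
  assumes a: "a \<in> B" and idx: "s \<le> i" "i \<le> r" "r \<le> j" "j \<le> s'" "s' \<le> k" "k \<le> r'" "r' \<le> period succ a"
    and ws: "walk IE ws" "hd ws = fst ((succ ^^ s) a)" "last ws = fst ((succ ^^ s') a)"
    and ys: "walk IE ys" "hd ys = fst ((succ ^^ r) a)" "last ys = fst ((succ ^^ r') a)"
  shows "set ws \<inter> set ys \<noteq> {}"
proof -
  define K where "K = period succ a"
  have ne: "ws \<noteq> []" "ys \<noteq> []" using ws ys by (auto simp: walk_def)
  have ends: "hd ws \<in> set ws" "last ws \<in> set ws" "hd ys \<in> set ys" "last ys \<in> set ys" using ne by auto
  have KK: "(succ ^^ K) a = (succ ^^ 0) a" using period_succ(2)[OF a] by (simp add: K_def)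
  consider "s = r" | "r = s'" | "s' = r'" | "r' = K" "s = 0" | "s < r" "r < s'" "s' < r'" "r' < s + K"
    using idx by (fastforce simp: K_def)
  thus ?thesis
  proof cases
    case 1
    thus ?thesis using ends ws ys by auto
  next
    case 2
    thus ?thesis using ends ws ys by auto
  next
    case 3
    thus ?thesis using ends ws ys by auto
  next
    case 4
    hence "hd ws = last ys" using ws(2) ys(3) KK by simp
    thus ?thesis using ends by auto
  next
    case 5
    define p where "p = (succ ^^ s) a"
    have p: "p \<in> B" unfolding p_def by (rule succ_pow_in[OF a])
    have Kp: "period succ p = K" unfolding p_def K_def by (rule period_succ_shift[OF a])
    have shift: "(succ ^^ n) a = (succ ^^ (n - s)) p" if "s \<le> n" for n
    proof -
      have "(succ ^^ n) a = (succ ^^ (n - s + s)) a" using that by simp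
      thus ?thesis unfolding funpow_add p_def by simp
    qed
    define m where "m = position p (s' - s)"
    have hit: "\<exists>l. 0 < l \<and> l \<le> s' - s \<and> (contour ^^ n) p = (succ ^^ l) p"
      if "0 < n" "n \<le> m" "(contour ^^ n) p \<in> B" for n
      using contour_hits_succ[OF p that(1) _ that(3)] that(2) unfolding m_def by blast
    have idx_inj: "(succ ^^ u) p \<noteq> (succ ^^ l) p" if "u < K" "l < K" "u \<noteq> l" for u l
      using period_succ(3)[OF p, of u l] that Kp by auto
    show ?thesis
    proof (rule interlaced_walks_meet[where p = p and p' = "(succ ^^ s') a" and q = "(succ ^^ r) a" and q' = "(succ ^^ r') a"])
      show "p \<in> B" by (rule p)
      show "(succ ^^ s') a = (contour ^^ m) p"
        using position_contour[OF p] shift[of s'] 5 by (simp add: m_def)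
      show "(contour ^^ n) p \<noteq> p" if n: "0 < n" "n \<le> m" for n
      proof
        assume e: "(contour ^^ n) p = p"
        hence "(contour ^^ n) p \<in> B" using p by simp
        then obtain l where "0 < l" "l \<le> s' - s" "(contour ^^ n) p = (succ ^^ l) p"
          using hit[OF n] by blast
        hence l: "0 < l" "l \<le> s' - s" "(succ ^^ 0) p = (succ ^^ l) p" using e by auto
        have "0 < K" "l < K" using l(1,2) 5 by auto
        from idx_inj[OF this] l show False by blast
      qed
      show "\<exists>n. 0 < n \<and> n \<le> m \<and> (succ ^^ r) a = (contour ^^ n) p"
      proof (intro exI[of _ "position p (r - s)"] conjI)
        show "0 < position p (r - s)" using position_ge[OF p, of "r - s"] 5 by linarith
        show "position p (r - s) \<le> m"
          using position_mono[OF p, of "r - s" "s' - s"] 5 diff_less_mono[of r s' s] unfolding m_def by simp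
        show "(succ ^^ r) a = (contour ^^ position p (r - s)) p"
          using position_contour[OF p] shift[of r] 5 by simp
      qed
      show "(succ ^^ r') a \<noteq> (contour ^^ n) p" if n: "0 < n" "n \<le> m" for n
      proof
        assume e: "(succ ^^ r') a = (contour ^^ n) p"
        hence "(contour ^^ n) p \<in> B" using succ_pow_in[OF a, of r'] by simp
        then obtain l where l: "0 < l" "l \<le> s' - s" "(contour ^^ n) p = (succ ^^ l) p"
          using hit[OF n] by blast
        have "(succ ^^ (r' - s)) p = (succ ^^ l) p" using l(3) e shift[of r'] 5 by simp
        thus False using idx_inj[of "r' - s" l] l 5 by auto
      qed
    qed (use ws ys succ_pow_in[OF a] in \<open>auto simp: p_def\<close>)
  qed
qed

end

section \<open>Faces have boundedly many corners\<close>

text \<open>The directions that have negative inner products with both sides of an angle \<open>\<beta>\<close> form an arc of length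
  \<open>\<pi> - \<beta> \<ge> \<eta>\<close>, and this is longer than the distance of consecutive directions among \<open>M\<close> equidistributed ones.\<close>

lemma exposing_direction:
  fixes A C :: complex and M :: nat
  assumes A: "A \<noteq> 0" and C: "C = of_real r * cis \<beta> * A" "r > 0" and \<beta>: "0 < \<beta>" "\<beta> \<le> pi - \<eta>"
    and M: "real M * \<eta> > 2 * pi"
  shows "\<exists>k<M. inner (cis (2 * pi * real k / real M)) A < 0 \<and> inner (cis (2 * pi * real k / real M)) C < 0"
proof -
  have eta: "\<eta> > 0"
  proof (rule ccontr)
    assume "\<not> \<eta> > 0"
    hence "real M * \<eta> \<le> 0" by (intro mult_nonneg_nonpos) auto
    thus False using M pi_gt_zero by linarith
  qed
  have M0: "M > 0" using M eta pi_gt_zero by (cases M) auto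
  define \<alpha> where "\<alpha> = Arg A"
  have A_eq: "A = of_real (cmod A) * cis \<alpha>"
    unfolding \<alpha>_def using A by (simp add: cis_Arg sgn_eq)
  have C_eq: "C = of_real (r * cmod A) * cis (\<alpha> + \<beta>)"
    unfolding C(1) by (subst A_eq) (simp add: cis_mult[symmetric] mult_ac)
  have inn: "inner (cis \<psi>) (of_real R * cis \<theta>) = R * cos (\<psi> - \<theta>)" for \<psi> R \<theta>
    by (simp add: inner_complex_def cos_diff algebra_simps)
  \<comment> \<open>The arc starts at the angle \<open>L\<close>; the smallest multiple of \<open>2\<pi> / M\<close> beyond \<open>L\<close> is taken.\<close>
  define L where "L = \<alpha> + \<beta> + pi / 2"
  define k where "k = \<lfloor>L * real M / (2 * pi)\<rfloor> + 1"
  define \<psi> where "\<psi> = 2 * pi * real_of_int k / real M"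
  have k1: "L * real M / (2 * pi) < real_of_int k" "real_of_int k \<le> L * real M / (2 * pi) + 1"
    unfolding k_def by linarith+
  have "L * real M < real_of_int k * (2 * pi)" using k1(1) by (simp add: pos_divide_less_eq)
  hence lo: "L < \<psi>" unfolding \<psi>_def using M0 by (simp add: pos_less_divide_eq mult_ac)
  have "real_of_int k * (2 * pi) \<le> (L * real M / (2 * pi) + 1) * (2 * pi)"
    using k1(2) by (intro mult_right_mono) auto
  also have "\<dots> = L * real M + 2 * pi" by (simp add: field_simps)
  also have "\<dots> < L * real M + real M * \<eta>" using M by simp
  finally have hi: "\<psi> < L + \<eta>" unfolding \<psi>_def using M0
    by (simp add: pos_divide_less_eq algebra_simps)
  have neg: "cos x < 0" if "pi / 2 < x" "x < 3 * pi / 2" for x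
  proof -
    have "cos (x - pi) > 0" using that by (intro cos_gt_zero_pi) auto
    thus ?thesis by (simp add: cos_diff)
  qed
  have "cos (\<psi> - \<alpha>) < 0" by (rule neg) (use lo hi \<beta> in \<open>auto simp: L_def field_simps\<close>)
  hence nA: "inner (cis \<psi>) A < 0" by (subst A_eq) (use A in \<open>simp add: inn mult_pos_neg\<close>)
  have "cos (\<psi> - (\<alpha> + \<beta>)) < 0" by (rule neg) (use lo hi \<beta> in \<open>auto simp: L_def field_simps\<close>)
  hence nC: "inner (cis \<psi>) C < 0"
    unfolding C_eq inn using A C(2) by (intro mult_pos_neg) auto
  define k' where "k' = nat (k mod int M)"
  have k': "k' < M" "int k' = k mod int M" using M0 by (auto simp: k'_def nat_less_iff)
  have "real_of_int k = real M * real_of_int (k div int M) + real k'"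
  proof -
    have "k = int M * (k div int M) + int k'" using k'(2) by simp
    thus ?thesis by (metis of_int_add of_int_mult of_int_of_nat_eq)
  qed
  hence "\<psi> = 2 * pi * real_of_int (k div int M) + 2 * pi * real k' / real M"
    unfolding \<psi>_def using M0 by (simp add: field_simps)
  hence "cis \<psi> = cis (2 * pi * real k' / real M)" by (simp flip: cis_mult)
  thus ?thesis using nA nC k'(1) by auto
qed

text \<open>Whether two points see each other is decided in a ball. Edges that cross the ball with both end points outside are left
  out of \<open>near_edges\<close>, which makes this family finite; at the vertices inside the ball, it contains all edges.\<close>

locale local_graph = admissible_graph +
  fixes R :: real
  assumes eta0: "\<eta>\<^sub>0 > 0"
begin

abbreviation "X \<equiv> ball (0::complex) R"

definition near_edges :: "complex set set" where
  "near_edges = {e \<in> E. e \<inter> X \<noteq> {}}"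

definition free_region :: "complex set" where
  "free_region = X - support near_edges"

lemma finite_near_edges: "finite near_edges"
proof -
  have "finite (cball 0 R \<inter> \<Gamma>)"
    by (rule finite_not_islimpt_in_compact) (use no_accumulation in auto)
  hence fin: "finite (\<Gamma> \<inter> X)" by (rule rev_finite_subset) auto
  have "near_edges \<subseteq> (\<Union>v\<in>\<Gamma> \<inter> X. (\<lambda>x. {v, x}) ` nbrs E v)"
  proof
    fix e assume e: "e \<in> near_edges"
    hence "e \<in> E" by (simp add: near_edges_def)
    then obtain p q where pq: "e = {p, q}" "p \<in> \<Gamma>" "q \<in> \<Gamma>" by (rule edge_hull)
    have n: "q \<in> nbrs E p" "p \<in> nbrs E q" using \<open>e \<in> E\<close> pq(1) by (auto simp: in_nbrs_iff insert_commute)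
    have "p \<in> X \<or> q \<in> X" using e pq(1) by (auto simp: near_edges_def)
    thus "e \<in> (\<Union>v\<in>\<Gamma> \<inter> X. (\<lambda>x. {v, x}) ` nbrs E v)"
    proof
      assume "p \<in> X"
      thus ?thesis using n(1) pq by (intro UN_I[of p]) auto
    next
      assume "q \<in> X"
      moreover have "e = {q, p}" using pq(1) by auto
      ultimately show ?thesis using n(2) pq(3) by (intro UN_I[of q]) auto
    qed
  qed
  moreover have "finite (\<Union>v\<in>\<Gamma> \<inter> X. (\<lambda>x. {v, x}) ` nbrs E v)" using fin finite_nbrs by auto
  ultimately show ?thesis by (rule finite_subset)
qed

lemma near_edges_subset: "near_edges \<subseteq> E"
  by (auto simp: near_edges_def)

lemma open_free_region: "open free_region"
  unfolding free_region_def using closed_support_edges[OF finite_near_edges near_edges_subset] by auto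

lemma segment_in_support: "{p, q} \<in> F \<Longrightarrow> closed_segment p q \<subseteq> support F"
  by (auto simp: support_def segment_convex_hull)

text \<open>If the segment touches the graph without crossing an edge, it contains a vertex in its interior: an edge that runs along
  the segment ends before it reaches the end points. At a vertex the edges do not fit into a half-plane. So
  in all cases a corner with legs on both sides blocks the view.\<close>

lemma blocking_corner:
  assumes xy: "x \<in> free_region" "y \<in> free_region" and z: "z \<in> open_segment x y" "z \<in> support near_edges"
  obtains z' p q where "z' \<in> open_segment x y" "cross2 (y - x) (p - x) > 0" "cross2 (y - x) (q - x) < 0"
    "closed_segment z' p \<subseteq> support near_edges" "closed_segment z' q \<subseteq> support near_edges"
proof -
  note found = that
  define D where "D = y - x"
  have D: "D \<noteq> 0" using z by (auto simp: D_def)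
  have onX: "t \<in> X" if "t \<in> open_segment x y" for t
  proof -
    have "closed_segment x y \<subseteq> X" using xy by (intro closed_segment_subset) (auto simp: free_region_def)
    thus ?thesis using that segment_open_subset_closed by blast
  qed
  have par: "\<exists>r. 0 < r \<and> r < 1 \<and> t = x + of_real r * D" if "t \<in> open_segment x y" for t
    using that by (auto simp: in_segment D_def scaleR_conv_of_real algebra_simps)
  have vertex: ?thesis if t: "t \<in> open_segment x y" "t \<in> \<Gamma>" for t
  proof -
    obtain r where r: "t = x + of_real r * D" using par[OF t(1)] by blast
    have off: "cross2 D (p - x) = cross2 D (p - t)" for p
      unfolding r by (simp add: cross2_def algebra_simps)
    obtain p where p: "p \<in> nbrs E t" "cross2 D (p - t) > 0" by (rule nbr_left_of_direction[OF t(2) D eta0])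
    have "- D \<noteq> 0" using D by simp
    then obtain q where q: "q \<in> nbrs E t" "cross2 (- D) (q - t) > 0"
      by (rule nbr_left_of_direction[OF t(2) _ eta0])
    have q': "cross2 D (q - t) < 0" using q(2) by (simp add: cross2_def)
    have "{t, p} \<in> near_edges" "{t, q} \<in> near_edges"
      using p q onX[OF t(1)] by (auto simp: near_edges_def in_nbrs_iff)
    thus ?thesis
      using found[OF t(1), of p q] p(2) q' segment_in_support off[of p] off[of q] by (simp add: D_def)
  qed
  obtain e where e: "e \<in> near_edges" "z \<in> convex hull e" using z(2) by (auto simp: support_def)
  have "e \<in> E" using e near_edges_subset by auto
  then obtain a b where ab: "e = {a, b}" "a \<noteq> b" "a \<in> \<Gamma>" "b \<in> \<Gamma>" "convex hull e = closed_segment a b"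
    by (rule edge_hull)
  have seg: "closed_segment a b \<subseteq> support near_edges" using segment_in_support e(1) ab(1) by simp
  obtain r where r: "0 < r" "r < 1" "z = x + of_real r * D" using par[OF z(1)] by blast
  show ?thesis
  proof (cases "z \<in> {a, b}")
    case True
    thus ?thesis using vertex[OF z(1)] ab by auto
  next
    case False
    have zo: "z \<in> open_segment a b" using e(2) ab(5) False by (auto simp: open_segment_def)
    then obtain t where t: "0 < t" "t < 1" "z = (1 - t) *\<^sub>R a + t *\<^sub>R b" by (auto simp: in_segment)
    define ca where "ca = cross2 D (a - x)"
    define cb where "cb = cross2 D (b - x)"
    have "cross2 D (z - x) = 0" unfolding r(3) by (simp add: cross2_def)
    moreover have "cross2 D (z - x) = (1 - t) * ca + t * cb"
      unfolding t(3) ca_def cb_def by (simp add: cross2_def algebra_simps)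
    ultimately have sum: "(1 - t) * ca + t * cb = 0" by simp
    have za: "closed_segment z a \<subseteq> support near_edges" and zb: "closed_segment z b \<subseteq> support near_edges"
      using zo seg by (meson closed_segment_subset convex_closed_segment ends_in_segment
          segment_open_subset_closed subset_iff subset_trans)+
    consider "ca > 0" | "ca < 0" | "ca = 0" by linarith
    thus ?thesis
    proof cases
      case 1
      hence "(1 - t) * ca > 0" using t by simp
      hence "cb < 0" using sum t(1) by (smt (verit) mult_nonneg_nonneg)
      thus ?thesis using found[OF z(1), of a b] 1 za zb by (simp add: ca_def cb_def D_def)
    next
      case 2
      hence "(1 - t) * ca < 0" using t by (simp add: mult_pos_neg)
      hence "cb > 0" using sum t(1) by (smt (verit) mult_nonneg_nonpos)
      thus ?thesis using found[OF z(1), of b a] 2 za zb by (simp add: ca_def cb_def D_def)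
    next
      case 3
      hence "cb = 0" using sum t(1) by simp
      obtain \<alpha> where \<alpha>: "a - x = of_real \<alpha> * D" using cross2_zero_collinear[of D "a - x"] 3 D by (auto simp: ca_def)
      obtain \<beta> where \<beta>: "b - x = of_real \<beta> * D" using cross2_zero_collinear[of D "b - x"] \<open>cb = 0\<close> D by (auto simp: cb_def)
      have a': "a = x + of_real \<alpha> * D" and b': "b = x + of_real \<beta> * D" using \<alpha> \<beta> by (auto simp: algebra_simps)
      have comb: "(1 - s) *\<^sub>R a + s *\<^sub>R b = x + of_real ((1 - s) * \<alpha> + s * \<beta>) * D" for s
        unfolding a' b' by (simp add: scaleR_conv_of_real algebra_simps)
      have "x + of_real r * D = x + of_real ((1 - t) * \<alpha> + t * \<beta>) * D"
        using t(3) r(3) comb[of t] by (simp only:)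
      hence rr: "r = (1 - t) * \<alpha> + t * \<beta>"
        using D by (simp del: of_real_diff of_real_add of_real_mult)
      have no: "\<not> (\<exists>s. 0 \<le> s \<and> s \<le> 1 \<and> (1 - s) * \<alpha> + s * \<beta> = c)" if "x + of_real c * D \<in> free_region" for c
      proof
        assume "\<exists>s. 0 \<le> s \<and> s \<le> 1 \<and> (1 - s) * \<alpha> + s * \<beta> = c"
        then obtain s where s: "0 \<le> s" "s \<le> 1" "(1 - s) * \<alpha> + s * \<beta> = c" by blast
        have "(1 - s) *\<^sub>R a + s *\<^sub>R b \<in> closed_segment a b" using s by (auto simp: in_segment)
        hence "x + of_real c * D \<in> closed_segment a b" unfolding comb s(3) .
        thus False using that seg by (auto simp: free_region_def)
      qed
      have n0: "\<not> (\<exists>s. 0 \<le> s \<and> s \<le> 1 \<and> (1 - s) * \<alpha> + s * \<beta> = 0)" using no[of 0] xy by simp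
      have n1: "\<not> (\<exists>s. 0 \<le> s \<and> s \<le> 1 \<and> (1 - s) * \<alpha> + s * \<beta> = 1)" using no[of 1] xy by (simp add: D_def)
      have "\<alpha> \<noteq> \<beta>" using a' b' ab(2) by auto
      have hit: "\<exists>s. 0 \<le> s \<and> s \<le> 1 \<and> (1 - s) * \<alpha> + s * \<beta> = c" if "(\<alpha> \<le> c \<and> c \<le> r) \<or> (r \<le> c \<and> c \<le> \<alpha>)" for c
      proof -
        define s where "s = (if \<alpha> = r then 0 else t * ((c - \<alpha>) / (r - \<alpha>)))"
        have "\<alpha> \<noteq> r" using rr \<open>\<alpha> \<noteq> \<beta>\<close> t by (auto simp: algebra_simps)
        have f: "0 \<le> (c - \<alpha>) / (r - \<alpha>)" "(c - \<alpha>) / (r - \<alpha>) \<le> 1"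
          using that \<open>\<alpha> \<noteq> r\<close> by (auto simp: divide_simps)
        have "(1 - s) * \<alpha> + s * \<beta> = \<alpha> + ((c - \<alpha>) / (r - \<alpha>)) * (t * (\<beta> - \<alpha>))"
          unfolding s_def if_not_P[OF \<open>\<alpha> \<noteq> r\<close>] by algebra
        also have "t * (\<beta> - \<alpha>) = r - \<alpha>" using rr by (simp add: algebra_simps)
        finally have "(1 - s) * \<alpha> + s * \<beta> = c" using \<open>\<alpha> \<noteq> r\<close> by simp
        moreover have "0 \<le> s" "s \<le> 1"
          unfolding s_def if_not_P[OF \<open>\<alpha> \<noteq> r\<close>] using f t by (auto intro: mult_nonneg_nonneg mult_le_one simp del: times_divide_eq_right)
        ultimately show ?thesis by blast
      qed
      have "0 < \<alpha>" using n0 hit[of 0] r by (meson less_imp_le not_le)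
      moreover have "\<alpha> < 1" using n1 hit[of 1] r by (meson less_imp_le not_le)
      ultimately have "a \<in> open_segment x y"
        unfolding in_segment using D by (auto simp: a' D_def scaleR_conv_of_real algebra_simps intro!: exI[of _ \<alpha>])
      thus ?thesis using vertex ab(3) by blast
    qed
  qed
qed

text \<open>The points of the component that are visible from \<open>x\<close> form an open set, and the others do so as well, since a
  blocking corner blocks the view of all points nearby.\<close>

lemma segment_stays_in_component:
  assumes x: "x \<in> free_region" and y: "y \<in> connected_component_set free_region x"
  shows "closed_segment x y \<subseteq> free_region"
proof -
  define C where "C = connected_component_set free_region x"
  have C: "open C" "connected C" "C \<subseteq> free_region" "x \<in> C"
    unfolding C_def using open_connected_component[OF open_free_region] connected_component_subset x
    by (auto simp: connected_component_refl_eq)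
  define T where "T = {y \<in> C. closed_segment x y \<subseteq> free_region}"
  have opT: "openin (top_of_set C) T"
  proof -
    have "open T"
      unfolding open_dist
    proof (intro ballI)
      fix y assume y: "y \<in> T"
      obtain e where e: "e > 0" "(\<Union>t\<in>closed_segment x y. ball t e) \<subseteq> free_region"
        by (rule compact_subset_open_imp_ball_epsilon_subset[OF compact_segment open_free_region])
           (use y in \<open>auto simp: T_def\<close>)
      obtain e' where e': "e' > 0" "ball y e' \<subseteq> C"
        using C(1) y by (auto simp: T_def open_contains_ball)
      show "\<exists>e>0. \<forall>y'. dist y' y < e \<longrightarrow> y' \<in> T"
      proof (intro exI[of _ "min e e'"] conjI allI impI)
        fix y' assume d: "dist y' y < min e e'"
        have "closed_segment x y' \<subseteq> free_region"
        proof
          fix z assume "z \<in> closed_segment x y'"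
          then obtain t where t: "0 \<le> t" "t \<le> 1" "z = (1 - t) *\<^sub>R x + t *\<^sub>R y'" by (auto simp: in_segment)
          define z0 where "z0 = (1 - t) *\<^sub>R x + t *\<^sub>R y"
          have "z0 \<in> closed_segment x y" using t by (auto simp: in_segment z0_def)
          moreover have "dist z0 z < e"
          proof -
            have "z0 - z = t *\<^sub>R (y - y')" by (simp add: z0_def t(3) algebra_simps)
            hence "dist z0 z = t * dist y' y" using t(1) by (simp add: dist_norm norm_minus_commute)
            also have "\<dots> \<le> 1 * dist y' y" using t by (intro mult_right_mono) auto
            finally show ?thesis using d by simp
          qed
          ultimately show "z \<in> free_region" using e(2) by (meson UN_I mem_ball subsetD)
        qed
        moreover have "y' \<in> C" using e'(2) d by (auto simp: dist_commute)
        ultimately show "y' \<in> T" by (simp add: T_def)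
      qed (use e e' in auto)
    qed
    moreover have "T \<subseteq> C" by (auto simp: T_def)
    ultimately show ?thesis by (simp add: openin_open_eq[OF C(1)])
  qed
  have "open (C - T)"
    unfolding open_dist
  proof (intro ballI)
    fix y assume y: "y \<in> C - T"
    then obtain z where z: "z \<in> closed_segment x y" "z \<notin> free_region" by (auto simp: T_def)
    have yg: "y \<in> free_region" using y C by auto
    have "closed_segment x y \<subseteq> X" using x yg by (intro closed_segment_subset) (auto simp: free_region_def)
    hence zs: "z \<in> support near_edges" using z by (auto simp: free_region_def)
    have "z \<in> open_segment x y" using z x yg by (auto simp: open_segment_def)
    from blocking_corner[OF x yg this zs] obtain z' p q where c: "z' \<in> open_segment x y"
      "cross2 (y - x) (p - x) > 0" "cross2 (y - x) (q - x) < 0"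
      "closed_segment z' p \<subseteq> support near_edges" "closed_segment z' q \<subseteq> support near_edges" by blast
    obtain e where e: "e > 0"
      "\<And>y'. dist y' y < e \<Longrightarrow> closed_segment x y' \<inter> (closed_segment z' p \<union> closed_segment z' q) \<noteq> {}"
      by (rule blocked_view_stable[OF c(1,2,3)]) (rule that, assumption, blast)
    obtain e' where e': "e' > 0" "ball y e' \<subseteq> C" using C(1) y by (auto simp: open_contains_ball)
    show "\<exists>e>0. \<forall>y'. dist y' y < e \<longrightarrow> y' \<in> C - T"
    proof (intro exI[of _ "min e e'"] conjI allI impI)
      fix y' assume d: "dist y' y < min e e'"
      hence "closed_segment x y' \<inter> (closed_segment z' p \<union> closed_segment z' q) \<noteq> {}" using e(2) by simp
      hence "\<not> closed_segment x y' \<subseteq> free_region" using c(4,5) by (auto simp: free_region_def)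
      moreover have "y' \<in> C" using e'(2) d by (auto simp: dist_commute)
      ultimately show "y' \<in> C - T" by (simp add: T_def)
    qed (use e e' in auto)
  qed
  hence clT: "closedin (top_of_set C) T"
    unfolding closedin_def using C(1) by (auto simp: openin_open_eq T_def)
  have "T \<noteq> {}" using C(3,4) x by (auto simp: T_def)
  hence "T = C" using C(2)[unfolded connected_clopen, rule_format, OF conjI[OF opT clT]] by simp
  thus ?thesis using y by (auto simp: T_def C_def)
qed

lemma convex_component: "convex (connected_component_set free_region z)"
  unfolding convex_contains_segment
proof (intro ballI)
  fix x y assume xy: "x \<in> connected_component_set free_region z" "y \<in> connected_component_set free_region z"
  have x: "x \<in> free_region" using xy(1) connected_component_in[of free_region z x] by simp
  have eq: "connected_component_set free_region z = connected_component_set free_region x"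
    using connected_component_eq[of x free_region z] xy(1) by simp
  have "closed_segment x y \<subseteq> free_region" using segment_stays_in_component[OF x] xy(2) eq by simp
  hence "closed_segment x y \<subseteq> connected_component_set free_region x"
    by (intro connected_component_maximal) auto
  thus "closed_segment x y \<subseteq> connected_component_set free_region z" using eq by simp
qed

text \<open>The base points close to the edge all lie in one component of the free region; the limit selects this component
  independently of a choice of \<open>\<epsilon>\<close>.\<close>

definition face :: "complex \<Rightarrow> complex \<Rightarrow> complex set" where
  "face u v = {z. eventually (\<lambda>\<epsilon>. connected_component free_region (right_germ u v \<epsilon>) z) (at_right 0)}"

lemma face_germs:
  assumes e: "{u, v} \<in> E" and X: "u \<in> X" "v \<in> X"
  shows "eventually (\<lambda>\<epsilon>. connected_component_set free_region (right_germ u v \<epsilon>) = face u v \<and> right_germ u v \<epsilon> \<in> face u v)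
    (at_right 0)"
proof -
  have "(u + v) / 2 \<in> closed_segment u v"
    using midpoint_in_closed_segment[of u v] by (simp add: midpoint_def scaleR_conv_of_real mult.commute)
  hence "(u + v) / 2 \<in> X" using X closed_segment_subset[OF X convex_ball] by blast
  then obtain e0 where e0: "e0 > 0" "\<And>\<epsilon> \<epsilon>'. 0 < \<epsilon> \<and> \<epsilon> < e0 \<and> 0 < \<epsilon>' \<and> \<epsilon>' < e0 \<Longrightarrow>
      connected_component free_region (right_germ u v \<epsilon>) (right_germ u v \<epsilon>')"
    using right_germ_stable[OF e finite_near_edges near_edges_subset open_ball] unfolding free_region_def by blast
  define C where "C = connected_component_set free_region (right_germ u v (e0 / 2))"
  have ceq: "connected_component_set free_region (right_germ u v \<epsilon>) = C" if "0 < \<epsilon>" "\<epsilon> < e0" for \<epsilon>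
    unfolding C_def
    by (rule connected_component_eq) (use e0(2)[of "e0/2" \<epsilon>] e0(1) that in auto)
  have ev: "eventually (\<lambda>\<epsilon>. connected_component_set free_region (right_germ u v \<epsilon>) = C) (at_right 0)"
    by (rule eventually_at_right_0I[OF e0(1)]) (rule ceq)
  have fC: "face u v = C"
  proof -
    have "z \<in> face u v \<longleftrightarrow> z \<in> C" for z
    proof -
      have "eventually (\<lambda>\<epsilon>. connected_component free_region (right_germ u v \<epsilon>) z \<longleftrightarrow> z \<in> C) (at_right 0)"
        using ev by eventually_elim auto
      hence "z \<in> face u v \<longleftrightarrow> eventually (\<lambda>\<epsilon>. z \<in> C) (at_right (0::real))"
        unfolding face_def mem_Collect_eq by (rule eventually_subst)
      thus ?thesis by (simp add: eventually_const)
    qed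
    thus ?thesis by blast
  qed
  have mem: "eventually (\<lambda>\<epsilon>. right_germ u v \<epsilon> \<in> connected_component_set free_region (right_germ u v \<epsilon>)) (at_right 0)"
  proof (rule eventually_at_right_0I[OF e0(1)])
    fix \<epsilon> :: real assume "0 < \<epsilon>" "\<epsilon> < e0"
    thus "right_germ u v \<epsilon> \<in> connected_component_set free_region (right_germ u v \<epsilon>)" using e0(2)[of \<epsilon> \<epsilon>] by simp
  qed
  show ?thesis unfolding fC using ev mem by eventually_elim metis
qed

lemma face_component:
  assumes "{u, v} \<in> E" "u \<in> X" "v \<in> X"
  obtains z where "face u v = connected_component_set free_region z"
  using eventually_happens[OF face_germs[OF assms]] by (auto simp: trivial_limit_at_right_real)

lemma face_props:
  assumes "{u, v} \<in> E" "u \<in> X" "v \<in> X"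
  shows "convex (face u v)" "open (face u v)" "face u v \<subseteq> free_region"
proof -
  obtain z where z: "face u v = connected_component_set free_region z" by (rule face_component[OF assms])
  show "convex (face u v)" unfolding z by (rule convex_component)
  show "open (face u v)" unfolding z by (rule open_connected_component[OF open_free_region])
  show "face u v \<subseteq> free_region" unfolding z by (rule connected_component_subset)
qed

lemma closure_of_limit:
  fixes f :: "real \<Rightarrow> complex"
  assumes "(f \<longlongrightarrow> l) (at_right 0)" "eventually (\<lambda>\<epsilon>. f \<epsilon> \<in> S) (at_right 0)"
  shows "l \<in> closure S"
proof (rule Lim_in_closed_set[OF closed_closure _ _ assms(1)])
  show "eventually (\<lambda>\<epsilon>. f \<epsilon> \<in> closure S) (at_right 0)"
    using assms(2) by (rule eventually_mono) (use closure_subset in auto)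
qed (rule trivial_limit_at_right_real)

lemma midpoint_in_closure_face:
  assumes "{u, v} \<in> E" "u \<in> X" "v \<in> X"
  shows "(u + v) / 2 \<in> closure (face u v)"
  by (rule closure_of_limit[OF tendsto_right_germ])
     (use face_germs[OF assms] in \<open>auto elim: eventually_mono\<close>)

text \<open>A point of the convex face on the left of the edge would see the points just to the right of the midpoint across
  the edge. A point on the line of the edge can be moved to the left within the open face.\<close>

lemma face_right_of_edge:
  assumes e: "{u, v} \<in> E" "u \<in> X" "v \<in> X" and z: "z \<in> face u v"
  shows "cross2 (v - u) (z - u) < 0"
proof (rule ccontr)
  assume neg: "\<not> cross2 (v - u) (z - u) < 0"
  have uv: "v - u \<noteq> 0" using edge_vertices[OF e(1)] by auto
  note fp = face_props[OF e]
  obtain r where r: "r > 0" "ball z r \<subseteq> face u v" using fp(2) z by (auto simp: open_contains_ball)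
  define \<delta> where "\<delta> = r / (2 * cmod (v - u))"
  have \<delta>: "\<delta> > 0" using r(1) uv by (simp add: \<delta>_def)
  define y where "y = z + of_real \<delta> * (\<i> * (v - u))"
  have "dist z y = \<delta> * cmod (v - u)" unfolding y_def using \<delta> by (simp add: dist_norm norm_mult)
  hence "dist z y = r / 2" using uv by (simp add: \<delta>_def)
  hence yF: "y \<in> face u v" using r by auto
  have cy: "cross2 (v - u) (y - u) > 0"
  proof -
    have "y - u = (z - u) + of_real \<delta> * (\<i> * (v - u))" by (simp add: y_def)
    hence "cross2 (v - u) (y - u) = cross2 (v - u) (z - u) + \<delta> * (cmod (v - u))\<^sup>2"
      by (simp only: cross2_linear(2,8) cross2_rotate)
    thus ?thesis using neg \<delta> uv by (simp add: add_nonneg_pos)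
  qed
  define m where "m = (u + v) / 2"
  have lim: "(right_germ u v \<longlongrightarrow> m) (at_right 0)" unfolding m_def by (rule tendsto_right_germ)
  define h where "h = (\<lambda>g. cross2 (y - g) (u - g) * cross2 (y - g) (v - g))"
  have "continuous_on UNIV h" unfolding h_def by (intro continuous_intros)
  hence "isCont h m" by (simp add: continuous_on_eq_continuous_at)
  hence "((\<lambda>\<epsilon>. h (right_germ u v \<epsilon>)) \<longlongrightarrow> h m) (at_right 0)" using isCont_tendsto_compose lim by blast
  moreover have "h m < 0"
  proof -
    have um: "u - m = of_real (-1/2) * (v - u)" and vm: "v - m = of_real (1/2) * (v - u)"
      by (simp_all add: m_def field_simps)
    have "cross2 (v - u) (y - m) = cross2 (v - u) (y - u)"
      unfolding m_def by (simp add: cross2_def field_simps)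
    hence c: "cross2 (y - m) (v - u) = - cross2 (v - u) (y - u)" using cross2_swap[of "v - u" "y - m"] by simp
    have "h m = - (1/4) * (cross2 (v - u) (y - u))\<^sup>2"
      unfolding h_def um vm cross2_linear(8) c by (simp add: power2_eq_square)
    thus ?thesis using cy by simp
  qed
  ultimately have "eventually (\<lambda>\<epsilon>. h (right_germ u v \<epsilon>) < 0) (at_right 0)" by (rule order_tendstoD(2))
  moreover have "eventually (\<lambda>\<epsilon>::real. \<epsilon> > 0) (at_right 0)" by (rule eventually_at_right_less)
  ultimately have "eventually (\<lambda>\<epsilon>. h (right_germ u v \<epsilon>) < 0 \<and> right_germ u v \<epsilon> \<in> face u v \<and> \<epsilon> > 0) (at_right 0)"
    using face_germs[OF e] by eventually_elim simp
  then obtain \<epsilon> where \<epsilon>: "h (right_germ u v \<epsilon>) < 0" "right_germ u v \<epsilon> \<in> face u v" "\<epsilon> > 0"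
    using eventually_happens[of _ "at_right (0::real)"] by (auto simp: trivial_limit_at_right_real)
  define g where "g = right_germ u v \<epsilon>"
  have gu: "g - u = of_real (1/2) * (v - u) - of_real \<epsilon> * (\<i> * (v - u))"
    by (simp add: g_def right_germ_def field_simps)
  have "cross2 (v - u) (g - u) = - \<epsilon> * (cmod (v - u))\<^sup>2"
    unfolding gu by (simp only: cross2_linear(4,8,9) cross2_rotate)
  hence cg: "cross2 (v - u) (g - u) < 0" using \<epsilon>(3) uv by simp
  have "closed_segment u v \<inter> closed_segment g y \<noteq> {}"
    by (rule segments_cross[OF cg cy]) (use \<epsilon>(1) in \<open>simp add: h_def g_def\<close>)
  moreover have "closed_segment g y \<subseteq> free_region"
    using closed_segment_subset[OF \<epsilon>(2) yF fp(1)] fp(3) by (auto simp: g_def)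
  moreover have "closed_segment u v \<inter> free_region = {}"
    using segment_in_support[of u v near_edges] e by (auto simp: free_region_def near_edges_def)
  ultimately show False by blast
qed

lemma face_corner:
  assumes u: "u \<in> nbrs E v" and x: "x = next_nbr E v u" and X: "u \<in> X" "v \<in> X" "x \<in> X"
  shows "face u v = face v x" "v \<in> closure (face u v)"
proof -
  have xn: "x \<in> nbrs E v" unfolding x using next_nbr_in nbr_vertices[OF u] by blast
  have e: "{u, v} \<in> E" "{v, x} \<in> E" using u xn by (auto simp: in_nbrs_iff insert_commute)
  obtain e0 where e0: "e0 > 0" "\<And>\<epsilon>. 0 < \<epsilon> \<and> \<epsilon> < e0 \<Longrightarrow>
    connected_component free_region (right_germ u v \<epsilon>) (right_germ v x \<epsilon>) \<and>
    connected_component free_region (right_germ u v \<epsilon>) (v + (of_real \<epsilon> * (u - v) + of_real \<epsilon> * (x - v)))"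
    using corner_sector_full[OF u x finite_near_edges near_edges_subset convex_ball X eta0]
    unfolding free_region_def by blast
  have ev: "eventually (\<lambda>\<epsilon>. connected_component free_region (right_germ u v \<epsilon>) (right_germ v x \<epsilon>) \<and>
    connected_component free_region (right_germ u v \<epsilon>) (v + (of_real \<epsilon> * (u - v) + of_real \<epsilon> * (x - v)))) (at_right 0)"
    by (rule eventually_at_right_0I[OF e0(1)]) (use e0(2) in simp)
  have "eventually (\<lambda>\<epsilon>. face u v = face v x) (at_right (0::real))"
    using ev face_germs[OF e(1) X(1,2)] face_germs[OF e(2) X(2,3)]
  proof eventually_elim
    case (elim \<epsilon>)
    have "right_germ v x \<epsilon> \<in> connected_component_set free_region (right_germ u v \<epsilon>)" using elim(1) by simp
    from connected_component_eq[OF this] show ?case using elim(2,3) by metis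
  qed
  thus "face u v = face v x" by (simp add: eventually_const)
  show "v \<in> closure (face u v)"
  proof (rule closure_of_limit)
    have "((\<lambda>\<epsilon>::real. v + (of_real \<epsilon> * (u - v) + of_real \<epsilon> * (x - v))) \<longlongrightarrow>
        v + (of_real 0 * (u - v) + of_real 0 * (x - v))) (at_right 0)" by (intro tendsto_intros)
    thus "((\<lambda>\<epsilon>::real. v + (of_real \<epsilon> * (u - v) + of_real \<epsilon> * (x - v))) \<longlongrightarrow> v) (at_right 0)" by simp
    show "eventually (\<lambda>\<epsilon>. v + (of_real \<epsilon> * (u - v) + of_real \<epsilon> * (x - v)) \<in> face u v) (at_right 0)"
      using ev face_germs[OF e(1) X(1,2)]
    proof eventually_elim
      case (elim \<epsilon>)
      thus ?case by (metis mem_Collect_eq)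
    qed
  qed
qed

lemma closure_halfplane:
  assumes "\<And>z. z \<in> S \<Longrightarrow> cross2 a (z - b) > 0" "z \<in> closure S"
  shows "cross2 a (z - b) \<ge> 0"
proof -
  have "closed {z. cross2 a (z - b) \<ge> 0}"
    by (intro closed_Collect_le continuous_intros)
  hence "closure S \<subseteq> {z. cross2 a (z - b) \<ge> 0}"
    by (intro closure_minimal) (use assms(1) in \<open>auto intro: less_imp_le\<close>)
  thus ?thesis using assms(2) by auto
qed

text \<open>The face lies in the convex cone at each of its corners. If \<open>n\<close> has negative inner products with the legs of the cone,
  then its maximum on the closure of the face is attained at the apex only, and the two corners have the same
  vertex. Then each of the two first legs is in the closure of the other cone, so that they have the same direction.\<close>

lemma exposed_corner_unique:
  assumes u: "u \<in> nbrs E v" "x = next_nbr E v u" "u \<in> X" "v \<in> X" "x \<in> X"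
    and u': "u' \<in> nbrs E v'" "x' = next_nbr E v' u'" "u' \<in> X" "v' \<in> X" "x' \<in> X"
    and F: "face u v = face u' v'"
    and n: "inner n (u - v) < 0" "inner n (x - v) < 0" "inner n (u' - v') < 0" "inner n (x' - v') < 0"
  shows "v = v' \<and> u = u'"
proof -
  have cone: "cross2 (u - v) (z - v) > 0" "cross2 (x - v) (z - v) < 0" if z: "z \<in> face u v"
    and h: "u \<in> nbrs E v" "x = next_nbr E v u" "u \<in> X" "v \<in> X" "x \<in> X" for u v x z
  proof -
    have xn: "x \<in> nbrs E v" unfolding h(2) using next_nbr_in nbr_vertices[OF h(1)] by blast
    have e: "{u, v} \<in> E" "{v, x} \<in> E" using h(1) xn by (auto simp: in_nbrs_iff insert_commute)
    have "cross2 (v - u) (z - u) < 0" by (rule face_right_of_edge[OF e(1) h(3,4) z])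
    moreover have "cross2 (v - u) (z - u) = - cross2 (u - v) (z - v)" by (simp add: cross2_def algebra_simps)
    ultimately show "cross2 (u - v) (z - v) > 0" by simp
    show "cross2 (x - v) (z - v) < 0"
      using face_right_of_edge[OF e(2) h(4,5)] z face_corner(1)[OF h] by simp
  qed
  have below: "inner n (z - v) \<le> 0 \<and> (inner n (z - v) = 0 \<longrightarrow> z = v)" if z: "z \<in> closure (face u v)"
    and h: "u \<in> nbrs E v" "x = next_nbr E v u" "u \<in> X" "v \<in> X" "x \<in> X"
    and nn: "inner n (u - v) < 0" "inner n (x - v) < 0" for u v x z
  proof -
    have 1: "cross2 (u - v) (z - v) \<ge> 0" by (rule closure_halfplane[OF cone(1)[OF _ h] z])
    have 2: "cross2 (- (x - v)) (z - v) \<ge> 0"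
      by (rule closure_halfplane[OF _ z]) (use cone(2)[OF _ h] in \<open>simp only: cross2_linear(5) neg_0_less_iff_less\<close>)
    have c: "cross2 (u - v) (x - v) > 0" unfolding h(2) by (rule next_nbr_cross[OF h(1) eta0])
    define s where "s = cross2 (z - v) (x - v) / cross2 (u - v) (x - v)"
    define t where "t = cross2 (u - v) (z - v) / cross2 (u - v) (x - v)"
    have "cross2 (z - v) (x - v) \<ge> 0" using 2 cross2_swap[of "x - v" "z - v"] unfolding cross2_linear(5) by linarith
    hence s: "s \<ge> 0" using c by (simp add: s_def)
    have t: "t \<ge> 0" using 1 c by (simp add: t_def)
    have zv: "z - v = of_real s * (u - v) + of_real t * (x - v)"
      unfolding s_def t_def by (rule cross2_cramer) (use c in simp)
    hence "z - v = s *\<^sub>R (u - v) + t *\<^sub>R (x - v)" by (simp add: scaleR_conv_of_real)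
    hence i: "inner n (z - v) = s * inner n (u - v) + t * inner n (x - v)" by (simp add: inner_add_right)
    have a: "s * inner n (u - v) \<le> 0" "t * inner n (x - v) \<le> 0"
      using s t nn by (auto intro: mult_nonneg_nonpos)
    have "z = v" if "inner n (z - v) = 0"
    proof -
      have "s * inner n (u - v) = 0" "t * inner n (x - v) = 0" using a i that by linarith+
      hence "s = 0" "t = 0" using nn by auto
      thus ?thesis using zv by simp
    qed
    thus ?thesis using i a by auto
  qed
  have b1: "inner n (v' - v) \<le> 0 \<and> (inner n (v' - v) = 0 \<longrightarrow> v' = v)"
    by (rule below[OF _ u n(1,2)]) (use face_corner(2)[OF u'] F in simp)
  have b2: "inner n (v - v') \<le> 0 \<and> (inner n (v - v') = 0 \<longrightarrow> v = v')"
    by (rule below[OF _ u' n(3,4)]) (use face_corner(2)[OF u] F in simp)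
  have "inner n (v' - v) = - inner n (v - v')" by (simp add: inner_diff_right)
  hence vv: "v = v'" using b1 b2 by auto
  have e: "{u, v} \<in> E" "{u', v} \<in> E" using u(1) u'(1) vv by (auto simp: in_nbrs_iff insert_commute)
  have mid: "cross2 (a - v) ((b + v) / 2 - v) = cross2 (a - v) (b - v) / 2" for a b
    by (simp add: cross2_def field_simps)
  have "cross2 (u - v) ((u' + v) / 2 - v) \<ge> 0"
    by (rule closure_halfplane[OF cone(1)[OF _ u]])
       (use midpoint_in_closure_face[OF e(2) u'(3)] u(4) F vv in auto)
  hence c1: "cross2 (u - v) (u' - v) \<ge> 0" unfolding mid by simp
  have "cross2 (u' - v') ((u + v) / 2 - v') \<ge> 0"
    by (rule closure_halfplane[OF cone(1)[OF _ u']])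
       (use midpoint_in_closure_face[OF e(1) u(3,4)] F in auto)
  hence "cross2 (u' - v) (u - v) \<ge> 0" unfolding vv[symmetric] mid by simp
  hence c0: "cross2 (u - v) (u' - v) = 0" using c1 cross2_swap[of "u - v" "u' - v"] by linarith
  have nz: "u - v \<noteq> 0" using nbr_neq[OF u(1)] by simp
  obtain r where r: "u' - v = of_real r * (u - v)" using cross2_zero_collinear[OF c0 nz] .
  obtain z where z: "z \<in> face u v"
    using face_corner(2)[OF u] closure_empty by fastforce
  have p1: "cross2 (u - v) (z - v) > 0" by (rule cone(1)[OF z u])
  have "cross2 (u' - v') (z - v') > 0" by (rule cone(1)[OF _ u']) (use z F in simp)
  hence "r * cross2 (u - v) (z - v) > 0" unfolding vv[symmetric] r cross2_linear(7) .
  hence "r > 0" using p1 by (simp add: zero_less_mult_iff)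
  have "u' \<in> nbrs E v" using u'(1) unfolding vv[symmetric] .
  from nbr_same_direction[OF u(1) this r \<open>r > 0\<close>] have "u = u'" .
  thus ?thesis by (rule conjI[OF vv])
qed

end

context planar_domain
begin

text \<open>The label of a dart is the face on its right. The corner at the tail of the dart is exposed by one of \<open>M\<close> directions, and
  on the darts with a common face this direction determines the dart.\<close>

lemma bounded_face_labelling:
  fixes M :: nat
  assumes M: "real M * \<eta>\<^sub>0 > 2 * pi"
  obtains \<Phi> :: "complex \<times> complex \<Rightarrow> complex set"
  where "\<And>d. d \<in> darts - B \<Longrightarrow> \<Phi> (contour d) = \<Phi> d" "\<And>F. card {d \<in> darts. \<Phi> d = F} \<le> M"
proof -
  have "finite (fst ` darts \<union> snd ` darts)" using finite_darts by auto
  hence "bounded (fst ` darts \<union> snd ` darts)" by (rule finite_imp_bounded)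
  then obtain b where b: "\<And>z. z \<in> fst ` darts \<union> snd ` darts \<Longrightarrow> norm z \<le> b"
    unfolding bounded_iff by blast
  define R where "R = b + 1"
  have R: "norm z < R" if "z \<in> fst ` darts \<union> snd ` darts" for z using b[OF that] by (simp add: R_def)
  interpret local_graph \<Gamma> E w \<omega>\<^sub>0 \<eta>\<^sub>0 \<kappa>\<^sub>0 R by unfold_locales (rule eta_pos)
  have inX: "fst d \<in> X" "snd d \<in> X" if "d \<in> darts" for d using R that by auto
  define \<Phi> where "\<Phi> = (\<lambda>d. face (fst d) (snd d))"
  have c1: "\<Phi> (contour d) = \<Phi> d" if d: "d \<in> darts - B" for d
  proof -
    obtain u v where uv: "d = (u, v)" by (cases d)
    have v: "v \<in> V" "u \<in> nbrs E v" using d uv by (auto simp: B_iff darts_def in_nbrs_iff insert_commute)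
    have cd: "contour d = (v, next_nbr E v u)" using uv v by simp
    have "(v, next_nbr E v u) \<in> darts" using contour_in d cd by auto
    hence "next_nbr E v u \<in> X" using inX(2) by fastforce
    moreover have "u \<in> X" "v \<in> X" using inX[of d] d uv by auto
    ultimately have "face u v = face v (next_nbr E v u)" using face_corner(1)[OF v(2) refl] by simp
    thus ?thesis unfolding \<Phi>_def cd unfolding uv by simp
  qed
  define dir where "dir = (\<lambda>k::nat. cis (2 * pi * real k / real M))"
  have "\<forall>d\<in>darts. \<exists>u. d = rot (fst d, u) \<and> (fst d, u) \<in> darts"
  proof
    fix d assume "d \<in> darts"
    have "rot ` darts = darts"
      by (rule endo_inj_surj[OF finite_darts _ inj_rot]) (use rot_in in auto)
    then obtain d0 where d0: "d0 \<in> darts" "d = rot d0" using \<open>d \<in> darts\<close> by blast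
    obtain p q where pq: "d0 = (p, q)" by (cases d0)
    have "d = rot (fst d, q) \<and> (fst d, q) \<in> darts" using d0 by (simp add: pq rot_def)
    thus "\<exists>u. d = rot (fst d, u) \<and> (fst d, u) \<in> darts" by (rule exI)
  qed
  from bchoice[OF this] obtain prev
    where prev': "\<forall>d\<in>darts. d = rot (fst d, prev d) \<and> (fst d, prev d) \<in> darts" ..
  have prev: "d = rot (fst d, prev d)" "(fst d, prev d) \<in> darts" if "d \<in> darts" for d
    using bspec[OF prev' that] by auto
  have pn: "prev d \<in> nbrs E (fst d)" "snd d = next_nbr E (fst d) (prev d)" "prev d \<in> X" "fst d \<in> X" "snd d \<in> X"
    if "d \<in> darts" for d
  proof -
    show "prev d \<in> nbrs E (fst d)" using prev(2)[OF that] by (simp add: darts_iff)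
    show "snd d = next_nbr E (fst d) (prev d)"
      using arg_cong[OF prev(1)[OF that], of snd] by (simp add: rot_def)
    show "prev d \<in> X" using inX(2)[OF prev(2)[OF that]] by simp
  qed (use inX that in auto)
  have "\<forall>d\<in>darts. \<exists>k. k < M \<and> inner (dir k) (prev d - fst d) < 0 \<and> inner (dir k) (snd d - fst d) < 0"
  proof
    fix d assume d: "d \<in> darts"
    define A where "A = prev d - fst d"
    define C where "C = snd d - fst d"
    have "snd d \<in> nbrs E (fst d)" using d by (cases d) (simp add: darts_iff)
    hence nz: "A \<noteq> 0" "C \<noteq> 0"
      using nbr_neq[of "snd d" "fst d"] nbr_neq[OF pn(1)[OF d]] by (simp_all add: A_def C_def)
    obtain r where r: "r > 0" "C = of_real r * cis (ccw_angle A C) * A" by (rule cis_ccw_angle[OF nz])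
    have "ccw_angle A C \<le> pi - \<eta>\<^sub>0"
      unfolding A_def C_def pn(2)[OF d] by (rule angles) (use pn(1)[OF d] nbr_vertices in auto)
    from exposing_direction[OF nz(1) r(2,1) ccw_angle_bounds(1) this M]
    show "\<exists>k. k < M \<and> inner (dir k) (prev d - fst d) < 0 \<and> inner (dir k) (snd d - fst d) < 0"
      unfolding dir_def A_def C_def .
  qed
  from bchoice[OF this] obtain \<kappa> where \<kappa>': "\<forall>d\<in>darts. \<kappa> d < M \<and> inner (dir (\<kappa> d)) (prev d - fst d) < 0 \<and>
      inner (dir (\<kappa> d)) (snd d - fst d) < 0" ..
  have \<kappa>: "\<kappa> d < M" "inner (dir (\<kappa> d)) (prev d - fst d) < 0" "inner (dir (\<kappa> d)) (snd d - fst d) < 0"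
    if "d \<in> darts" for d using bspec[OF \<kappa>' that] by auto
  have c2: "card {d \<in> darts. \<Phi> d = F} \<le> M" for F
  proof -
    have "inj_on \<kappa> {d \<in> darts. \<Phi> d = F}"
    proof (rule inj_onI)
      fix d d' assume d: "d \<in> {d \<in> darts. \<Phi> d = F}" "d' \<in> {d \<in> darts. \<Phi> d = F}" and k: "\<kappa> d = \<kappa> d'"
      have dd: "d \<in> darts" "d' \<in> darts" using d by auto
      have fc: "face (prev e) (fst e) = \<Phi> e" if "e \<in> darts" for e
        using face_corner(1)[OF pn[OF that]] by (simp add: \<Phi>_def)
      have same: "face (prev d) (fst d) = face (prev d') (fst d')" using fc[OF dd(1)] fc[OF dd(2)] d by simp
      have "fst d = fst d' \<and> prev d = prev d'"
        by (rule exposed_corner_unique[OF pn[OF dd(1)] pn[OF dd(2)] same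
              \<kappa>(2,3)[OF dd(1)] \<kappa>(2,3)[OF dd(2), folded k]])
      thus "d = d'" using prev(1)[OF dd(1)] prev(1)[OF dd(2)] by simp
    qed
    moreover have "\<kappa> ` {d \<in> darts. \<Phi> d = F} \<subseteq> {..<M}" using \<kappa> by auto
    ultimately show ?thesis using card_inj_on_le[of \<kappa> _ "{..<M}"] by simp
  qed
  show ?thesis by (rule that[OF c1 c2])
qed

end

section \<open>Paths along a cut\<close>

lemma walk_connect_refl: "\<exists>ws. walk F ws \<and> hd ws = x \<and> last ws = x"
  by (intro exI[of _ "[x]"]) (simp add: walk_simps)

lemma walk_connect_trans:
  assumes "\<exists>ws. walk F ws \<and> hd ws = x \<and> last ws = y" "\<exists>ws. walk F ws \<and> hd ws = y \<and> last ws = z"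
  shows "\<exists>ws. walk F ws \<and> hd ws = x \<and> last ws = z"
proof -
  obtain ws vs where w: "walk F ws" "hd ws = x" "last ws = y" "walk F vs" "hd vs = y" "last vs = z"
    using assms by blast
  have ne: "ws \<noteq> []" "vs \<noteq> []" using w walk_simps(3) by auto
  have ws: "ws = butlast ws @ [y]" using append_butlast_last_id[OF ne(1)] w(3) by simp
  have vs: "vs = y # tl vs" using w(5) ne(2) by (cases vs) auto
  have "walk F (butlast ws @ y # tl vs)"
    using walk_append[of F "butlast ws" y "tl vs"] w(1,4) ws vs by metis
  moreover have "hd (butlast ws @ y # tl vs) = x"
  proof -
    have "hd (butlast ws @ y # tl vs) = hd (butlast ws @ [y])" by (cases "butlast ws") auto
    thus ?thesis using ws w(2) by metis
  qed
  moreover have "last (butlast ws @ y # tl vs) = z" using w(6) vs by (metis last_appendR list.distinct(1))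
  ultimately show ?thesis by blast
qed

lemma walk_connect_sym:
  assumes "\<exists>ws. walk F ws \<and> hd ws = x \<and> last ws = y"
  shows "\<exists>ws. walk F ws \<and> hd ws = y \<and> last ws = x"
proof -
  obtain ws where w: "walk F ws" "hd ws = x" "last ws = y" using assms by blast
  have "ws \<noteq> []" using w walk_simps(3) by auto
  thus ?thesis using w walk_rev[of F ws] by (intro exI[of _ "rev ws"]) (auto simp: hd_rev last_rev)
qed

lemma walk_connect_edge: "{x, y} \<in> F \<Longrightarrow> \<exists>ws. walk F ws \<and> hd ws = x \<and> last ws = y"
  by (intro exI[of _ "[x, y]"]) (simp add: walk_simps)

lemma distinct_walk:
  assumes "walk F ws"
  shows "\<exists>vs. walk F vs \<and> hd vs = hd ws \<and> last vs = last ws \<and> distinct vs"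
  using assms
proof (induction "length ws" arbitrary: ws rule: less_induct)
  case less
  show ?case
  proof (cases "distinct ws")
    case False
    then obtain as x bs cs where ws: "ws = as @ [x] @ bs @ [x] @ cs" using not_distinct_decomp by blast
    have w: "walk F (as @ x # bs @ x # cs)" using less.prems ws by simp
    have "walk F (as @ [x])" "walk F ((x # bs) @ x # cs)" using w walk_append[of F as x "bs @ x # cs"] by auto
    moreover have "walk F (x # cs)" using calculation(2) walk_append[of F "x # bs" x cs] by simp
    ultimately have "walk F (as @ x # cs)" using walk_append[of F as x cs] by simp
    moreover have "length (as @ x # cs) < length ws" using ws by simp
    ultimately obtain vs where "walk F vs" "hd vs = hd (as @ x # cs)" "last vs = last (as @ x # cs)" "distinct vs"
      using less.hyps by blast
    moreover have "hd (as @ x # cs) = hd ws" "last (as @ x # cs) = last ws" using ws by (auto simp: hd_append)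
    ultimately show ?thesis by metis
  qed (use less in blast)
qed

lemma path_length_steps: "path_length g vs = (\<Sum>(x, y)\<leftarrow>steps vs. g {x, y})"
proof -
  have "(\<Sum>(x, y)\<leftarrow>steps vs. g {x, y}) = (\<Sum>i<length (steps vs). (\<lambda>(x, y). g {x, y}) (steps vs ! i))"
    by (simp add: sum_list_sum_nth atLeast0LessThan)
  also have "\<dots> = (\<Sum>i<length vs - 1. g {vs ! i, vs ! Suc i})"
    by (rule sum.cong) (auto simp: steps_def nth_tl)
  finally show ?thesis by (simp add: path_length_def)
qed

lemma steps_path: "vs \<noteq> [] \<Longrightarrow> steps ([a] @ vs @ [b]) = (a, hd vs) # steps vs @ [(last vs, b)]"
  using steps_snoc[of vs b] by (cases vs) auto

lemma distinct_steps_edges: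
  assumes "distinct vs"
  shows "distinct (map (\<lambda>(x, y). {x, y}) (steps vs))"
  using assms
proof (induction vs rule: induct_list012)
  case (3 x y zs)
  have "{x, y} \<noteq> {x', y'}" if "(x', y') \<in> set (steps (y # zs))" for x' y'
    using set_steps_subset[OF that] 3 by (auto simp: doubleton_eq_iff)
  thus ?case using 3 by auto
qed auto

context planar_domain
begin

definition edge :: "complex \<times> complex \<Rightarrow> complex set" where
  "edge d = {fst d, snd d}"

text \<open>The part of a contour from one half-edge to the next, or a whole contour without half-edges. Unlike the outer contour as
  a whole, a piece runs along a single face of the graph and has a bounded number of darts.\<close>

inductive piece :: "complex \<times> complex \<Rightarrow> complex \<times> complex \<Rightarrow> bool" for d where
  self: "piece d d"
| fwd: "piece d d' \<Longrightarrow> d' \<in> darts - B \<Longrightarrow> piece d (contour d')"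
| bwd: "piece d (contour d') \<Longrightarrow> d' \<in> darts - B \<Longrightarrow> piece d d'"

text \<open>The piece of \<open>d\<close> ends in the half-edge \<open>p\<close>.\<close>

definition hits :: "complex \<times> complex \<Rightarrow> complex \<times> complex \<Rightarrow> bool" where
  "hits d p \<longleftrightarrow> (\<exists>n. (contour ^^ n) d = p \<and> (\<forall>l<n. (contour ^^ l) d \<in> darts - B))"

lemma hits_contour:
  assumes d: "d \<in> darts - B" and p: "p \<in> B"
  shows "hits (contour d) p \<longleftrightarrow> hits d p"
proof
  assume "hits (contour d) p"
  then obtain n where n: "(contour ^^ n) (contour d) = p" "\<forall>l<n. (contour ^^ l) (contour d) \<in> darts - B"
    by (auto simp: hits_def)
  have "(contour ^^ Suc n) d = p" using n(1) by (simp add: funpow_swap1)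
  moreover have "(contour ^^ l) d \<in> darts - B" if "l < Suc n" for l
  proof (cases l)
    case (Suc m)
    thus ?thesis using n(2) that by (simp add: funpow_swap1)
  qed (use d in simp)
  ultimately show "hits d p" unfolding hits_def by blast
next
  assume "hits d p"
  then obtain n where n: "(contour ^^ n) d = p" "\<forall>l<n. (contour ^^ l) d \<in> darts - B" by (auto simp: hits_def)
  obtain m where m: "n = Suc m" using n(1) d p by (cases n) auto
  have "(contour ^^ m) (contour d) = p" using n(1) m by (simp add: funpow_swap1)
  moreover have "(contour ^^ l) (contour d) \<in> darts - B" if "l < m" for l
    using n(2)[rule_format, of "Suc l"] that m by (simp add: funpow_swap1)
  ultimately show "hits (contour d) p" unfolding hits_def by blast
qed

lemma hits_B: "d \<in> B \<Longrightarrow> hits d p \<Longrightarrow> d = p"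
  unfolding hits_def by (metis DiffD2 funpow_0 gr0I)

lemma hits_refl: "hits p p"
  unfolding hits_def by (rule exI[of _ 0]) simp

lemma hits_piece:
  assumes "hits d p"
  shows "piece d p"
proof -
  obtain n where n: "(contour ^^ n) d = p" "\<forall>l<n. (contour ^^ l) d \<in> darts - B"
    using assms by (auto simp: hits_def)
  have "piece d ((contour ^^ l) d)" if "l \<le> n" for l
    using that
  proof (induction l)
    case (Suc l)
    thus ?case using piece.fwd[of d "(contour ^^ l) d"] n(2) by simp
  qed (simp add: piece.self)
  thus ?thesis using n(1) by blast
qed

lemma piece_trans:
  assumes "piece d d'" "piece d' d''"
  shows "piece d d''"
  using assms(2,1) by induction (auto intro: piece.intros)

lemma piece_label:
  assumes "piece d d'" "\<And>d. d \<in> darts - B \<Longrightarrow> \<Phi> (contour d) = \<Phi> d"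
  shows "\<Phi> d' = \<Phi> d"
  using assms(1) by induction (use assms(2) in auto)

subsection \<open>Closed families of pieces\<close>

text \<open>Let a union \<open>K\<close> of pieces contain with each dart at which the level changes the dart on the other side of this edge, too.
  The sum of the changes of the level over the interior darts in \<open>K\<close> is zero, because the two
  orientations cancel. On the other hand it telescopes along each piece to the difference of the levels of its
  two half-edges.\<close>

lemma closed_pieces_sum:
  fixes level :: "complex \<Rightarrow> real" and level_B :: "complex \<times> complex \<Rightarrow> real"
  assumes K1: "\<And>d. d \<in> darts - B \<Longrightarrow> contour d \<in> K \<longleftrightarrow> d \<in> K"
    and K2: "\<And>d. d \<in> darts - B \<Longrightarrow> level (fst d) \<noteq> level (snd d) \<Longrightarrow> opp d \<in> K \<longleftrightarrow> d \<in> K"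
    and K3: "\<And>d. d \<in> B \<Longrightarrow> level (fst d) \<noteq> level_B d \<Longrightarrow> contour d \<in> K \<longleftrightarrow> d \<in> K"
  shows "(\<Sum>p\<in>B. level_B p * (of_bool (p \<in> K) - of_bool (succ p \<in> K))) = 0"
proof -
  define k where "k = (\<lambda>d. of_bool (d \<in> K) :: real)"
  have bij_opp: "bij_betw opp (darts - B) (darts - B)"
    by (rule bij_betw_byWitness[where f' = opp]) (use opp_opp opp_in_int in auto)
  have bij_contour: "bij_betw contour darts darts"
    unfolding bij_betw_def using inj_contour endo_inj_surj[OF finite_darts contour_in inj_contour] by simp
  define f where "f = (\<lambda>d. k d * (level (snd d) - level (fst d)))"
  have "(\<Sum>d\<in>darts - B. f (opp d)) = (\<Sum>d\<in>darts - B. f d)"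
    by (rule sum.reindex_bij_betw[OF bij_opp])
  moreover have "f (opp d) = - f d" if d: "d \<in> darts - B" for d
  proof (cases "level (fst d) = level (snd d)")
    case False
    thus ?thesis using K2[OF d] opp_int[OF d] by (simp add: f_def k_def)
  qed (simp add: f_def opp_int[OF d])
  ultimately have "(\<Sum>d\<in>darts - B. f d) = 0" by (simp add: sum_negf)
  hence s1: "(\<Sum>d\<in>darts - B. k d * level (snd d)) = (\<Sum>d\<in>darts - B. k d * level (fst d))"
    by (simp add: f_def right_diff_distrib sum_subtractf)
  define g where "g = (\<lambda>d. k d * level (fst d))"
  have "(\<Sum>d\<in>darts - B. g (contour d)) = (\<Sum>d\<in>darts - B. g d)"
  proof -
    have "g (contour d) = k d * level (snd d)" if "d \<in> darts - B" for d
      using K1[OF that] fst_contour(1)[OF that] by (simp add: g_def k_def)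
    thus ?thesis using s1 by (simp add: g_def)
  qed
  moreover have "(\<Sum>d\<in>darts. g (contour d)) = (\<Sum>d\<in>darts. g d)"
    by (rule sum.reindex_bij_betw[OF bij_contour])
  moreover have "sum h darts = sum h (darts - B) + sum h B" for h :: "complex \<times> complex \<Rightarrow> real"
    by (rule sum.subset_diff[OF B_subset finite_darts])
  ultimately have "(\<Sum>p\<in>B. g (contour p)) = (\<Sum>p\<in>B. g p)" by simp
  hence "(\<Sum>p\<in>B. level (fst p) * (k p - k (contour p))) = 0"
    using fst_contour(2) by (simp add: g_def right_diff_distrib sum_subtractf mult.commute)
  moreover have "level_B p * (of_bool (p \<in> K) - of_bool (succ p \<in> K)) = level (fst p) * (k p - k (contour p))"
    if p: "p \<in> B" for p
  proof -
    have "(contour ^^ Suc i) p \<in> K \<longleftrightarrow> contour p \<in> K" if "Suc i \<le> boundary_gap p" for i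
      using that
    proof (induction i)
      case (Suc i)
      have "(contour ^^ Suc i) p \<in> darts - B"
        using boundary_gap_props(4)[OF p, of "Suc i"] Suc.prems contour_pow_in[of p "Suc i"] p B_subset by auto
      thus ?case using K1 Suc by simp
    qed simp
    from this[of "boundary_gap p - 1"] have "succ p \<in> K \<longleftrightarrow> contour p \<in> K"
      using boundary_gap_props(1,2)[OF p] by simp
    thus ?thesis using K3[OF p] by (cases "level (fst p) = level_B p") (auto simp: k_def)
  qed
  ultimately show ?thesis by simp
qed

text \<open>Consider all pieces in the arc from \<open>b\<close> to \<open>c\<close> together with the pieces that can be reached from them over edges at which
  the level changes. If no piece in the arc from \<open>d\<close> to \<open>a\<close> were among them, then the sum in
  \<open>closed_pieces_sum\<close> would be the change of the level from \<open>b\<close> to \<open>c\<close>, which is one and not zero. The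
  path follows the contours of the pieces; \<open>Y\<close> consists of the darts of pieces in which the level changes.\<close>

lemma path_along_cut:
  fixes level :: "complex \<Rightarrow> real" and level_B :: "complex \<times> complex \<Rightarrow> real"
  defines "crosses \<equiv> \<lambda>d. level (fst d) \<noteq> (if d \<in> B then level_B d else level (snd d))"
  defines "Y \<equiv> {d \<in> darts. \<exists>c\<in>darts. crosses c \<and> (piece c d \<or> c \<in> B \<and> piece (contour c) d)}"
  assumes a: "a \<in> B" and idx: "0 < i" "i < j" "j < k" "k < period succ a"
    and low: "\<And>m. m \<le> i \<Longrightarrow> level_B ((succ ^^ m) a) = 0"
    and high: "\<And>m. j \<le> m \<Longrightarrow> m \<le> k \<Longrightarrow> level_B ((succ ^^ m) a) = 1"
  shows "\<exists>m0 m ws. i \<le> m0 \<and> m0 \<le> j \<and> k < m \<and> m \<le> period succ a \<and>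
    (succ ^^ m0) a \<in> Y \<and> (succ ^^ m) a \<in> Y \<and>
    walk (IE \<inter> edge ` Y) ws \<and> hd ws = fst ((succ ^^ m0) a) \<and> last ws = fst ((succ ^^ m) a)"
proof -
  define N where "N = period succ a"
  define p where "p = (\<lambda>m. (succ ^^ m) a)"
  define F where "F = IE \<inter> edge ` Y"
  define con where "con = (\<lambda>x y. \<exists>ws. walk F ws \<and> hd ws = x \<and> last ws = y)"
  have pB: "p m \<in> B" for m unfolding p_def by (rule succ_pow_in[OF a])
  have pN: "p N = p 0" using period_succ(2)[OF a] by (simp add: p_def N_def)
  have p_inj: "m = m'" if "p m = p m'" "m < N" "m' < N" for m m'
    using period_succ(3)[OF a] that by (simp add: p_def N_def)
  have con_refl: "con x x" for x unfolding con_def by (rule walk_connect_refl)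
  have con_trans: "con x z" if "con x y" "con y z" for x y z
    using that unfolding con_def by (rule walk_connect_trans)
  have con_sym: "con y x" if "con x y" for x y using that unfolding con_def by (rule walk_connect_sym)
  have con_edge: "con x y" if "{x, y} \<in> F" for x y using that unfolding con_def by (rule walk_connect_edge)
  have Y_darts: "Y \<subseteq> darts" by (auto simp: Y_def)
  have Y_piece: "d' \<in> Y" if dY: "d \<in> Y" "piece d d'" "d' \<in> darts" for d d'
  proof -
    obtain c where c: "c \<in> darts" "crosses c" "piece c d \<or> c \<in> B \<and> piece (contour c) d"
      using dY(1) unfolding Y_def by blast
    hence "piece c d' \<or> c \<in> B \<and> piece (contour c) d'" using piece_trans[OF _ that(2)] by blast
    thus ?thesis using c that(3) by (auto simp: Y_def)
  qed
  have Y_cut: "d \<in> Y" if "d \<in> darts" "crosses d" for d using that piece.self[of d] by (auto simp: Y_def)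
  have Y_cut_B: "contour d \<in> Y" if "d \<in> B" "crosses d" for d
    using that piece.self[of "contour d"] contour_in B_subset by (auto simp: Y_def)
  have edge_F: "{fst d, snd d} \<in> F" if "d \<in> Y" "d \<in> darts - B" for d
    using that int_dart_edge[OF that(2)] unfolding F_def edge_def by auto
  have con_contour: "con (fst d) (fst (contour d))" if "d \<in> Y" "d \<in> darts - B" for d
    using con_edge[OF edge_F[OF that]] fst_contour(1)[OF that(2)] by simp
  have con_piece: "con (fst d) (fst d') \<and> d' \<in> darts" if "piece d d'" "d \<in> Y" for d d'
    using that
  proof (induction)
    case self
    thus ?case using con_refl Y_darts by auto
  next
    case (fwd d')
    have "d' \<in> Y" using Y_piece fwd by blast
    thus ?case using con_contour con_trans fwd contour_in by blast
  next
    case (bwd d')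
    have "d' \<in> Y" by (rule Y_piece[OF bwd.prems]) (use bwd piece.bwd in auto)
    thus ?case using con_contour con_sym con_trans bwd by blast
  qed
  \<comment> \<open>The pieces of the first arc end in the boundary points with the indices from \<open>i + 1\<close> to \<open>j\<close>; they belong to
    \<open>K\<close> whether or not the level changes in them. All other darts of \<open>K\<close> are in \<open>Y\<close>.\<close>
  define K1 where "K1 = {d \<in> darts. \<exists>m. i < m \<and> m \<le> j \<and> hits d (p m)}"
  define K2 where "K2 = {d \<in> Y. \<exists>m. i \<le> m \<and> m \<le> j \<and> p m \<in> Y \<and> con (fst (p m)) (fst d)}"
  define K where "K = K1 \<union> K2"
  have K1Y: "d \<in> K2" if "d \<in> K1" "d \<in> Y" for d
  proof -
    obtain m where m: "i < m" "m \<le> j" "hits d (p m)" using \<open>d \<in> K1\<close> by (auto simp: K1_def)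
    note pc = hits_piece[OF m(3)]
    have "con (fst (p m)) (fst d)" using con_piece[OF pc that(2)] con_sym by blast
    moreover have "p m \<in> Y" using Y_piece[OF that(2) pc] pB B_subset by blast
    ultimately show ?thesis using that(2) m by (auto simp: K2_def intro!: exI[of _ m])
  qed
  have KY: "d \<in> K \<longleftrightarrow> d \<in> K2" if "d \<in> Y" for d
    using K1Y that unfolding K_def by blast
  have K2Y: "K2 \<subseteq> Y" by (auto simp: K2_def)
  have K2_con: "d' \<in> K2" if "d \<in> K2" "d' \<in> Y" "con (fst d) (fst d')" for d d'
    using that con_trans unfolding K2_def by blast
  have C1: "contour d \<in> K \<longleftrightarrow> d \<in> K" if d: "d \<in> darts - B" for d
  proof -
    have cd: "contour d \<in> darts" using d contour_in by auto
    have "contour d \<in> K1 \<longleftrightarrow> d \<in> K1" using hits_contour[OF d pB] d cd by (auto simp: K1_def)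
    moreover have "contour d \<in> Y \<longleftrightarrow> d \<in> Y"
      using Y_piece piece.fwd[OF piece.self d] piece.bwd[OF piece.self d] d cd by blast
    moreover have "contour d \<in> K2 \<longleftrightarrow> d \<in> K2" if "d \<in> Y" "contour d \<in> Y"
      using K2_con con_contour[OF that(1) d] con_sym that by blast
    ultimately show ?thesis using K2Y unfolding K_def by blast
  qed
  have C2': "opp d \<in> K" if d: "d \<in> darts - B" "level (fst d) \<noteq> level (snd d)" "d \<in> K" for d
  proof -
    have o: "opp d = (snd d, fst d)" "opp d \<in> darts - B" using opp_int[OF d(1)] opp_in_int[OF d(1)] by auto
    have "d \<in> Y" "opp d \<in> Y" using Y_cut[of d] Y_cut[of "opp d"] d o by (auto simp: crosses_def)
    moreover have "con (fst d) (fst (opp d))" using con_edge[OF edge_F[OF \<open>d \<in> Y\<close> d(1)]] o by simp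
    ultimately show ?thesis using K2_con[of d "opp d"] KY d(3) by blast
  qed
  have C2: "opp d \<in> K \<longleftrightarrow> d \<in> K" if d: "d \<in> darts - B" "level (fst d) \<noteq> level (snd d)" for d
  proof -
    have "level (fst (opp d)) \<noteq> level (snd (opp d))" using d opp_int[OF d(1)] by simp
    thus ?thesis using C2'[OF d] C2'[OF opp_in_int[OF d(1)]] opp_opp[of d] d(1) by (metis DiffD1)
  qed
  have C3: "contour d \<in> K \<longleftrightarrow> d \<in> K" if d: "d \<in> B" "level (fst d) \<noteq> level_B d" for d
  proof -
    have "crosses d" using d by (simp add: crosses_def)
    hence y: "d \<in> Y" "contour d \<in> Y" using Y_cut[of d] Y_cut_B[of d] d B_subset by blast+
    have "con (fst d) (fst (contour d))" using fst_contour(2)[OF d(1)] con_refl by simp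
    thus ?thesis unfolding KY[OF y(1)] KY[OF y(2)] using K2_con y con_sym by blast
  qed
  have sum0: "(\<Sum>q\<in>B. level_B q * (of_bool (q \<in> K) - of_bool (succ q \<in> K))) = 0"
    by (rule closed_pieces_sum[of K level, OF C1 C2 C3])
  define \<kappa> where "\<kappa> = (\<lambda>m. of_bool (p m \<in> K) :: real)"
  have succ_p: "succ (p m) = p (Suc m)" for m by (simp add: p_def)
  have "(\<Sum>m<N. level_B (p m) * (\<kappa> m - \<kappa> (Suc m))) = 0"
  proof -
    have "inj_on p {..<N}" using p_inj by (auto intro: inj_onI)
    moreover have "B = p ` {..<N}" using boundary_succ_orbit[OF a] by (simp add: p_def N_def)
    ultimately have "(\<Sum>q\<in>B. level_B q * (of_bool (q \<in> K) - of_bool (succ q \<in> K))) =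
        (\<Sum>m<N. level_B (p m) * (of_bool (p m \<in> K) - of_bool (succ (p m) \<in> K)))"
      by (simp add: sum.reindex)
    thus ?thesis using sum0 by (simp add: \<kappa>_def succ_p)
  qed
  have one: "\<kappa> m = 1" if "i < m" "m \<le> j" for m
  proof -
    have "p m \<in> K1" using that hits_refl pB B_subset unfolding K1_def by blast
    thus ?thesis by (simp add: \<kappa>_def K_def)
  qed
  have "\<exists>m. k < m \<and> m \<le> N \<and> p m \<in> K"
  proof (rule ccontr)
    assume "\<not> ?thesis"
    hence zero: "\<kappa> m = 0" if "k < m" "m \<le> N" for m using that by (simp add: \<kappa>_def)
    have "(\<Sum>m<N. level_B (p m) * (\<kappa> m - \<kappa> (Suc m))) = (\<Sum>m\<in>{j..<Suc k}. \<kappa> m - \<kappa> (Suc m))"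
    proof (rule sum.mono_neutral_cong_right)
      show "{j..<Suc k} \<subseteq> {..<N}" using idx by (auto simp: N_def)
      show "\<forall>m\<in>{..<N} - {j..<Suc k}. level_B (p m) * (\<kappa> m - \<kappa> (Suc m)) = 0"
      proof
        fix m assume m: "m \<in> {..<N} - {j..<Suc k}"
        consider "m \<le> i" | "i < m" "m < j" | "k < m" using m by fastforce
        thus "level_B (p m) * (\<kappa> m - \<kappa> (Suc m)) = 0"
        proof cases
          case 1
          thus ?thesis using low by (simp add: p_def)
        next
          case 2
          thus ?thesis using one[of m] one[of "Suc m"] by simp
        next
          case 3
          thus ?thesis using zero[of m] zero[of "Suc m"] m by simp
        qed
      qed
      show "level_B (p m) * (\<kappa> m - \<kappa> (Suc m)) = \<kappa> m - \<kappa> (Suc m)" if "m \<in> {j..<Suc k}" for m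
        using high[of m] that by (simp add: p_def)
    qed simp
    also have "\<dots> = - (\<Sum>m\<in>{j..<Suc k}. \<kappa> (Suc m) - \<kappa> m)" by (simp flip: sum_negf)
    also have "\<dots> = \<kappa> j - \<kappa> (Suc k)" using idx by (subst sum_Suc_diff') auto
    also have "\<dots> = 1" using one[of j] zero[of "Suc k"] idx by (simp add: N_def)
    finally show False using \<open>(\<Sum>m<N. _ m) = 0\<close> by simp
  qed
  then obtain m where m: "k < m" "m \<le> N" "p m \<in> K" by blast
  have "p m \<notin> K1"
  proof
    assume "p m \<in> K1"
    then obtain m' where m': "i < m'" "m' \<le> j" "hits (p m) (p m')" by (auto simp: K1_def)
    have eq: "p m = p m'" by (rule hits_B[OF pB m'(3)])
    have "m' < N" using m' idx by (simp add: N_def)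
    show False
    proof (cases "m = N")
      case True
      hence "p 0 = p m'" using eq pN by simp
      thus False using p_inj[of 0 m'] m' \<open>m' < N\<close> by simp
    next
      case False
      thus False using p_inj[OF eq] m m' \<open>m' < N\<close> idx by simp
    qed
  qed
  hence "p m \<in> K2" using m by (simp add: K_def)
  thus ?thesis using m unfolding K2_def con_def F_def N_def p_def by blast
qed

end

section \<open>The upper bound\<close>

context planar_domain
begin

lemma edge_B_inj: "p \<in> B \<Longrightarrow> q \<in> B \<Longrightarrow> edge p = edge q \<Longrightarrow> p = q"
  by (cases p; cases q) (auto simp: edge_def bd_points_def doubleton_eq_iff)

lemma edge_B_not_int: "p \<in> B \<Longrightarrow> edge p \<notin> IE"
  by (cases p) (auto simp: edge_def bd_points_def int_edges_def)

lemma dom_edges_eq: "dom_edges E V = edge ` darts"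
proof
  show "dom_edges E V \<subseteq> edge ` darts"
  proof
    fix e assume "e \<in> dom_edges E V"
    then consider "e \<in> IE" | p where "p \<in> B" "e = edge p"
      unfolding dom_edges_def edge_def by fastforce
    thus "e \<in> edge ` darts"
    proof cases
      case 1
      hence "e \<in> E" by (simp add: int_edges_def)
      then obtain u v where uv: "e = {u, v}" by (rule edge_hull)
      thus ?thesis using edge_dart[of u v] 1 by (intro image_eqI[of _ _ "(u, v)"]) (auto simp: edge_def)
    next
      case 2
      thus ?thesis using B_subset by auto
    qed
  qed
  show "edge ` darts \<subseteq> dom_edges E V"
  proof
    fix e assume "e \<in> edge ` darts"
    then obtain d where d: "d \<in> darts" "e = edge d" by auto
    show "e \<in> dom_edges E V"
    proof (cases "d \<in> B")
      case True
      thus ?thesis using d(2) unfolding dom_edges_def edge_def by force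
    next
      case False
      thus ?thesis using int_dart_edge[of d] d by (auto simp: dom_edges_def edge_def)
    qed
  qed
qed

lemma finite_dom_edges: "finite (dom_edges E V)"
  unfolding dom_edges_eq using finite_darts by simp

lemma card_darts_of_edge:
  assumes "e \<in> edge ` darts"
  shows "real (card {d \<in> darts. edge d = e}) \<le> 2"
proof -
  obtain x y where xy: "e = {x, y}" using assms by (auto simp: edge_def)
  have "{d \<in> darts. edge d = e} \<subseteq> {(x, y), (y, x)}"
    unfolding xy edge_def by (auto simp: doubleton_eq_iff)
  hence "card {d \<in> darts. edge d = e} \<le> card {(x, y), (y, x)}" by (intro card_mono) auto
  also have "\<dots> \<le> 2" using card_length[of "[(x, y), (y, x)]"] by simp
  finally show ?thesis by simp
qed

lemma sum_darts_edge:
  fixes f :: "complex set \<Rightarrow> real"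
  assumes "\<And>e. e \<in> dom_edges E V \<Longrightarrow> 0 \<le> f e"
  shows "(\<Sum>d\<in>darts. f (edge d)) \<le> 2 * (\<Sum>e\<in>dom_edges E V. f e)"
proof -
  have "(\<Sum>d\<in>darts. f (edge d)) = (\<Sum>e\<in>edge ` darts. \<Sum>d\<in>{d \<in> darts. edge d = e}. f (edge d))"
    by (rule sum.image_gen[OF finite_darts])
  also have "\<dots> \<le> (\<Sum>e\<in>edge ` darts. 2 * f e)"
  proof (rule sum_mono)
    fix e assume e: "e \<in> edge ` darts"
    note c = card_darts_of_edge[OF e]
    have "(\<Sum>d\<in>{d \<in> darts. edge d = e}. f (edge d)) = real (card {d \<in> darts. edge d = e}) * f e" by simp
    also have "\<dots> \<le> 2 * f e"
      using c assms[of e] e unfolding dom_edges_eq by (intro mult_right_mono) auto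
    finally show "(\<Sum>d\<in>{d \<in> darts. edge d = e}. f (edge d)) \<le> 2 * f e" .
  qed
  finally show ?thesis by (simp add: dom_edges_eq sum_distrib_left)
qed

lemma path_length_ends:
  assumes "vs \<noteq> []"
  shows "path_length g ([x] @ vs @ [y]) = g {x, hd vs} + (\<Sum>(x, y)\<leftarrow>steps vs. g {x, y}) + g {last vs, y}"
  unfolding path_length_steps steps_path[OF assms] by simp

text \<open>A simple path passes no edge twice, so that its length is at most the sum over all available edges.\<close>

lemma path_length_simple_le:
  assumes g: "\<And>e. e \<in> dom_edges E V \<Longrightarrow> 0 \<le> g e"
    and Y: "Y \<subseteq> darts" and p: "p \<in> B" "p \<in> Y" and q: "q \<in> B" "q \<in> Y" and "p \<noteq> q"
    and ws: "walk (IE \<inter> edge ` Y) ws" "hd ws = fst p" "last ws = fst q" "distinct ws"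
  shows "path_length g ([snd p] @ ws @ [snd q]) \<le> (\<Sum>d\<in>Y. g (edge d))"
proof -
  have ne: "ws \<noteq> []" using ws(1) walk_simps(3) by auto
  define es where "es = map (\<lambda>(x, y). {x, y}) (steps ws)"
  have es: "distinct es" "set es \<subseteq> IE \<inter> edge ` Y"
    unfolding es_def using distinct_steps_edges[OF ws(4)] ws(1) unfolding walk_iff_steps by auto
  have ends: "edge p = {snd p, hd ws}" "edge q = {last ws, snd q}"
    using ws(2,3) by (auto simp: edge_def)
  have "path_length g ([snd p] @ ws @ [snd q]) = g (edge p) + sum_list (map g es) + g (edge q)"
    unfolding path_length_ends[OF ne] ends es_def by (simp add: comp_def case_prod_unfold)
  also have "sum_list (map g es) = sum g (set es)" using es(1) by (rule sum_list_distinct_conv_sum_set)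
  also have "g (edge p) + sum g (set es) + g (edge q) = sum g (insert (edge p) (insert (edge q) (set es)))"
  proof -
    have "edge p \<notin> set es" "edge q \<notin> set es"
      using es(2) edge_B_not_int[OF p(1)] edge_B_not_int[OF q(1)] by blast+
    moreover have "edge p \<noteq> edge q" using edge_B_inj[OF p(1) q(1)] \<open>p \<noteq> q\<close> by blast
    ultimately show ?thesis by simp
  qed
  also have "\<dots> \<le> sum g (edge ` Y)"
  proof (rule sum_mono2)
    show "finite (edge ` Y)" using finite_subset[OF Y finite_darts] by simp
    show "0 \<le> g e" if "e \<in> edge ` Y - insert (edge p) (insert (edge q) (set es))" for e
      using g[of e] that Y unfolding dom_edges_eq by auto
  qed (use es p q in auto)
  also have "\<dots> \<le> sum (g \<circ> edge) Y"
    by (rule sum_image_le) (use finite_subset[OF Y finite_darts] g Y dom_edges_eq in auto)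
  finally show ?thesis by simp
qed

text \<open>The distance from the arc \<open>A\<close> in the metric \<open>g\<close>. Including \<open>l\<close> in the infimum truncates it at \<open>l\<close>, which
  is a lower bound for the distance of the opposite arc.\<close>

definition arc_dist :: "(complex set \<Rightarrow> real) \<Rightarrow> real \<Rightarrow> (complex \<times> complex) set \<Rightarrow> complex \<Rightarrow> real" where
  "arc_dist g l A v =
     Inf (insert l {path_length g (x # vs) | x vs. walk IE vs \<and> (hd vs, x) \<in> A \<and> last vs = v})"

lemma IE_subset: "IE \<subseteq> dom_edges E V"
  by (auto simp: dom_edges_def)

lemma path_length_Cons: "vs \<noteq> [] \<Longrightarrow> path_length g (x # vs) = g {x, hd vs} + (\<Sum>(x, y)\<leftarrow>steps vs. g {x, y})"
  unfolding path_length_steps by (cases vs) auto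

context
  fixes g :: "complex set \<Rightarrow> real" and l :: real and A A' :: "(complex \<times> complex) set"
  assumes g: "\<And>e. e \<in> dom_edges E V \<Longrightarrow> 0 \<le> g e" and l: "0 \<le> l"
    and AB: "A \<subseteq> B" "A' \<subseteq> B"
    and len: "\<And>\<gamma>. \<gamma> \<in> connecting_paths E V A A' \<Longrightarrow> l \<le> path_length g \<gamma>"
begin

lemma path_length_nonneg:
  assumes "walk IE vs" "(hd vs, x) \<in> A"
  shows "0 \<le> path_length g (x # vs)"
proof -
  have ne: "vs \<noteq> []" using assms(1) walk_simps(3) by auto
  have "edge (hd vs, x) \<in> dom_edges E V" using assms(2) AB B_subset dom_edges_eq by blast
  hence "0 \<le> g {x, hd vs}" using g by (simp add: edge_def insert_commute)
  moreover have "0 \<le> (\<Sum>(x, y)\<leftarrow>steps vs. g {x, y})"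
    using assms(1) g IE_subset unfolding walk_iff_steps by (intro sum_list_nonneg) auto
  ultimately show ?thesis unfolding path_length_Cons[OF ne] by simp
qed

lemma arc_dist_le:
  assumes "walk IE vs" "(hd vs, x) \<in> A" "last vs = v"
  shows "arc_dist g l A v \<le> path_length g (x # vs)"
  unfolding arc_dist_def
  by (rule cInf_lower) (use assms path_length_nonneg l in \<open>auto intro!: bdd_belowI[of _ 0]\<close>)

lemma arc_dist_le_l: "arc_dist g l A v \<le> l"
  unfolding arc_dist_def
  by (rule cInf_lower) (use path_length_nonneg l in \<open>auto intro!: bdd_belowI[of _ 0]\<close>)

lemma arc_dist_greatest:
  assumes "z \<le> l" "\<And>x vs. walk IE vs \<Longrightarrow> (hd vs, x) \<in> A \<Longrightarrow> last vs = v \<Longrightarrow> z \<le> path_length g (x # vs)"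
  shows "z \<le> arc_dist g l A v"
  unfolding arc_dist_def by (rule cInf_greatest) (use assms in auto)

lemma arc_dist_nonneg: "0 \<le> arc_dist g l A v"
  by (rule arc_dist_greatest) (use l path_length_nonneg in auto)

lemma arc_dist_step:
  assumes e: "{x, y} \<in> IE"
  shows "arc_dist g l A y \<le> arc_dist g l A x + g {x, y}"
proof -
  have g0: "0 \<le> g {x, y}" using g e IE_subset by auto
  have "arc_dist g l A y - g {x, y} \<le> arc_dist g l A x"
  proof (rule arc_dist_greatest)
    show "arc_dist g l A y - g {x, y} \<le> l" using arc_dist_le_l[of y] g0 by linarith
    fix z vs assume vs: "walk IE vs" "(hd vs, z) \<in> A" "last vs = x"
    have ne: "vs \<noteq> []" using vs(1) walk_simps(3) by auto
    have "arc_dist g l A y \<le> path_length g (z # (vs @ [y]))"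
      by (rule arc_dist_le) (use vs ne e walk_snoc[OF ne, of IE y] in auto)
    also have "\<dots> = path_length g (z # vs) + g {x, y}"
      using ne vs(3) by (simp add: path_length_Cons steps_snoc)
    finally show "arc_dist g l A y - g {x, y} \<le> path_length g (z # vs)" by simp
  qed
  thus ?thesis by simp
qed

lemma arc_dist_start:
  assumes "p \<in> A"
  shows "arc_dist g l A (fst p) \<le> g (edge p)"
proof -
  have "arc_dist g l A (fst p) \<le> path_length g (snd p # [fst p])"
    by (rule arc_dist_le) (use assms in \<open>auto simp: walk_simps\<close>)
  thus ?thesis by (simp add: path_length_Cons edge_def insert_commute)
qed

lemma arc_dist_end:
  assumes p: "p \<in> A'"
  shows "l \<le> arc_dist g l A (fst p) + g (edge p)"
proof -
  have "0 \<le> g (edge p)" using g p AB B_subset dom_edges_eq by blast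
  have "l - g (edge p) \<le> arc_dist g l A (fst p)"
  proof (rule arc_dist_greatest)
    show "l - g (edge p) \<le> l" using \<open>0 \<le> g (edge p)\<close> by simp
    fix z vs assume vs: "walk IE vs" "(hd vs, z) \<in> A" "last vs = fst p"
    have ne: "vs \<noteq> []" using vs(1) walk_simps(3) by auto
    have "[z] @ vs @ [snd p] \<in> connecting_paths E V A A'"
      unfolding connecting_paths_def using vs p by (intro CollectI exI conjI) auto
    hence "l \<le> path_length g ([z] @ vs @ [snd p])" by (rule len)
    also have "\<dots> = path_length g (z # vs) + g (edge p)"
      unfolding path_length_ends[OF ne] path_length_Cons[OF ne] using vs(3) by (simp add: edge_def)
    finally show "l - g (edge p) \<le> path_length g (z # vs)" by simp
  qed
  thus ?thesis by simp
qed

end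

text \<open>The distance functions of \<open>g1\<close> at the two ends of an edge differ by at most the length of this edge, and so the edge
  crosses the level \<open>t\<close> for a set of \<open>t\<close> of at most this measure. The path along the cut at level
  \<open>t\<close> uses edges that share a piece with a crossing edge. Its \<open>g2\<close>-length is integrated over \<open>t\<close>. A half-edge belongs to
  the piece that it ends and borders the piece that starts after it; this explains the second alternative in the relation.\<close>

lemma product_of_lengths_le:
  fixes g1 g2 :: "complex set \<Rightarrow> real" and M :: nat
  assumes a: "a \<in> B" and ccw: "listed_ccw E V a b c d"
    and g1: "\<And>e. e \<in> dom_edges E V \<Longrightarrow> 0 \<le> g1 e" and g2: "\<And>e. e \<in> dom_edges E V \<Longrightarrow> 0 \<le> g2 e"
    and l1: "0 \<le> l1" "\<And>\<gamma>. \<gamma> \<in> connecting_paths E V (bd_arc E V a b) (bd_arc E V c d) \<Longrightarrow> l1 \<le> path_length g1 \<gamma>"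
    and l2: "0 \<le> l2" "\<And>\<gamma>. \<gamma> \<in> connecting_paths E V (bd_arc E V b c) (bd_arc E V d a) \<Longrightarrow> l2 \<le> path_length g2 \<gamma>"
    and Phi: "\<And>d. d \<in> darts - B \<Longrightarrow> \<Phi> (contour d) = \<Phi> d"
  shows "l1 * l2 \<le> (\<Sum>(c, d)\<in>{(c, d). c \<in> darts \<and> d \<in> darts \<and> (\<Phi> d = \<Phi> c \<or> c \<in> B \<and> \<Phi> d = \<Phi> (contour c))}.
    g1 (edge c) * g2 (edge d))"
proof -
  define R where "R = {(c, d). c \<in> darts \<and> d \<in> darts \<and> (\<Phi> d = \<Phi> c \<or> c \<in> B \<and> \<Phi> d = \<Phi> (contour c))}"
  have "R \<subseteq> darts \<times> darts" by (auto simp: R_def)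
  hence finR: "finite R" using finite_darts finite_subset by (metis finite_SigmaI)
  obtain i j k where ijk: "0 < i" "i < j" "j < k" "k < period succ a"
    and arcs: "bd_arc E V a b = (\<lambda>m. (succ ^^ m) a) ` {0..i}" "bd_arc E V b c = (\<lambda>m. (succ ^^ m) a) ` {i..j}"
      "bd_arc E V c d = (\<lambda>m. (succ ^^ m) a) ` {j..k}"
      "bd_arc E V d a = (\<lambda>m. (succ ^^ m) a) ` {k..period succ a}"
    by (rule four_arcs[OF a ccw])
  define N where "N = period succ a"
  define p where "p = (\<lambda>m. (succ ^^ m) a)"
  note arcs = arcs[folded p_def N_def]
  have pB: "p m \<in> B" for m unfolding p_def by (rule succ_pow_in[OF a])
  have p_inj: "m = m'" if "p m = p m'" "m < N" "m' < N" for m m'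
    using period_succ(3)[OF a] that by (simp add: p_def N_def)
  have pN: "p N = p 0" using period_succ(2)[OF a] by (simp add: p_def N_def)
  define A where "A = bd_arc E V a b"
  define A' where "A' = bd_arc E V c d"
  have AB: "A \<subseteq> B" "A' \<subseteq> B" unfolding A_def A'_def arcs using pB by auto
  have disj: "A \<inter> A' = {}"
  proof (rule ccontr)
    assume "A \<inter> A' \<noteq> {}"
    then obtain q where "q \<in> p ` {0..i}" "q \<in> p ` {j..k}" unfolding A_def A'_def arcs by blast
    then obtain m m' where "m \<in> {0..i}" "m' \<in> {j..k}" "p m = p m'" by (elim imageE) simp
    thus False using p_inj[of m m'] ijk by (simp add: N_def)
  qed
  define h where "h = arc_dist g1 l1 A"
  note ad = g1 l1(1) AB l1(2)[folded A_def A'_def]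
  \<comment> \<open>On half-edges outside of the two arcs the value is copied from the inner end, so that these edges cross no level.\<close>
  define hB where "hB = (\<lambda>q. if q \<in> A then 0 else if q \<in> A' then l1 else h (fst q))"
  define hh where "hh = (\<lambda>d. if d \<in> B then hB d else h (snd d))"
  have h_range: "0 \<le> h v" "h v \<le> l1" for v
    unfolding h_def using arc_dist_nonneg[OF ad] arc_dist_le_l[OF ad] by auto
  have hh_range: "0 \<le> hh d" "hh d \<le> l1" for d
    unfolding hh_def hB_def using h_range l1 by auto
  have lip: "\<bar>h (fst d) - hh d\<bar> \<le> g1 (edge d)" if d: "d \<in> darts" for d
  proof -
    have g0: "0 \<le> g1 (edge d)" using g1 d dom_edges_eq by blast
    consider "d \<in> A" | "d \<in> A'" "d \<notin> A" | "d \<in> B" "d \<notin> A" "d \<notin> A'" | "d \<in> darts - B" using d by blast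
    thus ?thesis
    proof cases
      case 1
      hence "hh d = 0" using AB by (auto simp: hh_def hB_def)
      thus ?thesis using arc_dist_start[OF ad 1] h_range(1)[of "fst d"] by (simp add: h_def)
    next
      case 2
      hence "hh d = l1" using AB by (auto simp: hh_def hB_def)
      thus ?thesis using arc_dist_end[OF ad 2(1)] h_range(2)[of "fst d"] by (simp add: h_def)
    next
      case 3
      thus ?thesis using g0 by (simp add: hh_def hB_def)
    next
      case 4
      hence e: "{fst d, snd d} \<in> IE" using int_dart_edge by blast
      hence "{snd d, fst d} \<in> IE" by (simp add: insert_commute)
      thus ?thesis using arc_dist_step[OF ad e] arc_dist_step[OF ad, of "snd d" "fst d"] 4
        by (simp add: h_def hh_def edge_def insert_commute)
    qed
  qed
  define lo where "lo = (\<lambda>d. min (h (fst d)) (hh d))"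
  define hi where "hi = (\<lambda>d. max (h (fst d)) (hh d))"
  define ind where "ind = (\<lambda>d t. if t \<in> {lo d .. hi d} then 1 else (0::real))"
  have level: "l2 \<le> (\<Sum>(c, d)\<in>R. ind c t * g2 (edge d))" if t: "0 < t" "t < l1" for t
  proof -
    define lv where "lv = (\<lambda>v. if h v \<le> t then 0 else (1::real))"
    define lB where "lB = (\<lambda>q. if hB q \<le> t then 0 else (1::real))"
    define crosses where "crosses = (\<lambda>d. lv (fst d) \<noteq> (if d \<in> B then lB d else lv (snd d)))"
    define Y where "Y = {d \<in> darts. \<exists>c\<in>darts. crosses c \<and> (piece c d \<or> c \<in> B \<and> piece (contour c) d)}"
    have lo0: "lB ((succ ^^ m) a) = 0" if "m \<le> i" for m
    proof -
      have "p m \<in> A" unfolding A_def arcs using that by auto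
      thus ?thesis using t by (simp add: lB_def hB_def p_def)
    qed
    have hi1: "lB ((succ ^^ m) a) = 1" if "j \<le> m" "m \<le> k" for m
    proof -
      have "p m \<in> A'" unfolding A'_def arcs using that by auto
      hence "p m \<notin> A" using disj by blast
      thus ?thesis using t \<open>p m \<in> A'\<close> by (simp add: lB_def hB_def p_def)
    qed
    obtain m0 m ws where w: "i \<le> m0" "m0 \<le> j" "k < m" "m \<le> N" "p m0 \<in> Y" "p m \<in> Y"
      "walk (IE \<inter> edge ` Y) ws" "hd ws = fst (p m0)" "last ws = fst (p m)"
    proof -
      have "\<exists>m0 m ws. i \<le> m0 \<and> m0 \<le> j \<and> k < m \<and> m \<le> N \<and> p m0 \<in> Y \<and> p m \<in> Y \<and>
          walk (IE \<inter> edge ` Y) ws \<and> hd ws = fst (p m0) \<and> last ws = fst (p m)"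
        unfolding N_def p_def Y_def crosses_def
        by (rule path_along_cut[where level = lv and level_B = lB, OF a ijk lo0 hi1])
      thus ?thesis using that by blast
    qed
    obtain vs where vs: "walk (IE \<inter> edge ` Y) vs" "hd vs = fst (p m0)" "last vs = fst (p m)" "distinct vs"
      using distinct_walk[OF w(7)] w(8,9) by auto
    have vIE: "walk IE vs" using vs(1) unfolding walk_iff_steps by auto
    have "p m0 \<noteq> p m"
    proof
      assume eq: "p m0 = p m"
      have "m0 < N" using w ijk by (simp add: N_def)
      thus False using p_inj[of m0 m] p_inj[of m0 0] eq pN w ijk by (cases "m = N") (auto simp: N_def)
    qed
    have "[snd (p m0)] @ vs @ [snd (p m)] \<in> connecting_paths E V (bd_arc E V b c) (bd_arc E V d a)"
      unfolding connecting_paths_def arcs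
    proof (intro CollectI exI conjI)
      show "(hd vs, snd (p m0)) \<in> p ` {i..j}" using vs(2) w by (auto intro!: image_eqI[of _ _ m0])
      show "(last vs, snd (p m)) \<in> p ` {k..N}" using vs(3) w by (auto intro!: image_eqI[of _ _ m])
    qed (use vIE in auto)
    hence "l2 \<le> path_length g2 ([snd (p m0)] @ vs @ [snd (p m)])" by (rule l2(2))
    also have "\<dots> \<le> (\<Sum>d\<in>Y. g2 (edge d))"
      by (rule path_length_simple_le[OF g2 _ pB w(5) pB w(6) \<open>p m0 \<noteq> p m\<close> vs]) (auto simp: Y_def)
    also have "\<dots> \<le> (\<Sum>d\<in>darts. \<Sum>c\<in>{c. (c, d) \<in> R}. ind c t * g2 (edge d))"
    proof -
      have finc: "finite {c. (c, d) \<in> R}" for d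
        by (rule finite_subset[OF _ finite_darts]) (auto simp: R_def)
      have nn: "0 \<le> ind c t * g2 (edge d)" if "d \<in> darts" for c d
        using g2 that dom_edges_eq by (auto simp: ind_def)
      have "g2 (edge d) \<le> (\<Sum>c\<in>{c. (c, d) \<in> R}. ind c t * g2 (edge d))" if d: "d \<in> Y" for d
      proof -
        obtain c where c: "c \<in> darts" "crosses c" "piece c d \<or> c \<in> B \<and> piece (contour c) d" and dd: "d \<in> darts"
          using d unfolding Y_def by blast
        have "(c, d) \<in> R" using c dd piece_label[where \<Phi> = \<Phi>, OF _ Phi] unfolding R_def by blast
        moreover have "ind c t = 1"
        proof -
          have "(h (fst c) \<le> t) \<noteq> (hh c \<le> t)" using c(2)
            by (auto simp: crosses_def lv_def lB_def hh_def split: if_splits)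
          thus ?thesis by (auto simp: ind_def lo_def hi_def)
        qed
        ultimately show ?thesis
          using member_le_sum[of c "{c. (c, d) \<in> R}" "\<lambda>c. ind c t * g2 (edge d)"] nn[OF dd] finc by simp
      qed
      hence "(\<Sum>d\<in>Y. g2 (edge d)) \<le> (\<Sum>d\<in>Y. \<Sum>c\<in>{c. (c, d) \<in> R}. ind c t * g2 (edge d))" by (rule sum_mono)
      also have "\<dots> \<le> (\<Sum>d\<in>darts. \<Sum>c\<in>{c. (c, d) \<in> R}. ind c t * g2 (edge d))"
        by (rule sum_mono2[OF finite_darts]) (use nn in \<open>auto simp: Y_def intro!: sum_nonneg\<close>)
      finally show ?thesis .
    qed
    also have "\<dots> = (\<Sum>(d, c)\<in>Sigma darts (\<lambda>d. {c. (c, d) \<in> R}). ind c t * g2 (edge d))"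
      by (rule sum.Sigma[OF finite_darts]) (auto intro: finite_subset[OF _ finite_darts] simp: R_def)
    also have "\<dots> = (\<Sum>(c, d)\<in>R. ind c t * g2 (edge d))"
      by (rule sum.reindex_bij_witness[of _ prod.swap prod.swap]) (auto simp: R_def)
    finally show ?thesis .
  qed
  have int_ind: "((ind c) has_integral (hi c - lo c)) {0..l1}" for c
  proof -
    have sub: "cbox (lo c) (hi c) \<subseteq> cbox 0 l1"
      using h_range[of "fst c"] hh_range[of c] by (auto simp: lo_def hi_def)
    have "((\<lambda>x. 1::real) has_integral (hi c - lo c)) (cbox (lo c) (hi c))"
    proof -
      have "lo c \<le> hi c" by (auto simp: lo_def hi_def)
      thus ?thesis using has_integral_const_real[of "1::real" "lo c" "hi c"] by simp
    qed
    from has_integral_restrict_closed_subinterval[OF this sub] show ?thesis by (simp add: ind_def)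
  qed
  have "((\<lambda>t. \<Sum>cd\<in>R. ind (fst cd) t * g2 (edge (snd cd))) has_integral
      (\<Sum>cd\<in>R. (hi (fst cd) - lo (fst cd)) * g2 (edge (snd cd)))) {0..l1}"
    by (intro has_integral_sum[OF finR] has_integral_mult_left int_ind)
  \<comment> \<open>The estimate by levels holds for \<open>0 < t < l1\<close> only, since the level has to separate the two arcs.\<close>
  hence i1: "((\<lambda>t. \<Sum>cd\<in>R. ind (fst cd) t * g2 (edge (snd cd))) has_integral
      (\<Sum>cd\<in>R. (hi (fst cd) - lo (fst cd)) * g2 (edge (snd cd)))) {0<..<l1}"
    by (simp add: has_integral_Icc_iff_Ioo)
  have "((\<lambda>t. l2) has_integral (l1 * l2)) {0..l1}"
    using has_integral_const_real[of l2 0 l1] l1(1) by simp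
  hence i2: "((\<lambda>t. l2) has_integral (l1 * l2)) {0<..<l1}" by (simp add: has_integral_Icc_iff_Ioo)
  have "l1 * l2 \<le> (\<Sum>cd\<in>R. (hi (fst cd) - lo (fst cd)) * g2 (edge (snd cd)))"
    by (rule has_integral_le[OF i2 i1]) (use level in \<open>auto simp: case_prod_unfold\<close>)
  also have "\<dots> \<le> (\<Sum>cd\<in>R. g1 (edge (fst cd)) * g2 (edge (snd cd)))"
  proof (rule sum_mono)
    fix cd assume "cd \<in> R"
    hence cd: "fst cd \<in> darts" "snd cd \<in> darts" by (auto simp: R_def)
    have "hi (fst cd) - lo (fst cd) \<le> g1 (edge (fst cd))"
      using lip[OF cd(1)] by (auto simp: hi_def lo_def)
    thus "(hi (fst cd) - lo (fst cd)) * g2 (edge (snd cd)) \<le> g1 (edge (fst cd)) * g2 (edge (snd cd))"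
      using g2 cd(2) dom_edges_eq by (intro mult_right_mono) auto
  qed
  finally show ?thesis unfolding R_def[symmetric] by (simp add: case_prod_unfold)
qed

lemma sum_squares_darts:
  assumes "\<omega>\<^sub>0 > 0"
  shows "(\<Sum>d\<in>darts. (g (edge d))\<^sup>2) \<le> 2 / \<omega>\<^sub>0 * metric_area E w V g"
proof -
  have "(\<Sum>d\<in>darts. (g (edge d))\<^sup>2) \<le> 2 * (\<Sum>e\<in>dom_edges E V. (g e)\<^sup>2)"
    by (rule sum_darts_edge) simp
  also have "(\<Sum>e\<in>dom_edges E V. (g e)\<^sup>2) \<le> (\<Sum>e\<in>dom_edges E V. w e * (g e)\<^sup>2 / \<omega>\<^sub>0)"
  proof (rule sum_mono)
    fix e assume "e \<in> dom_edges E V"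
    hence "e \<in> E" by (auto simp: dom_edges_def int_edges_def bd_points_def)
    hence "\<omega>\<^sub>0 * (g e)\<^sup>2 \<le> w e * (g e)\<^sup>2" using weight_lower by (intro mult_right_mono) auto
    thus "(g e)\<^sup>2 \<le> w e * (g e)\<^sup>2 / \<omega>\<^sub>0" using assms by (simp add: field_simps)
  qed
  also have "(\<Sum>e\<in>dom_edges E V. w e * (g e)\<^sup>2 / \<omega>\<^sub>0) = metric_area E w V g / \<omega>\<^sub>0"
    by (simp add: metric_area_def sum_divide_distrib)
  finally show ?thesis by simp
qed

text \<open>A dart is related to at most \<open>2 * M\<close> darts on either side, and a sum over darts counts an edge at most twice. With
  the lower bound for the weights this gives the factor \<open>4 * M / \<omega>\<^sub>0\<close> for each of the metrics.\<close>

lemma product_of_squares_le: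
  fixes g1 g2 :: "complex set \<Rightarrow> real" and M :: nat
  assumes a: "a \<in> B" and ccw: "listed_ccw E V a b c d" and w0: "\<omega>\<^sub>0 > 0" and M: "real M * \<eta>\<^sub>0 > 2 * pi"
    and g1: "\<And>e. e \<in> dom_edges E V \<Longrightarrow> 0 \<le> g1 e" and g2: "\<And>e. e \<in> dom_edges E V \<Longrightarrow> 0 \<le> g2 e"
    and l1: "0 \<le> l1" "\<And>\<gamma>. \<gamma> \<in> connecting_paths E V (bd_arc E V a b) (bd_arc E V c d) \<Longrightarrow> l1 \<le> path_length g1 \<gamma>"
    and l2: "0 \<le> l2" "\<And>\<gamma>. \<gamma> \<in> connecting_paths E V (bd_arc E V b c) (bd_arc E V d a) \<Longrightarrow> l2 \<le> path_length g2 \<gamma>"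
  shows "l1\<^sup>2 * l2\<^sup>2 \<le> (4 * real M / \<omega>\<^sub>0)\<^sup>2 * (metric_area E w V g1 * metric_area E w V g2)"
proof -
  obtain \<Phi> :: "complex \<times> complex \<Rightarrow> complex set" where Phi: "\<And>d. d \<in> darts - B \<Longrightarrow> \<Phi> (contour d) = \<Phi> d"
    "\<And>F. card {d \<in> darts. \<Phi> d = F} \<le> M" using bounded_face_labelling[OF M] by blast
  define R where "R = {(c, d). c \<in> darts \<and> d \<in> darts \<and> (\<Phi> d = \<Phi> c \<or> c \<in> B \<and> \<Phi> d = \<Phi> (contour c))}"
  have "R \<subseteq> darts \<times> darts" by (auto simp: R_def)
  hence finR: "finite R" using finite_darts finite_subset by (metis finite_SigmaI)
  define x where "x = (\<lambda>cd :: (complex \<times> complex) \<times> complex \<times> complex. g1 (edge (fst cd)))"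
  define y where "y = (\<lambda>cd :: (complex \<times> complex) \<times> complex \<times> complex. g2 (edge (snd cd)))"
  have fin: "finite {d. (c, d) \<in> R}" "finite {d. (d, c) \<in> R}" for c
    by (rule finite_subset[OF _ finite_darts]; auto simp: R_def)+
  have card1: "card {d. (c, d) \<in> R} \<le> 2 * M" for c
  proof -
    have "{d. (c, d) \<in> R} \<subseteq> {d \<in> darts. \<Phi> d = \<Phi> c} \<union> {d \<in> darts. \<Phi> d = \<Phi> (contour c)}" by (auto simp: R_def)
    hence "card {d. (c, d) \<in> R} \<le> card ({d \<in> darts. \<Phi> d = \<Phi> c} \<union> {d \<in> darts. \<Phi> d = \<Phi> (contour c)})"
      using finite_darts by (intro card_mono) auto
    also have "\<dots> \<le> card {d \<in> darts. \<Phi> d = \<Phi> c} + card {d \<in> darts. \<Phi> d = \<Phi> (contour c)}" by (rule card_Un_le)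
    finally show ?thesis using Phi(2)[of "\<Phi> c"] Phi(2)[of "\<Phi> (contour c)"] by simp
  qed
  have card2: "card {c. (c, d) \<in> R} \<le> 2 * M" for d
  proof -
    define S where "S = {c \<in> B. \<Phi> d = \<Phi> (contour c)}"
    have "card S \<le> card {c \<in> darts. \<Phi> c = \<Phi> d}"
    proof (rule card_inj_on_le)
      show "inj_on contour S" using inj_on_subset[OF inj_contour, of S] B_subset by (auto simp: S_def)
      show "contour ` S \<subseteq> {c \<in> darts. \<Phi> c = \<Phi> d}" using contour_in B_subset unfolding S_def by auto
    qed (use finite_darts in simp)
    moreover have "{c. (c, d) \<in> R} \<subseteq> {c \<in> darts. \<Phi> c = \<Phi> d} \<union> S" by (auto simp: R_def S_def)
    hence "card {c. (c, d) \<in> R} \<le> card ({c \<in> darts. \<Phi> c = \<Phi> d} \<union> S)"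
      using finite_darts finite_B by (intro card_mono) (auto simp: S_def)
    moreover have "card ({c \<in> darts. \<Phi> c = \<Phi> d} \<union> S) \<le> card {c \<in> darts. \<Phi> c = \<Phi> d} + card S"
      by (rule card_Un_le)
    ultimately show ?thesis using Phi(2)[of "\<Phi> d"] by simp
  qed
  have X: "(\<Sum>cd\<in>R. (x cd)\<^sup>2) \<le> 4 * real M / \<omega>\<^sub>0 * metric_area E w V g1"
  proof -
    have "(\<Sum>cd\<in>R. (x cd)\<^sup>2) = (\<Sum>(c, d)\<in>Sigma darts (\<lambda>c. {d. (c, d) \<in> R}). (g1 (edge c))\<^sup>2)"
      by (rule sum.cong) (auto simp: R_def x_def)
    also have "\<dots> = (\<Sum>c\<in>darts. \<Sum>d\<in>{d. (c, d) \<in> R}. (g1 (edge c))\<^sup>2)"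
      by (rule sum.Sigma[symmetric]) (use finite_darts fin in auto)
    also have "\<dots> \<le> (\<Sum>c\<in>darts. (2 * real M) * (g1 (edge c))\<^sup>2)"
    proof (rule sum_mono)
      fix c
      have "real (card {d. (c, d) \<in> R}) \<le> 2 * real M" using card1[of c] by linarith
      thus "(\<Sum>d\<in>{d. (c, d) \<in> R}. (g1 (edge c))\<^sup>2) \<le> (2 * real M) * (g1 (edge c))\<^sup>2"
        by (simp add: mult_right_mono)
    qed
    also have "\<dots> = (2 * real M) * (\<Sum>c\<in>darts. (g1 (edge c))\<^sup>2)" by (simp add: sum_distrib_left)
    also have "\<dots> \<le> (2 * real M) * (2 / \<omega>\<^sub>0 * metric_area E w V g1)"
      using sum_squares_darts[OF w0, of g1] by (intro mult_left_mono) auto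
    finally show ?thesis by (simp add: mult_ac)
  qed
  have Y: "(\<Sum>cd\<in>R. (y cd)\<^sup>2) \<le> 4 * real M / \<omega>\<^sub>0 * metric_area E w V g2"
  proof -
    have "(\<Sum>cd\<in>R. (y cd)\<^sup>2) = (\<Sum>(d, c)\<in>Sigma darts (\<lambda>d. {c. (c, d) \<in> R}). (g2 (edge d))\<^sup>2)"
      by (rule sum.reindex_bij_witness[of _ prod.swap prod.swap]) (auto simp: R_def y_def)
    also have "\<dots> = (\<Sum>d\<in>darts. \<Sum>c\<in>{c. (c, d) \<in> R}. (g2 (edge d))\<^sup>2)"
      by (rule sum.Sigma[symmetric]) (use finite_darts fin in auto)
    also have "\<dots> \<le> (\<Sum>d\<in>darts. (2 * real M) * (g2 (edge d))\<^sup>2)"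
    proof (rule sum_mono)
      fix d
      have "real (card {c. (c, d) \<in> R}) \<le> 2 * real M" using card2[of d] by linarith
      thus "(\<Sum>c\<in>{c. (c, d) \<in> R}. (g2 (edge d))\<^sup>2) \<le> (2 * real M) * (g2 (edge d))\<^sup>2"
        by (simp add: mult_right_mono)
    qed
    also have "\<dots> = (2 * real M) * (\<Sum>d\<in>darts. (g2 (edge d))\<^sup>2)" by (simp add: sum_distrib_left)
    also have "\<dots> \<le> (2 * real M) * (2 / \<omega>\<^sub>0 * metric_area E w V g2)"
      using sum_squares_darts[OF w0, of g2] by (intro mult_left_mono) auto
    finally show ?thesis by (simp add: mult_ac)
  qed
  have "l1 * l2 \<le> (\<Sum>cd\<in>R. x cd * y cd)"
    using product_of_lengths_le[where \<Phi> = \<Phi>, OF a ccw g1 g2 l1 l2 Phi(1)] unfolding R_def[symmetric] x_def y_def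
    by (simp add: case_prod_unfold)
  hence "(l1 * l2)\<^sup>2 \<le> (\<Sum>cd\<in>R. x cd * y cd)\<^sup>2" using l1(1) l2(1) by (intro power_mono) auto
  also have "\<dots> \<le> (\<Sum>cd\<in>R. (x cd)\<^sup>2) * (\<Sum>cd\<in>R. (y cd)\<^sup>2)" by (rule Cauchy_Schwarz_ineq_sum)
  also have "\<dots> \<le> (4 * real M / \<omega>\<^sub>0 * metric_area E w V g1) * (4 * real M / \<omega>\<^sub>0 * metric_area E w V g2)"
  proof (rule mult_mono[OF X Y])
    show "0 \<le> 4 * real M / \<omega>\<^sub>0 * metric_area E w V g1"
      by (rule order_trans[OF _ X]) (simp add: sum_nonneg)
  qed (simp add: sum_nonneg)
  finally show ?thesis by (simp add: power2_eq_square mult_ac)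
qed

end

section \<open>Potentials and currents\<close>

text \<open>The supremum of all \<open>s\<close> with \<open>s \<le> T s\<close> is a fixed point, as in the theorem of Knaster and Tarski.\<close>

lemma monotone_fixed_point:
  fixes T :: "('a \<Rightarrow> real) \<Rightarrow> 'a \<Rightarrow> real"
  assumes range: "\<And>s x. (\<And>y. 0 \<le> s y \<and> s y \<le> 1) \<Longrightarrow> 0 \<le> T s x \<and> T s x \<le> 1"
    and mono: "\<And>s t x. (\<And>y. s y \<le> t y) \<Longrightarrow> T s x \<le> T t x"
  shows "\<exists>h. (\<forall>x. 0 \<le> h x \<and> h x \<le> 1) \<and> T h = h"
proof -
  define S where "S = {s. (\<forall>x. 0 \<le> s x \<and> s x \<le> 1) \<and> (\<forall>x. s x \<le> T s x)}"
  have zero: "(\<lambda>x. 0) \<in> S" using range[of "\<lambda>x. 0"] by (auto simp: S_def)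
  define h where "h = (\<lambda>x. SUP s\<in>S. s x)"
  have bdd: "bdd_above ((\<lambda>s. s x) ` S)" for x by (rule bdd_aboveI[of _ 1]) (auto simp: S_def)
  have up: "s x \<le> h x" if "s \<in> S" for s x unfolding h_def by (rule cSUP_upper[OF that bdd])
  have least: "h x \<le> c" if "\<And>s. s \<in> S \<Longrightarrow> s x \<le> c" for x c
    unfolding h_def by (rule cSUP_least) (use zero that in auto)
  have r: "0 \<le> h x \<and> h x \<le> 1" for x using up[OF zero, of x] least[of x 1] by (auto simp: S_def)
  have le: "h x \<le> T h x" for x
  proof (rule least)
    fix s assume s: "s \<in> S"
    hence "s x \<le> T s x" by (auto simp: S_def)
    also have "\<dots> \<le> T h x" by (rule mono) (rule up[OF s])
    finally show "s x \<le> T h x" .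
  qed
  have "T h \<in> S" using range[of h] r mono[of h "T h"] le by (auto simp: S_def)
  hence "T h x \<le> h x" for x by (rule up)
  hence "T h = h" using le by (intro ext antisym) auto
  thus ?thesis using r by blast
qed

lemma sum_set_le_sum_list:
  fixes q :: "'a \<Rightarrow> real"
  assumes "\<And>x. 0 \<le> q x"
  shows "sum q (set xs) \<le> sum_list (map q xs)"
proof (induction xs)
  case (Cons x xs)
  have "sum q (insert x (set xs)) \<le> q x + sum q (set xs)" using assms by (cases "x \<in> set xs") (auto simp: insert_absorb)
  thus ?case using Cons by simp
qed simp

lemma sum_list_steps: "xs \<noteq> [] \<Longrightarrow> sum_list (map q xs) = q (hd xs) + (\<Sum>(x, y)\<leftarrow>steps xs. q y)"
  for q :: "'a \<Rightarrow> real"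
  by (induction xs rule: induct_list012) auto

context planar_domain
begin

lemma sum_darts_vertex: "(\<Sum>d\<in>darts. f d) = (\<Sum>v\<in>V. \<Sum>d\<in>{d \<in> darts. fst d = v}. f d)"
  for f :: "complex \<times> complex \<Rightarrow> real"
proof -
  have "(\<Sum>d\<in>darts. f d) = (\<Sum>v\<in>fst ` darts. \<Sum>d\<in>{d \<in> darts. fst d = v}. f d)"
    by (rule sum.image_gen[OF finite_darts])
  also have "\<dots> = (\<Sum>v\<in>V. \<Sum>d\<in>{d \<in> darts. fst d = v}. f d)"
  proof (rule sum.mono_neutral_left)
    show "\<forall>v\<in>V - fst ` darts. (\<Sum>d\<in>{d \<in> darts. fst d = v}. f d) = 0" by (auto intro!: sum.neutral)
  qed (use V_props fst_in_V in auto)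
  finally show ?thesis .
qed

lemma weight_edge_pos: "d \<in> darts \<Longrightarrow> 0 < w (edge d)"
  using weight_pos by (cases d) (auto simp: darts_def edge_def)

lemma edge_opp: "edge (opp d) = edge d"
  by (auto simp: edge_def opp_def)

lemma edge_eq_cases: "d \<in> darts \<Longrightarrow> d' \<in> darts \<Longrightarrow> edge d = edge d' \<Longrightarrow> d' = d \<or> d' = opp d"
  by (cases d; cases d') (auto simp: edge_def opp_def darts_def doubleton_eq_iff)

text \<open>The value of a potential at the head of a dart: zero and one are prescribed on two sets of boundary points,
  and no current leaves through the other boundary points.\<close>

definition head_value ::
  "(complex \<times> complex) set \<Rightarrow> (complex \<times> complex) set \<Rightarrow> (complex \<Rightarrow> real) \<Rightarrow> complex \<times> complex \<Rightarrow> real" where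
  "head_value Z0 Z1 h d =
     (if d \<in> Z0 then 0 else if d \<in> Z1 then 1 else if d \<in> B then h (fst d) else h (snd d))"

definition current ::
  "(complex \<times> complex) set \<Rightarrow> (complex \<times> complex) set \<Rightarrow> (complex \<Rightarrow> real) \<Rightarrow> complex \<times> complex \<Rightarrow> real" where
  "current Z0 Z1 h d = w (edge d) * (head_value Z0 Z1 h d - h (fst d))"

text \<open>The potential at a vertex has to be the weighted mean of the prescribed and of the neighbouring values. Taking means is a
  monotone operation. At a vertex without conducting edges the mean has the default value zero, and Kirchhoff's
  law is void.\<close>

lemma exists_harmonic:
  assumes Z: "Z0 \<subseteq> B" "Z1 \<subseteq> B"
  shows "\<exists>h. (\<forall>v. 0 \<le> h v \<and> h v \<le> 1) \<and> (\<forall>v. (\<Sum>d\<in>{d \<in> darts. fst d = v}. current Z0 Z1 h d) = 0)"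
proof -
  define D where "D = (\<lambda>v. {d \<in> darts. fst d = v \<and> (d \<in> B \<longrightarrow> d \<in> Z0 \<union> Z1)})"
  define W where "W = (\<lambda>v. \<Sum>d\<in>D v. w (edge d))"
  define T where "T = (\<lambda>h v. (\<Sum>d\<in>D v. w (edge d) * head_value Z0 Z1 h d) / W v)"
  have finD: "finite (D v)" for v using finite_darts by (simp add: D_def)
  have wD: "0 < w (edge d)" if "d \<in> D v" for d v using that weight_edge_pos by (auto simp: D_def)
  have W0: "0 \<le> W v" for v unfolding W_def by (intro sum_nonneg) (use wD in \<open>auto intro: less_imp_le\<close>)
  have "\<exists>h. (\<forall>x. 0 \<le> h x \<and> h x \<le> 1) \<and> T h = h"
  proof (rule monotone_fixed_point)
    fix s :: "complex \<Rightarrow> real" and v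
    assume s: "\<And>y. 0 \<le> s y \<and> s y \<le> 1"
    have hv: "0 \<le> head_value Z0 Z1 s d" "head_value Z0 Z1 s d \<le> 1" for d using s by (auto simp: head_value_def)
    have "0 \<le> (\<Sum>d\<in>D v. w (edge d) * head_value Z0 Z1 s d)"
      by (intro sum_nonneg mult_nonneg_nonneg hv(1)) (use wD in \<open>auto intro: less_imp_le\<close>)
    moreover have "(\<Sum>d\<in>D v. w (edge d) * head_value Z0 Z1 s d) \<le> W v"
      unfolding W_def
      by (intro sum_mono mult_left_le hv) (use wD in \<open>auto intro: less_imp_le\<close>)
    ultimately show "0 \<le> T s v \<and> T s v \<le> 1"
      using W0[of v] by (cases "W v = 0") (auto simp: T_def divide_le_eq)
  next
    fix s t :: "complex \<Rightarrow> real" and v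
    assume st: "\<And>y. s y \<le> t y"
    have "head_value Z0 Z1 s d \<le> head_value Z0 Z1 t d" for d using st by (simp add: head_value_def)
    hence "(\<Sum>d\<in>D v. w (edge d) * head_value Z0 Z1 s d) \<le> (\<Sum>d\<in>D v. w (edge d) * head_value Z0 Z1 t d)"
      by (intro sum_mono mult_left_mono) (use wD in \<open>auto intro: less_imp_le\<close>)
    thus "T s v \<le> T t v" unfolding T_def by (rule divide_right_mono) (rule W0)
  qed
  then obtain h where h: "\<And>x. 0 \<le> h x \<and> h x \<le> 1" "T h = h" by blast
  have "(\<Sum>d\<in>{d \<in> darts. fst d = v}. current Z0 Z1 h d) = 0" for v
  proof -
    have "(\<Sum>d\<in>{d \<in> darts. fst d = v}. current Z0 Z1 h d) = (\<Sum>d\<in>D v. current Z0 Z1 h d)"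
      by (rule sum.mono_neutral_right) (use finite_darts in \<open>auto simp: D_def current_def head_value_def\<close>)
    also have "\<dots> = (\<Sum>d\<in>D v. w (edge d) * head_value Z0 Z1 h d) - h v * W v"
    proof -
      have "current Z0 Z1 h d = w (edge d) * head_value Z0 Z1 h d - h v * w (edge d)" if "d \<in> D v" for d
        using that by (simp add: D_def current_def algebra_simps)
      thus ?thesis by (simp add: sum_subtractf W_def sum_distrib_left)
    qed
    also have "\<dots> = 0"
    proof (cases "D v = {}")
      case False
      then obtain d where "d \<in> D v" by blast
      hence "0 < W v" unfolding W_def
        by (intro sum_pos2[OF finD _ wD]) (use wD in \<open>auto intro: less_imp_le\<close>)
      moreover have "h v = T h v" using h(2) by simp
      ultimately show ?thesis by (simp add: T_def field_simps)
    qed (simp add: W_def)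
    finally show ?thesis .
  qed
  thus ?thesis using h(1) by blast
qed

context
  fixes Z0 Z1 :: "(complex \<times> complex) set" and h :: "complex \<Rightarrow> real"
  assumes Z: "Z0 \<subseteq> B" "Z1 \<subseteq> B" "Z0 \<inter> Z1 = {}"
    and h01: "\<And>v. 0 \<le> h v \<and> h v \<le> 1"
    and kirchhoff: "\<And>v. (\<Sum>d\<in>{d \<in> darts. fst d = v}. current Z0 Z1 h d) = 0"
begin

definition potential_drop :: "complex \<times> complex \<Rightarrow> real" where
  "potential_drop d = head_value Z0 Z1 h d - h (fst d)"

lemma current_drop: "current Z0 Z1 h d = w (edge d) * potential_drop d"
  by (simp add: current_def potential_drop_def)

lemma drop_int: "d \<in> darts - B \<Longrightarrow> potential_drop d = h (snd d) - h (fst d)"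
  using Z by (auto simp: potential_drop_def head_value_def)

lemma drop_opp: "d \<in> darts - B \<Longrightarrow> potential_drop (opp d) = - potential_drop d"
  using drop_int opp_in_int[of d] opp_int[of d] by simp

lemma current_opp: "d \<in> darts - B \<Longrightarrow> current Z0 Z1 h (opp d) = - current Z0 Z1 h d"
  unfolding current_drop edge_opp using drop_opp by simp

text \<open>Dissipated energy, except that interior edges count twice because they carry two darts.\<close>

definition energy :: real where
  "energy = (\<Sum>d\<in>darts. w (edge d) * (potential_drop d)\<^sup>2)"

lemma bij_opp: "bij_betw opp (darts - B) (darts - B)"
  by (rule bij_betw_byWitness[where f' = opp]) (use opp_opp opp_in_int in auto)

text \<open>Green's identity: by Kirchhoff's law the sum of the current weighted with the potential at the tail is zero. The
  interior darts contribute minus half of their energy to this sum, and the half-edges the flux into \<open>Z1\<close> minus their energy.\<close>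

lemma energy_le_flux: "energy \<le> 2 * (\<Sum>d\<in>Z1. current Z0 Z1 h d)"
proof -
  let ?f = "current Z0 Z1 h"
  have e0: "0 \<le> w (edge d) * (potential_drop d)\<^sup>2" if "d \<in> darts" for d using weight_edge_pos[OF that] by simp
  have "(\<Sum>d\<in>darts. h (fst d) * ?f d) = (\<Sum>v\<in>V. \<Sum>d\<in>{d \<in> darts. fst d = v}. h (fst d) * ?f d)"
    by (rule sum_darts_vertex)
  also have "\<dots> = (\<Sum>v\<in>V. h v * (\<Sum>d\<in>{d \<in> darts. fst d = v}. ?f d))"
    unfolding sum_distrib_left by (intro sum.cong) auto
  finally have "(\<Sum>d\<in>darts. h (fst d) * ?f d) = 0" by (simp add: kirchhoff)
  hence split: "(\<Sum>d\<in>darts - B. h (fst d) * ?f d) + (\<Sum>d\<in>B. h (fst d) * ?f d) = 0"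
    using sum.subset_diff[OF B_subset finite_darts, of "\<lambda>d. h (fst d) * ?f d"] by simp
  have "(\<Sum>d\<in>darts - B. h (fst (opp d)) * ?f (opp d)) = (\<Sum>d\<in>darts - B. h (fst d) * ?f d)"
    by (rule sum.reindex_bij_betw[OF bij_opp])
  moreover have "(\<Sum>d\<in>darts - B. h (fst (opp d)) * ?f (opp d)) = (\<Sum>d\<in>darts - B. - (h (snd d) * ?f d))"
    by (rule sum.cong[OF refl]) (use current_opp opp_int in simp)
  ultimately have "2 * (\<Sum>d\<in>darts - B. h (fst d) * ?f d) =
      (\<Sum>d\<in>darts - B. h (fst d) * ?f d) + (\<Sum>d\<in>darts - B. - (h (snd d) * ?f d))" by simp
  also have "\<dots> = (\<Sum>d\<in>darts - B. - (w (edge d) * (potential_drop d)\<^sup>2))"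
    unfolding sum.distrib[symmetric]
    by (rule sum.cong[OF refl]) (simp add: current_drop drop_int power2_eq_square algebra_simps)
  finally have int: "2 * (\<Sum>d\<in>darts - B. h (fst d) * ?f d) = - (\<Sum>d\<in>darts - B. w (edge d) * (potential_drop d)\<^sup>2)"
    by (simp add: sum_negf)
  have bdterm: "h (fst d) * ?f d = (if d \<in> Z1 then ?f d else 0) - w (edge d) * (potential_drop d)\<^sup>2" if "d \<in> B" for d
    using that Z(3) unfolding current_drop
    by (auto simp: potential_drop_def head_value_def power2_eq_square algebra_simps)
  have "(\<Sum>d\<in>B. h (fst d) * ?f d) = (\<Sum>d\<in>B. if d \<in> Z1 then ?f d else 0) - (\<Sum>d\<in>B. w (edge d) * (potential_drop d)\<^sup>2)"
    unfolding sum_subtractf[symmetric] by (rule sum.cong[OF refl bdterm])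
  also have "(\<Sum>d\<in>B. if d \<in> Z1 then ?f d else 0) = (\<Sum>d\<in>Z1. ?f d)"
    using sum.inter_restrict[OF finite_B, of ?f Z1] Z(2) by (simp add: Int_absorb1)
  finally have bd: "(\<Sum>d\<in>B. h (fst d) * ?f d) = (\<Sum>d\<in>Z1. ?f d) - (\<Sum>d\<in>B. w (edge d) * (potential_drop d)\<^sup>2)" .
  have "energy = (\<Sum>d\<in>darts - B. w (edge d) * (potential_drop d)\<^sup>2) + (\<Sum>d\<in>B. w (edge d) * (potential_drop d)\<^sup>2)"
    unfolding energy_def by (rule sum.subset_diff[OF B_subset finite_darts])
  moreover have "0 \<le> (\<Sum>d\<in>B. w (edge d) * (potential_drop d)\<^sup>2)" by (intro sum_nonneg e0) (use B_subset in auto)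
  ultimately show ?thesis using split int bd by linarith
qed

text \<open>The two darts of an edge have opposite potential differences, so that the choice of the dart does not matter.\<close>

definition drop_metric :: "complex set \<Rightarrow> real" where
  "drop_metric e = \<bar>potential_drop (SOME d. d \<in> darts \<and> edge d = e)\<bar>"

lemma drop_metric_edge:
  assumes "d \<in> darts"
  shows "drop_metric (edge d) = \<bar>potential_drop d\<bar>"
proof -
  define d' where "d' = (SOME d'. d' \<in> darts \<and> edge d' = edge d)"
  have d': "d' \<in> darts \<and> edge d' = edge d" unfolding d'_def by (rule someI[of _ d]) (use assms in simp)
  have "d' = d \<or> d' = opp d" using edge_eq_cases[OF assms] d' by metis
  hence "\<bar>potential_drop d'\<bar> = \<bar>potential_drop d\<bar>"
  proof
    assume "d' = opp d"
    thus ?thesis using drop_opp[of d] opp_B[of d] assms by (cases "d \<in> B") auto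
  qed simp
  thus ?thesis by (simp add: drop_metric_def d'_def)
qed

lemma drop_metric_area: "metric_area E w V drop_metric \<le> energy"
proof -
  have "metric_area E w V drop_metric \<le> sum ((\<lambda>e. w e * (drop_metric e)\<^sup>2) \<circ> edge) darts"
    unfolding metric_area_def dom_edges_eq
  proof (rule sum_image_le[OF finite_darts])
    fix d assume "d \<in> darts"
    thus "0 \<le> w (edge d) * (drop_metric (edge d))\<^sup>2" using weight_edge_pos[of d] by simp
  qed
  also have "\<dots> = energy"
    unfolding energy_def by (rule sum.cong) (use drop_metric_edge in auto)
  finally show ?thesis .
qed

lemma drop_metric_length:
  assumes "\<gamma> \<in> connecting_paths E V Z0 Z1"
  shows "1 \<le> path_length drop_metric \<gamma>"
proof -
  obtain x vs y where \<gamma>: "\<gamma> = [x] @ vs @ [y]" "walk IE vs" "(hd vs, x) \<in> Z0" "(last vs, y) \<in> Z1"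
    using assms unfolding connecting_paths_def by blast
  have ne: "vs \<noteq> []" using \<gamma>(2) walk_simps(3) by auto
  have "h (last vs) - h (hd vs) \<le> (\<Sum>(x, y)\<leftarrow>steps vs. drop_metric {x, y})"
    using \<gamma>(2)
  proof (induction vs rule: induct_list012)
    case (3 x y zs)
    have e: "(x, y) \<in> darts - B" using 3 edge_dart by (simp add: walk_simps)
    have "h y - h x \<le> drop_metric {x, y}"
      using drop_metric_edge[of "(x, y)"] drop_int[OF e] e by (simp add: edge_def)
    moreover have "h (last (y # zs)) - h y \<le> (\<Sum>(x, y)\<leftarrow>steps (y # zs). drop_metric {x, y})"
      using 3 by (simp add: walk_simps)
    ultimately show ?case by simp
  qed (auto simp: walk_simps)
  moreover have "h (hd vs) \<le> drop_metric {x, hd vs}"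
  proof -
    have "drop_metric (edge (hd vs, x)) = \<bar>potential_drop (hd vs, x)\<bar>"
      using \<gamma>(3) Z B_subset by (intro drop_metric_edge) auto
    thus ?thesis using \<gamma>(3) by (simp add: edge_def insert_commute potential_drop_def head_value_def)
  qed
  moreover have "1 - h (last vs) \<le> drop_metric {last vs, y}"
  proof -
    have "drop_metric (edge (last vs, y)) = \<bar>potential_drop (last vs, y)\<bar>"
      using \<gamma>(4) Z B_subset by (intro drop_metric_edge) auto
    moreover have "(last vs, y) \<notin> Z0" using \<gamma>(4) Z(3) by blast
    ultimately show ?thesis using \<gamma>(4) by (simp add: edge_def potential_drop_def head_value_def)
  qed
  ultimately show ?thesis unfolding \<gamma>(1) path_length_ends[OF ne] by linarith
qed

definition throughput :: "complex \<Rightarrow> real" where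
  "throughput v = (\<Sum>d\<in>{d \<in> darts. fst d = v}. \<bar>current Z0 Z1 h d\<bar>)"

text \<open>The length of an edge is the total strength of the currents at its end points in the domain. A path is then at least as
  long as the current through its vertices is strong.\<close>

definition flow_metric :: "complex set \<Rightarrow> real" where
  "flow_metric e = (\<Sum>d\<in>{d \<in> darts. edge d = e}. throughput (fst d))"

lemma throughput_nonneg: "0 \<le> throughput v"
  unfolding throughput_def by (intro sum_nonneg) auto

lemma flow_metric_ge: "d \<in> darts \<Longrightarrow> throughput (fst d) \<le> flow_metric (edge d)"
  unfolding flow_metric_def
  by (rule member_le_sum) (use throughput_nonneg finite_darts in auto)

lemma flow_metric_nonneg: "0 \<le> flow_metric e"
  unfolding flow_metric_def by (intro sum_nonneg throughput_nonneg)

lemma weights_at_vertex: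
  assumes "v \<in> V"
  shows "(\<Sum>d\<in>{d \<in> darts. fst d = v}. w (edge d)) \<le> inverse \<omega>\<^sub>0"
proof -
  have "(\<Sum>d\<in>{d \<in> darts. fst d = v}. w (edge d)) = vertex_weight E w v"
    unfolding vertex_weight_def
    by (rule sum.reindex_bij_witness[of _ "\<lambda>x. (v, x)" snd])
       (use assms in \<open>auto simp: darts_iff edge_def\<close>)
  thus ?thesis using vertex_weight_upper assms V_props by auto
qed

text \<open>An edge has at most two ends in the domain, which gives the factor two. Both the squares of the throughput at a
  vertex and the weights of the edges at this vertex bring in the total weight there, at most \<open>1 / \<omega>\<^sub>0\<close>.\<close>

lemma flow_metric_area:
  assumes w0: "\<omega>\<^sub>0 > 0"
  shows "metric_area E w V flow_metric \<le> 2 / \<omega>\<^sub>0\<^sup>2 * energy"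
proof -
  have "metric_area E w V flow_metric \<le>
      (\<Sum>e\<in>edge ` darts. \<Sum>d\<in>{d \<in> darts. edge d = e}. 2 * (w (edge d) * (throughput (fst d))\<^sup>2))"
    unfolding metric_area_def dom_edges_eq
  proof (rule sum_mono)
    fix e assume e: "e \<in> edge ` darts"
    note c = card_darts_of_edge[OF e]
    have we: "0 \<le> w e" using e weight_edge_pos by (auto intro: less_imp_le)
    have "(flow_metric e)\<^sup>2 \<le> (\<Sum>d\<in>{d \<in> darts. edge d = e}. (throughput (fst d))\<^sup>2) * real (card {d \<in> darts. edge d = e})"
      unfolding flow_metric_def by (rule sum_squared_le_sum_of_squares)
    also have "\<dots> \<le> (\<Sum>d\<in>{d \<in> darts. edge d = e}. (throughput (fst d))\<^sup>2) * 2"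
      using c by (intro mult_left_mono sum_nonneg) auto
    finally have "w e * (flow_metric e)\<^sup>2 \<le> w e * ((\<Sum>d\<in>{d \<in> darts. edge d = e}. (throughput (fst d))\<^sup>2) * 2)"
      using we by (intro mult_left_mono) auto
    also have "\<dots> = (\<Sum>d\<in>{d \<in> darts. edge d = e}. 2 * (w (edge d) * (throughput (fst d))\<^sup>2))"
      by (simp add: sum_distrib_left sum_distrib_right mult_ac)
    finally show "w e * (flow_metric e)\<^sup>2 \<le> (\<Sum>d\<in>{d \<in> darts. edge d = e}. 2 * (w (edge d) * (throughput (fst d))\<^sup>2))" .
  qed
  also have "\<dots> = (\<Sum>d\<in>darts. 2 * (w (edge d) * (throughput (fst d))\<^sup>2))"
    by (rule sum.image_gen[OF finite_darts, symmetric])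
  also have "\<dots> = (\<Sum>v\<in>V. \<Sum>d\<in>{d \<in> darts. fst d = v}. 2 * (w (edge d) * (throughput (fst d))\<^sup>2))"
    by (rule sum_darts_vertex)
  also have "\<dots> \<le> (\<Sum>v\<in>V. 2 / \<omega>\<^sub>0\<^sup>2 * (\<Sum>d\<in>{d \<in> darts. fst d = v}. w (edge d) * (potential_drop d)\<^sup>2))"
  proof (rule sum_mono)
    fix v assume v: "v \<in> V"
    let ?D = "{d \<in> darts. fst d = v}"
    have wpos: "0 \<le> w (edge d)" if "d \<in> ?D" for d using weight_edge_pos[of d] that by (auto intro: less_imp_le)
    have S0: "0 \<le> (\<Sum>d\<in>?D. w (edge d) * (potential_drop d)\<^sup>2)" using wpos by (intro sum_nonneg) auto
    have "(throughput v)\<^sup>2 = (\<Sum>d\<in>?D. sqrt (w (edge d)) * (sqrt (w (edge d)) * \<bar>potential_drop d\<bar>))\<^sup>2"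
      unfolding throughput_def current_drop
      by (intro arg_cong[of _ _ "\<lambda>x. x\<^sup>2"] sum.cong refl)
         (use wpos in \<open>simp add: abs_mult flip: mult.assoc\<close>)
    also have "\<dots> \<le> (\<Sum>d\<in>?D. (sqrt (w (edge d)))\<^sup>2) * (\<Sum>d\<in>?D. (sqrt (w (edge d)) * \<bar>potential_drop d\<bar>)\<^sup>2)"
      by (rule Cauchy_Schwarz_ineq_sum)
    also have "(\<Sum>d\<in>?D. (sqrt (w (edge d)))\<^sup>2) = (\<Sum>d\<in>?D. w (edge d))"
      by (rule sum.cong) (use wpos in auto)
    also have "(\<Sum>d\<in>?D. (sqrt (w (edge d)) * \<bar>potential_drop d\<bar>)\<^sup>2) = (\<Sum>d\<in>?D. w (edge d) * (potential_drop d)\<^sup>2)"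
      by (rule sum.cong) (use wpos in \<open>auto simp: power_mult_distrib\<close>)
    also have "(\<Sum>d\<in>?D. w (edge d)) * (\<Sum>d\<in>?D. w (edge d) * (potential_drop d)\<^sup>2) \<le>
        inverse \<omega>\<^sub>0 * (\<Sum>d\<in>?D. w (edge d) * (potential_drop d)\<^sup>2)"
      using weights_at_vertex[OF v] S0 by (rule mult_right_mono)
    finally have q: "(throughput v)\<^sup>2 \<le> inverse \<omega>\<^sub>0 * (\<Sum>d\<in>?D. w (edge d) * (potential_drop d)\<^sup>2)" .
    have "(\<Sum>d\<in>?D. 2 * (w (edge d) * (throughput (fst d))\<^sup>2)) = (\<Sum>d\<in>?D. 2 * (throughput v)\<^sup>2 * w (edge d))"
      by (rule sum.cong) auto
    also have "\<dots> = 2 * (throughput v)\<^sup>2 * (\<Sum>d\<in>?D. w (edge d))" by (simp add: sum_distrib_left)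
    also have "\<dots> \<le> 2 * (throughput v)\<^sup>2 * inverse \<omega>\<^sub>0"
      using weights_at_vertex[OF v] by (intro mult_left_mono) auto
    also have "\<dots> \<le> 2 * (inverse \<omega>\<^sub>0 * (\<Sum>d\<in>?D. w (edge d) * (potential_drop d)\<^sup>2)) * inverse \<omega>\<^sub>0"
      using q w0 by (intro mult_right_mono mult_left_mono) auto
    also have "\<dots> = 2 / \<omega>\<^sub>0\<^sup>2 * (\<Sum>d\<in>?D. w (edge d) * (potential_drop d)\<^sup>2)"
      by (simp add: field_simps power2_eq_square)
    finally show "(\<Sum>d\<in>?D. 2 * (w (edge d) * (throughput (fst d))\<^sup>2)) \<le>
        2 / \<omega>\<^sub>0\<^sup>2 * (\<Sum>d\<in>?D. w (edge d) * (potential_drop d)\<^sup>2)" .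
  qed
  also have "\<dots> = 2 / \<omega>\<^sub>0\<^sup>2 * energy"
    unfolding energy_def sum_darts_vertex[of "\<lambda>d. w (edge d) * (potential_drop d)\<^sup>2"] sum_distrib_left ..
  finally show ?thesis .
qed

text \<open>Let \<open>S\<close> be the part of the domain outside of \<open>P\<close> that is joined to \<open>Z1\<close>. By Kirchhoff's law the current from \<open>S\<close> to
  \<open>Z1\<close> has come into \<open>S\<close> from \<open>P\<close>; for no part of \<open>S\<close> is joined to \<open>Z0\<close>, and nothing passes through the other
  half-edges. The rest of the current leaves to \<open>Z1\<close> from \<open>P\<close> directly.\<close>

lemma flux_through_separator:
  assumes sep: "\<And>ys p q. walk IE ys \<Longrightarrow> p \<in> Z1 \<Longrightarrow> hd ys = fst p \<Longrightarrow> q \<in> Z0 \<Longrightarrow> last ys = fst q \<Longrightarrow> set ys \<inter> P \<noteq> {}"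
    and P: "P \<subseteq> V"
  shows "(\<Sum>d\<in>Z1. current Z0 Z1 h d) \<le> (\<Sum>v\<in>P. throughput v)"
proof -
  let ?f = "current Z0 Z1 h"
  have finP: "finite P" using P V_props finite_subset by blast
  define S where "S = {v. \<exists>ys p. walk IE ys \<and> set ys \<inter> P = {} \<and> p \<in> Z1 \<and> hd ys = fst p \<and> last ys = v}"
  have S_V: "S \<subseteq> V - P"
  proof
    fix v assume "v \<in> S"
    then obtain ys p where ys: "walk IE ys" "set ys \<inter> P = {}" "p \<in> Z1" "hd ys = fst p" "last ys = v" by (auto simp: S_def)
    have "fst p \<in> V" using fst_in_V ys(3) Z(2) B_subset by blast
    hence "set ys \<subseteq> V" using walk_in_V[OF ys(1)] ys(4) by simp
    moreover have "ys \<noteq> []" using ys(1) walk_simps(3) by auto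
    hence "v \<in> set ys" using last_in_set[of ys] ys(5) by simp
    ultimately show "v \<in> V - P" using ys(2) by blast
  qed
  have S_step: "snd d \<in> S" if d: "d \<in> darts - B" "fst d \<in> S" "snd d \<notin> P" for d
  proof -
    obtain ys p where ys: "walk IE ys" "set ys \<inter> P = {}" "p \<in> Z1" "hd ys = fst p" "last ys = fst d"
      using d(2) by (auto simp: S_def)
    have ne: "ys \<noteq> []" using ys(1) walk_simps(3) by auto
    have "walk IE (ys @ [snd d])" unfolding walk_snoc[OF ne] using ys int_dart_edge[OF d(1)] by simp
    thus ?thesis unfolding S_def using ys ne d(3) by (intro CollectI exI[of _ "ys @ [snd d]"] exI[of _ p]) auto
  qed
  have S_Z0: "d \<notin> Z0" if d: "fst d \<in> S" for d
  proof
    assume "d \<in> Z0"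
    obtain ys p where ys: "walk IE ys" "set ys \<inter> P = {}" "p \<in> Z1" "hd ys = fst p" "last ys = fst d"
      using d by (auto simp: S_def)
    show False using sep[OF ys(1,3,4) \<open>d \<in> Z0\<close> ys(5)] ys(2) by simp
  qed
  have S_Z1: "fst p \<in> S \<or> fst p \<in> P" if "p \<in> Z1" for p
  proof (cases "fst p \<in> P")
    case False
    thus ?thesis using that unfolding S_def
      by (intro disjI1 CollectI exI[of _ "[fst p]"] exI[of _ p]) (auto simp: walk_simps)
  qed simp
  define D where "D = {d \<in> darts. fst d \<in> S}"
  define DS where "DS = {d \<in> darts - B. fst d \<in> S \<and> snd d \<in> S}"
  define DP where "DP = {d \<in> darts - B. fst d \<in> S \<and> snd d \<in> P}"
  define DB where "DB = {d \<in> B. fst d \<in> S}"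
  have fin: "finite D" "finite DS" "finite DP" "finite DB"
    using finite_darts finite_B by (auto simp: D_def DS_def DP_def DB_def)
  have "(\<Sum>d\<in>D. ?f d) = (\<Sum>v\<in>fst ` D. \<Sum>d\<in>{d \<in> D. fst d = v}. ?f d)" by (rule sum.image_gen[OF fin(1)])
  also have "\<dots> = 0"
  proof (rule sum.neutral, rule ballI)
    fix v assume "v \<in> fst ` D"
    hence "{d \<in> D. fst d = v} = {d \<in> darts. fst d = v}" by (auto simp: D_def)
    thus "(\<Sum>d\<in>{d \<in> D. fst d = v}. ?f d) = 0" by (simp only: kirchhoff)
  qed
  finally have zero: "(\<Sum>d\<in>D. ?f d) = 0" .
  have "D = DS \<union> DP \<union> DB" using S_step B_subset by (auto simp: D_def DS_def DP_def DB_def)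
  moreover have "DS \<inter> DP = {}" "(DS \<union> DP) \<inter> DB = {}" using S_V by (auto simp: DS_def DP_def DB_def)
  ultimately have "(\<Sum>d\<in>D. ?f d) = (\<Sum>d\<in>DS. ?f d) + (\<Sum>d\<in>DP. ?f d) + (\<Sum>d\<in>DB. ?f d)"
    using fin by (simp add: sum.union_disjoint)
  moreover have "(\<Sum>d\<in>DS. ?f d) = 0"
  proof -
    have int: "d \<in> darts - B" "d \<in> darts" "opp d \<in> DS" if "d \<in> DS" for d
      using that opp_in_int[of d] opp_int[of d] by (simp_all add: DS_def)
    have "bij_betw opp DS DS"
      by (rule bij_betw_byWitness[where f' = opp]) (use opp_opp[OF int(2)] int(3) in blast)+
    hence "(\<Sum>d\<in>DS. ?f (opp d)) = (\<Sum>d\<in>DS. ?f d)" by (rule sum.reindex_bij_betw)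
    moreover have "(\<Sum>d\<in>DS. ?f (opp d)) = - (\<Sum>d\<in>DS. ?f d)"
      unfolding sum_negf[symmetric] by (rule sum.cong[OF refl]) (rule current_opp[OF int(1)])
    ultimately show ?thesis by simp
  qed
  moreover have "(\<Sum>d\<in>DB. ?f d) = (\<Sum>d\<in>{d \<in> Z1. fst d \<in> S}. ?f d)"
  proof (rule sum.mono_neutral_right)
    show "\<forall>d\<in>DB - {d \<in> Z1. fst d \<in> S}. ?f d = 0"
    proof
      fix d assume "d \<in> DB - {d \<in> Z1. fst d \<in> S}"
      hence "d \<in> B" "d \<notin> Z1" "d \<notin> Z0" using S_Z0[of d] by (auto simp: DB_def)
      thus "?f d = 0" by (simp add: current_def head_value_def)
    qed
    show "{d \<in> Z1. fst d \<in> S} \<subseteq> DB" using Z(2) by (auto simp: DB_def)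
  qed (rule fin(4))
  ultimately have "(\<Sum>d\<in>{d \<in> Z1. fst d \<in> S}. ?f d) = (\<Sum>d\<in>DP. - ?f d)" using zero by (simp add: sum_negf)
  also have "\<dots> \<le> (\<Sum>d\<in>DP. \<bar>?f (opp d)\<bar>)"
  proof (rule sum_mono)
    fix d assume "d \<in> DP"
    hence "?f (opp d) = - ?f d" by (intro current_opp) (simp add: DP_def)
    thus "- ?f d \<le> \<bar>?f (opp d)\<bar>" by simp
  qed
  also have "\<dots> = (\<Sum>d\<in>opp ` DP. \<bar>?f d\<bar>)"
  proof -
    have "inj_on opp DP" by (rule inj_on_inverseI[of _ opp]) (rule opp_opp, simp add: DP_def)
    thus ?thesis by (simp add: sum.reindex)
  qed
  finally have 1: "(\<Sum>d\<in>{d \<in> Z1. fst d \<in> S}. ?f d) \<le> (\<Sum>d\<in>opp ` DP. \<bar>?f d\<bar>)" .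
  have 2: "(\<Sum>d\<in>{d \<in> Z1. fst d \<in> P}. ?f d) \<le> (\<Sum>d\<in>{d \<in> Z1. fst d \<in> P}. \<bar>?f d\<bar>)" by (rule sum_mono) simp
  have finZ: "finite Z1" using Z(2) finite_B finite_subset by blast
  have un: "{d \<in> Z1. fst d \<in> S} \<union> {d \<in> Z1. fst d \<in> P} = Z1" using S_Z1 by blast
  have "{d \<in> Z1. fst d \<in> S} \<inter> {d \<in> Z1. fst d \<in> P} = {}" using S_V by auto
  hence "sum ?f ({d \<in> Z1. fst d \<in> S} \<union> {d \<in> Z1. fst d \<in> P}) =
      (\<Sum>d\<in>{d \<in> Z1. fst d \<in> S}. ?f d) + (\<Sum>d\<in>{d \<in> Z1. fst d \<in> P}. ?f d)"
    by (intro sum.union_disjoint) (use finZ in auto)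
  hence "(\<Sum>d\<in>Z1. ?f d) = (\<Sum>d\<in>{d \<in> Z1. fst d \<in> S}. ?f d) + (\<Sum>d\<in>{d \<in> Z1. fst d \<in> P}. ?f d)"
    unfolding un .
  also have "\<dots> \<le> (\<Sum>d\<in>opp ` DP. \<bar>?f d\<bar>) + (\<Sum>d\<in>{d \<in> Z1. fst d \<in> P}. \<bar>?f d\<bar>)" using 1 2 by simp
  also have "\<dots> = (\<Sum>d\<in>opp ` DP \<union> {d \<in> Z1. fst d \<in> P}. \<bar>?f d\<bar>)"
  proof (rule sum.union_disjoint[symmetric])
    have "opp ` DP \<subseteq> darts - B" using opp_in_int unfolding DP_def by blast
    thus "opp ` DP \<inter> {d \<in> Z1. fst d \<in> P} = {}" using Z(2) by blast
  qed (use fin finZ in auto)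
  also have "\<dots> \<le> (\<Sum>d\<in>{d \<in> darts. fst d \<in> P}. \<bar>?f d\<bar>)"
  proof (rule sum_mono2)
    show "opp ` DP \<union> {d \<in> Z1. fst d \<in> P} \<subseteq> {d \<in> darts. fst d \<in> P}"
    proof -
      have "opp d \<in> darts \<and> fst (opp d) \<in> P" if "d \<in> DP" for d
        using that opp_in_int[of d] opp_int[of d] by (auto simp: DP_def)
      thus ?thesis using Z(2) B_subset by blast
    qed
  qed (use finite_darts in auto)
  also have "\<dots> = (\<Sum>v\<in>fst ` {d \<in> darts. fst d \<in> P}. \<Sum>d\<in>{d \<in> {d \<in> darts. fst d \<in> P}. fst d = v}. \<bar>?f d\<bar>)"
    by (rule sum.image_gen) (use finite_darts in simp)
  also have "\<dots> = (\<Sum>v\<in>fst ` {d \<in> darts. fst d \<in> P}. throughput v)"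
  proof (rule sum.cong[OF refl])
    fix v assume "v \<in> fst ` {d \<in> darts. fst d \<in> P}"
    hence "{d \<in> {d \<in> darts. fst d \<in> P}. fst d = v} = {d \<in> darts. fst d = v}" by auto
    thus "(\<Sum>d\<in>{d \<in> {d \<in> darts. fst d \<in> P}. fst d = v}. \<bar>?f d\<bar>) = throughput v"
      by (simp only: throughput_def)
  qed
  also have "\<dots> \<le> (\<Sum>v\<in>P. throughput v)"
    by (rule sum_mono2[OF finP]) (use throughput_nonneg in auto)
  finally show ?thesis .
qed

lemma flow_metric_length:
  assumes \<gamma>: "\<gamma> \<in> connecting_paths E V A A'" and AB: "A \<subseteq> B" "A' \<subseteq> B"
    and sep: "\<And>ws x y ys p q. walk IE ws \<Longrightarrow> (hd ws, x) \<in> A \<Longrightarrow> (last ws, y) \<in> A' \<Longrightarrow>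
      walk IE ys \<Longrightarrow> p \<in> Z1 \<Longrightarrow> hd ys = fst p \<Longrightarrow> q \<in> Z0 \<Longrightarrow> last ys = fst q \<Longrightarrow> set ys \<inter> set ws \<noteq> {}"
  shows "energy / 2 \<le> path_length flow_metric \<gamma>"
proof -
  obtain x vs y where g: "\<gamma> = [x] @ vs @ [y]" "walk IE vs" "(hd vs, x) \<in> A" "(last vs, y) \<in> A'"
    using \<gamma> unfolding connecting_paths_def by blast
  have ne: "vs \<noteq> []" using g(2) walk_simps(3) by auto
  have hdd: "(hd vs, x) \<in> darts" using g(3) AB B_subset by blast
  have V: "set vs \<subseteq> V" using walk_in_V[OF g(2)] fst_in_V[OF hdd] by simp
  have "energy / 2 \<le> (\<Sum>d\<in>Z1. current Z0 Z1 h d)" using energy_le_flux by simp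
  also have "\<dots> \<le> (\<Sum>v\<in>set vs. throughput v)"
    by (rule flux_through_separator[OF sep[OF g(2-4)] V])
  also have "\<dots> \<le> sum_list (map throughput vs)" by (rule sum_set_le_sum_list) (rule throughput_nonneg)
  also have "\<dots> = throughput (hd vs) + (\<Sum>(x, y)\<leftarrow>steps vs. throughput y)" by (rule sum_list_steps[OF ne])
  also have "\<dots> \<le> flow_metric {x, hd vs} + (\<Sum>(x, y)\<leftarrow>steps vs. flow_metric {x, y})"
  proof (rule add_mono)
    show "throughput (hd vs) \<le> flow_metric {x, hd vs}"
      using flow_metric_ge[OF hdd] by (simp add: edge_def insert_commute)
    show "(\<Sum>(x, y)\<leftarrow>steps vs. throughput y) \<le> (\<Sum>(x, y)\<leftarrow>steps vs. flow_metric {x, y})"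
    proof (rule sum_list_mono, clarify)
      fix x y assume "(x, y) \<in> set (steps vs)"
      hence "{y, x} \<in> IE" using g(2) unfolding walk_iff_steps by (auto simp: insert_commute)
      hence "(y, x) \<in> darts" using edge_dart by blast
      from flow_metric_ge[OF this] show "throughput y \<le> flow_metric {x, y}" by (simp add: edge_def insert_commute)
    qed
  qed
  also have "\<dots> \<le> path_length flow_metric \<gamma>"
    unfolding g(1) path_length_ends[OF ne] using flow_metric_nonneg by simp
  finally show ?thesis .
qed

end

end

section \<open>Comparison of the two extremal lengths\<close>

lemma ennreal_mult_SUP_le:
  fixes f g :: "'a \<Rightarrow> ennreal"
  assumes "\<And>x y. x \<in> S \<Longrightarrow> y \<in> T \<Longrightarrow> f x * g y \<le> c"
  shows "(SUP x\<in>S. f x) * (SUP y\<in>T. g y) \<le> c"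
  unfolding SUP_mult_right_ennreal SUP_mult_left_ennreal using assms by (intro SUP_least)

context planar_domain
begin

lemma path_length_nonneg_dom:
  assumes g: "\<And>e. e \<in> dom_edges E V \<Longrightarrow> 0 \<le> g e" and AB: "A \<subseteq> B" "A' \<subseteq> B"
    and \<gamma>: "\<gamma> \<in> connecting_paths E V A A'"
  shows "0 \<le> path_length g \<gamma>"
proof -
  obtain x vs y where d: "\<gamma> = [x] @ vs @ [y]" "walk IE vs" "(hd vs, x) \<in> A" "(last vs, y) \<in> A'"
    using \<gamma> unfolding connecting_paths_def by blast
  have ne: "vs \<noteq> []" using d(2) walk_simps(3) by auto
  have "edge (hd vs, x) \<in> dom_edges E V" "edge (last vs, y) \<in> dom_edges E V"
    using d(3,4) AB B_subset dom_edges_eq by blast+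
  hence "0 \<le> g {x, hd vs}" "0 \<le> g {last vs, y}" using g by (simp_all add: edge_def insert_commute)
  moreover have "0 \<le> (\<Sum>(x, y)\<leftarrow>steps vs. g {x, y})"
    using d(2) g IE_subset unfolding walk_iff_steps by (intro sum_list_nonneg) auto
  ultimately show ?thesis unfolding d(1) path_length_ends[OF ne] by linarith
qed

lemma connecting_paths_nonempty:
  assumes "p \<in> A" "q \<in> A'" "A \<subseteq> B" "A' \<subseteq> B"
  obtains \<gamma> where "\<gamma> \<in> connecting_paths E V A A'"
proof -
  have "fst p \<in> V" "fst q \<in> V" using assms B_subset fst_in_V by blast+
  then obtain vs where vs: "walk IE vs" "hd vs = fst p" "last vs = fst q" using V_connected by blast
  have "[snd p] @ vs @ [snd q] \<in> connecting_paths E V A A'"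
    unfolding connecting_paths_def using vs assms by (intro CollectI exI conjI) auto
  thus ?thesis using that by blast
qed

lemma metric_area_pos:
  assumes g: "\<And>e. e \<in> dom_edges E V \<Longrightarrow> 0 \<le> g e" and AB: "A \<subseteq> B" "A' \<subseteq> B"
    and \<gamma>: "\<gamma> \<in> connecting_paths E V A A'" "0 < path_length g \<gamma>"
  shows "0 < metric_area E w V g"
proof (rule ccontr)
  have wpos: "0 < w e" if "e \<in> dom_edges E V" for e
    using that weight_edge_pos unfolding dom_edges_eq by blast
  hence nn: "\<forall>e\<in>dom_edges E V. 0 \<le> w e * (g e)\<^sup>2"
    by (intro ballI mult_nonneg_nonneg less_imp_le[OF wpos]) auto
  assume "\<not> 0 < metric_area E w V g"
  moreover have "0 \<le> metric_area E w V g" unfolding metric_area_def using nn by (intro sum_nonneg) blast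
  ultimately have s0: "(\<Sum>e\<in>dom_edges E V. w e * (g e)\<^sup>2) = 0" by (simp add: metric_area_def)
  have z: "g e = 0" if e: "e \<in> dom_edges E V" for e
  proof -
    have "w e * (g e)\<^sup>2 = 0"
      by (rule sum_nonneg_0[where f = "\<lambda>e. w e * (g e)\<^sup>2", OF finite_dom_edges _ s0 e]) (use nn in blast)
    thus ?thesis using wpos[OF e] by simp
  qed
  obtain x vs y where d: "\<gamma> = [x] @ vs @ [y]" "walk IE vs" "(hd vs, x) \<in> A" "(last vs, y) \<in> A'"
    using \<gamma> unfolding connecting_paths_def by blast
  have ne: "vs \<noteq> []" using d(2) walk_simps(3) by auto
  have "edge (hd vs, x) \<in> dom_edges E V" "edge (last vs, y) \<in> dom_edges E V"
    using d(3,4) AB B_subset dom_edges_eq by blast+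
  hence "g {x, hd vs} = 0" "g {last vs, y} = 0" using z by (simp_all add: edge_def insert_commute)
  moreover have "(\<Sum>(x, y)\<leftarrow>steps vs. g {x, y}) = 0"
  proof -
    have "map (\<lambda>(x, y). g {x, y}) (steps vs) = map (\<lambda>_. 0) (steps vs)"
      using d(2) z IE_subset unfolding walk_iff_steps by (intro map_cong) auto
    hence "(\<Sum>(x, y)\<leftarrow>steps vs. g {x, y}) = sum_list (map (\<lambda>_. 0) (steps vs))" by (rule arg_cong)
    also have "\<dots> = 0" by (rule sum_list_0)
    finally show ?thesis .
  qed
  ultimately show False using \<gamma>(2) unfolding d(1) path_length_ends[OF ne] by simp
qed

lemma extremal_length_ge:
  assumes g: "\<And>e. e \<in> dom_edges E V \<Longrightarrow> 0 \<le> g e" and AB: "A \<subseteq> B" "A' \<subseteq> B" "A \<noteq> {}" "A' \<noteq> {}"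
    and l: "0 < l" "\<And>\<gamma>. \<gamma> \<in> connecting_paths E V A A' \<Longrightarrow> l \<le> path_length g \<gamma>"
    and K: "metric_area E w V g \<le> K"
  shows "ennreal (l\<^sup>2 / K) \<le> extremal_length E w V A A'"
proof -
  obtain \<gamma> where \<gamma>: "\<gamma> \<in> connecting_paths E V A A'"
    using connecting_paths_nonempty AB by (metis ex_in_conv)
  have pos: "0 < metric_area E w V g"
    by (rule metric_area_pos[OF g AB(1,2) \<gamma> less_le_trans[OF l(1) l(2)[OF \<gamma>]]])
  have "ennreal (l\<^sup>2 / K) \<le> ennreal (l\<^sup>2 / metric_area E w V g)"
    using pos K by (intro ennreal_leI divide_left_mono) auto
  also have "\<dots> = (ennreal l)\<^sup>2 / ennreal (metric_area E w V g)"
    using pos l(1) by (simp add: divide_ennreal ennreal_power)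
  also have "\<dots> \<le> (INF \<gamma>\<in>connecting_paths E V A A'. ennreal (path_length g \<gamma>))\<^sup>2 / ennreal (metric_area E w V g)"
    by (intro divide_right_mono_ennreal power_mono INF_greatest ennreal_leI l(2)) auto
  also have "\<dots> \<le> extremal_length E w V A A'"
    unfolding extremal_length_def by (rule SUP_upper) (use g pos in auto)
  finally show ?thesis .
qed

lemma length_infimum:
  assumes g: "\<And>e. e \<in> dom_edges E V \<Longrightarrow> 0 \<le> g e" and AB: "A \<subseteq> B" "A' \<subseteq> B" "A \<noteq> {}" "A' \<noteq> {}"
  shows "\<exists>l. 0 \<le> l \<and> (INF \<gamma>\<in>connecting_paths E V A A'. ennreal (path_length g \<gamma>)) = ennreal l \<and>
    (\<forall>\<gamma>\<in>connecting_paths E V A A'. l \<le> path_length g \<gamma>)"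
proof -
  define I where "I = (INF \<gamma>\<in>connecting_paths E V A A'. ennreal (path_length g \<gamma>))"
  have lower: "I \<le> ennreal (path_length g \<gamma>)" if "\<gamma> \<in> connecting_paths E V A A'" for \<gamma>
    unfolding I_def by (rule INF_lower[OF that])
  obtain \<gamma> where \<gamma>: "\<gamma> \<in> connecting_paths E V A A'"
    using connecting_paths_nonempty AB by (metis ex_in_conv)
  have "I < top" using lower[OF \<gamma>] ennreal_less_top le_less_trans by blast
  then obtain l where l: "0 \<le> l" "I = ennreal l" by (cases I) auto
  have "l \<le> path_length g \<gamma>" if "\<gamma> \<in> connecting_paths E V A A'" for \<gamma>
    using lower[OF that] path_length_nonneg_dom[OF g AB(1,2) that] l by (simp add: ennreal_le_iff)
  thus ?thesis using l unfolding I_def by blast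
qed

lemma arcs_in_B:
  assumes a: "a \<in> B" and ccw: "listed_ccw E V a b c d"
  shows "bd_arc E V a b \<subseteq> B" "bd_arc E V b c \<subseteq> B" "bd_arc E V c d \<subseteq> B" "bd_arc E V d a \<subseteq> B"
    "bd_arc E V a b \<noteq> {}" "bd_arc E V b c \<noteq> {}" "bd_arc E V c d \<noteq> {}" "bd_arc E V d a \<noteq> {}"
    "bd_arc E V b c \<inter> bd_arc E V d a = {}"
proof -
  obtain i j k where ijk: "0 < i" "i < j" "j < k" "k < period succ a"
    and arcs: "bd_arc E V a b = (\<lambda>m. (succ ^^ m) a) ` {0..i}" "bd_arc E V b c = (\<lambda>m. (succ ^^ m) a) ` {i..j}"
      "bd_arc E V c d = (\<lambda>m. (succ ^^ m) a) ` {j..k}"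
      "bd_arc E V d a = (\<lambda>m. (succ ^^ m) a) ` {k..period succ a}"
    by (rule four_arcs[OF a ccw])
  show "bd_arc E V a b \<subseteq> B" "bd_arc E V b c \<subseteq> B" "bd_arc E V c d \<subseteq> B" "bd_arc E V d a \<subseteq> B"
    unfolding arcs using succ_pow_in[OF a] by blast+
  show "bd_arc E V a b \<noteq> {}" "bd_arc E V b c \<noteq> {}" "bd_arc E V c d \<noteq> {}" "bd_arc E V d a \<noteq> {}"
    unfolding arcs using ijk by auto
  show "bd_arc E V b c \<inter> bd_arc E V d a = {}"
  proof (rule ccontr)
    assume "bd_arc E V b c \<inter> bd_arc E V d a \<noteq> {}"
    then obtain q where "q \<in> (\<lambda>m. (succ ^^ m) a) ` {i..j}" "q \<in> (\<lambda>m. (succ ^^ m) a) ` {k..period succ a}"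
      unfolding arcs by blast
    then obtain m m' where m: "m \<in> {i..j}" "m' \<in> {k..period succ a}" "(succ ^^ m) a = (succ ^^ m') a"
      by (elim imageE) simp
    have "m < period succ a" using m ijk by auto
    show False
    proof (cases "m' = period succ a")
      case True
      hence "(succ ^^ m) a = (succ ^^ 0) a" using m(3) period_succ(2)[OF a] by simp
      thus False using period_succ(3)[OF a \<open>m < period succ a\<close> _, of 0] period_succ(1)[OF a] m ijk by auto
    next
      case False
      thus False using period_succ(3)[OF a \<open>m < period succ a\<close> _ m(3)] m ijk by auto
    qed
  qed
qed

lemma paths_between_arcs_meet:
  assumes a: "a \<in> B" and ccw: "listed_ccw E V a b c d"
    and ws: "walk IE ws" "(hd ws, x) \<in> bd_arc E V a b" "(last ws, y) \<in> bd_arc E V c d"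
    and ys: "walk IE ys" "p \<in> bd_arc E V d a" "hd ys = fst p" "q \<in> bd_arc E V b c" "last ys = fst q"
  shows "set ys \<inter> set ws \<noteq> {}"
proof -
  obtain i j k where ijk: "0 < i" "i < j" "j < k" "k < period succ a"
    and arcs: "bd_arc E V a b = (\<lambda>m. (succ ^^ m) a) ` {0..i}" "bd_arc E V b c = (\<lambda>m. (succ ^^ m) a) ` {i..j}"
      "bd_arc E V c d = (\<lambda>m. (succ ^^ m) a) ` {j..k}"
      "bd_arc E V d a = (\<lambda>m. (succ ^^ m) a) ` {k..period succ a}"
    by (rule four_arcs[OF a ccw])
  obtain s where s: "s \<le> i" "(hd ws, x) = (succ ^^ s) a" using ws(2) unfolding arcs by auto
  obtain s' where s': "j \<le> s'" "s' \<le> k" "(last ws, y) = (succ ^^ s') a" using ws(3) unfolding arcs by auto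
  obtain r where r: "i \<le> r" "r \<le> j" "q = (succ ^^ r) a" using ys(4) unfolding arcs by auto
  obtain r' where r': "k \<le> r'" "r' \<le> period succ a" "p = (succ ^^ r') a" using ys(2) unfolding arcs by auto
  have ne: "ys \<noteq> []" using ys(1) walk_simps(3) by auto
  have "set ws \<inter> set (rev ys) \<noteq> {}"
  proof (rule arc_walks_meet[OF a s(1) r(1,2) s'(1,2) r'(1,2) ws(1)])
    show "hd ws = fst ((succ ^^ s) a)" using s(2) by (metis fst_conv)
    show "last ws = fst ((succ ^^ s') a)" using s'(3) by (metis fst_conv)
    show "walk IE (rev ys)" using ys(1) by (simp add: walk_rev)
    show "hd (rev ys) = fst ((succ ^^ r) a)" using ys(5) r(3) ne by (simp add: hd_rev)
    show "last (rev ys) = fst ((succ ^^ r') a)" using ys(3) r'(3) ne by (simp add: last_rev)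
  qed
  thus ?thesis by auto
qed

lemma extremal_length_product_upper:
  fixes M :: nat
  assumes a: "a \<in> B" and ccw: "listed_ccw E V a b c d" and w0: "\<omega>\<^sub>0 > 0" and M: "real M * \<eta>\<^sub>0 > 2 * pi"
  shows "extremal_length E w V (bd_arc E V a b) (bd_arc E V c d) *
    extremal_length E w V (bd_arc E V b c) (bd_arc E V d a) \<le> ennreal ((4 * real M / \<omega>\<^sub>0)\<^sup>2)"
proof -
  note arcs = arcs_in_B[OF a ccw]
  show ?thesis
    unfolding extremal_length_def
  proof (rule ennreal_mult_SUP_le)
    fix g1 g2 :: "complex set \<Rightarrow> real"
    assume "g1 \<in> {g. (\<forall>e\<in>dom_edges E V. 0 \<le> g e) \<and> 0 < metric_area E w V g}"
      and "g2 \<in> {g. (\<forall>e\<in>dom_edges E V. 0 \<le> g e) \<and> 0 < metric_area E w V g}"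
    hence g: "\<And>e. e \<in> dom_edges E V \<Longrightarrow> 0 \<le> g1 e" "\<And>e. e \<in> dom_edges E V \<Longrightarrow> 0 \<le> g2 e"
      and A: "0 < metric_area E w V g1" "0 < metric_area E w V g2" by auto
    define A1 where "A1 = metric_area E w V g1"
    define A2 where "A2 = metric_area E w V g2"
    obtain l1 where l1: "0 \<le> l1"
      "(INF \<gamma>\<in>connecting_paths E V (bd_arc E V a b) (bd_arc E V c d). ennreal (path_length g1 \<gamma>)) = ennreal l1"
      "\<And>\<gamma>. \<gamma> \<in> connecting_paths E V (bd_arc E V a b) (bd_arc E V c d) \<Longrightarrow> l1 \<le> path_length g1 \<gamma>"
    proof -
      have "\<exists>l. 0 \<le> l \<and> (INF \<gamma>\<in>connecting_paths E V (bd_arc E V a b) (bd_arc E V c d). ennreal (path_length g1 \<gamma>)) = ennreal l \<and>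
          (\<forall>\<gamma>\<in>connecting_paths E V (bd_arc E V a b) (bd_arc E V c d). l \<le> path_length g1 \<gamma>)"
        by (rule length_infimum[where g = g1, OF g(1) arcs(1,3,5,7)])
      thus ?thesis using that by blast
    qed
    obtain l2 where l2: "0 \<le> l2"
      "(INF \<gamma>\<in>connecting_paths E V (bd_arc E V b c) (bd_arc E V d a). ennreal (path_length g2 \<gamma>)) = ennreal l2"
      "\<And>\<gamma>. \<gamma> \<in> connecting_paths E V (bd_arc E V b c) (bd_arc E V d a) \<Longrightarrow> l2 \<le> path_length g2 \<gamma>"
    proof -
      have "\<exists>l. 0 \<le> l \<and> (INF \<gamma>\<in>connecting_paths E V (bd_arc E V b c) (bd_arc E V d a). ennreal (path_length g2 \<gamma>)) = ennreal l \<and>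
          (\<forall>\<gamma>\<in>connecting_paths E V (bd_arc E V b c) (bd_arc E V d a). l \<le> path_length g2 \<gamma>)"
        by (rule length_infimum[where g = g2, OF g(2) arcs(2,4,6,8)])
      thus ?thesis using that by blast
    qed
    have "l1\<^sup>2 * l2\<^sup>2 \<le> (4 * real M / \<omega>\<^sub>0)\<^sup>2 * (A1 * A2)"
      unfolding A1_def A2_def by (rule product_of_squares_le[where ?g1.0 = g1 and ?g2.0 = g2, OF a ccw w0 M g l1(1,3) l2(1,3)])
    moreover have Apos: "0 < A1" "0 < A2" using A by (simp_all add: A1_def A2_def)
    hence "0 < A1 * A2" by simp
    ultimately have "(l1\<^sup>2 * l2\<^sup>2) / (A1 * A2) \<le> (4 * real M / \<omega>\<^sub>0)\<^sup>2"
      using pos_divide_le_eq by blast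
    hence "(l1\<^sup>2 / A1) * (l2\<^sup>2 / A2) \<le> (4 * real M / \<omega>\<^sub>0)\<^sup>2" by (simp only: times_divide_times_eq)
    moreover have "(ennreal l1)\<^sup>2 / ennreal A1 * ((ennreal l2)\<^sup>2 / ennreal A2) = ennreal ((l1\<^sup>2 / A1) * (l2\<^sup>2 / A2))"
    proof -
      have "(ennreal l1)\<^sup>2 / ennreal A1 = ennreal (l1\<^sup>2 / A1)" "(ennreal l2)\<^sup>2 / ennreal A2 = ennreal (l2\<^sup>2 / A2)"
        using Apos l1(1) l2(1) by (simp_all add: divide_ennreal ennreal_power)
      moreover have "0 \<le> l1\<^sup>2 / A1" "0 \<le> l2\<^sup>2 / A2" using Apos by simp_all
      ultimately show ?thesis by (simp only: ennreal_mult)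
    qed
    ultimately show "(INF \<gamma>\<in>connecting_paths E V (bd_arc E V a b) (bd_arc E V c d). ennreal (path_length g1 \<gamma>))\<^sup>2 /
          ennreal (metric_area E w V g1) *
        ((INF \<gamma>\<in>connecting_paths E V (bd_arc E V b c) (bd_arc E V d a). ennreal (path_length g2 \<gamma>))\<^sup>2 /
          ennreal (metric_area E w V g2)) \<le> ennreal ((4 * real M / \<omega>\<^sub>0)\<^sup>2)"
      unfolding l1(2) l2(2) A1_def[symmetric] A2_def[symmetric] by (simp add: ennreal_leI)
  qed
qed

text \<open>The metric of potential differences shows that the second extremal length is at least \<open>1 / en\<close>. The metric of currents
  has lengths at least \<open>en / 2\<close> and area at most \<open>2 * en / \<omega>\<^sub>0\<^sup>2\<close>, and shows that the first one is at least \<open>en * \<omega>\<^sub>0\<^sup>2 / 8\<close>.\<close>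

lemma extremal_length_product_lower:
  assumes a: "a \<in> B" and ccw: "listed_ccw E V a b c d" and w0: "\<omega>\<^sub>0 > 0"
  shows "ennreal (\<omega>\<^sub>0\<^sup>2 / 8) \<le> extremal_length E w V (bd_arc E V a b) (bd_arc E V c d) *
    extremal_length E w V (bd_arc E V b c) (bd_arc E V d a)"
proof -
  note arcs = arcs_in_B[OF a ccw]
  define Z0 where "Z0 = bd_arc E V b c"
  define Z1 where "Z1 = bd_arc E V d a"
  have Z: "Z0 \<subseteq> B" "Z1 \<subseteq> B" "Z0 \<inter> Z1 = {}" using arcs by (simp_all add: Z0_def Z1_def)
  obtain h where h: "\<And>v. 0 \<le> h v \<and> h v \<le> 1"
    "\<And>v. (\<Sum>d\<in>{d \<in> darts. fst d = v}. current Z0 Z1 h d) = 0"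
    using exists_harmonic[OF Z(1,2)] by blast
  note ctx = Z h
  define en where "en = energy Z0 Z1 h"
  define dm where "dm = drop_metric Z0 Z1 h"
  define fm where "fm = flow_metric Z0 Z1 h"
  have dm_area: "metric_area E w V dm \<le> en" unfolding dm_def en_def by (rule drop_metric_area[OF ctx])
  have dm_len: "1 \<le> path_length dm \<gamma>" if "\<gamma> \<in> connecting_paths E V Z0 Z1" for \<gamma>
    unfolding dm_def by (rule drop_metric_length[OF ctx that])
  have dm0: "0 \<le> dm e" for e unfolding dm_def drop_metric_def[OF ctx] by simp
  have fm0: "0 \<le> fm e" for e unfolding fm_def by (rule flow_metric_nonneg[OF ctx])
  obtain \<gamma> where \<gamma>: "\<gamma> \<in> connecting_paths E V Z0 Z1"
    using connecting_paths_nonempty arcs(2,4,6,8) unfolding Z0_def Z1_def by (metis ex_in_conv)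
  have "0 < metric_area E w V dm"
    by (rule metric_area_pos[where g = dm, OF dm0 Z(1,2) \<gamma>]) (use dm_len[OF \<gamma>] in simp)
  hence en: "0 < en" using dm_area by simp
  have "ennreal (1\<^sup>2 / en) \<le> extremal_length E w V Z0 Z1"
    by (rule extremal_length_ge[where g = dm, OF dm0 Z(1,2) _ _ _ dm_len dm_area])
       (use arcs in \<open>simp_all add: Z0_def Z1_def\<close>)
  hence L2: "ennreal (1 / en) \<le> extremal_length E w V Z0 Z1" by simp
  have fm_len: "en / 2 \<le> path_length fm \<gamma>"
    if "\<gamma> \<in> connecting_paths E V (bd_arc E V a b) (bd_arc E V c d)" for \<gamma>
    unfolding en_def fm_def
    by (rule flow_metric_length[OF ctx that arcs(1,3)])
       (rule paths_between_arcs_meet[OF a ccw], simp_all add: Z0_def Z1_def)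
  have fm_area: "metric_area E w V fm \<le> 2 / \<omega>\<^sub>0\<^sup>2 * en"
    unfolding fm_def en_def by (rule flow_metric_area[OF ctx w0])
  have L1: "ennreal ((en / 2)\<^sup>2 / (2 / \<omega>\<^sub>0\<^sup>2 * en)) \<le> extremal_length E w V (bd_arc E V a b) (bd_arc E V c d)"
    by (rule extremal_length_ge[where g = fm, OF fm0 arcs(1,3,5,7) _ fm_len fm_area]) (use en in simp)
  have "\<omega>\<^sub>0\<^sup>2 / 8 = (en / 2)\<^sup>2 / (2 / \<omega>\<^sub>0\<^sup>2 * en) * (1 / en)"
    using en w0 by (simp add: field_simps power2_eq_square)
  hence "ennreal (\<omega>\<^sub>0\<^sup>2 / 8) = ennreal ((en / 2)\<^sup>2 / (2 / \<omega>\<^sub>0\<^sup>2 * en)) * ennreal (1 / en)"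
    using en w0 by (simp add: ennreal_mult[symmetric])
  also have "\<dots> \<le> extremal_length E w V (bd_arc E V a b) (bd_arc E V c d) * extremal_length E w V Z0 Z1"
    by (rule mult_mono[OF L1 L2]) auto
  finally show ?thesis by (simp add: Z0_def Z1_def)
qed

end

theorem corollary6p3:
  fixes \<omega>\<^sub>0 \<eta>\<^sub>0 \<kappa>\<^sub>0 :: real
  assumes "\<omega>\<^sub>0 > 0" and "\<eta>\<^sub>0 > 0" and "\<kappa>\<^sub>0 \<ge> 1"
  shows "\<exists>C\<^sub>1 C\<^sub>2 :: real. 0 < C\<^sub>1 \<and> 0 < C\<^sub>2 \<and>
    (\<forall>\<Gamma> E w V a b c d.
      admissible_graph \<Gamma> E w \<omega>\<^sub>0 \<eta>\<^sub>0 \<kappa>\<^sub>0 \<longrightarrow>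
      simply_connected_domain \<Gamma> E V \<longrightarrow>
      {a, b, c, d} \<subseteq> bd_points E V \<longrightarrow> distinct [a, b, c, d] \<longrightarrow> listed_ccw E V a b c d \<longrightarrow>
      ennreal C\<^sub>1 \<le> extremal_length E w V (bd_arc E V a b) (bd_arc E V c d) *
                    extremal_length E w V (bd_arc E V b c) (bd_arc E V d a) \<and>
      extremal_length E w V (bd_arc E V a b) (bd_arc E V c d) *
        extremal_length E w V (bd_arc E V b c) (bd_arc E V d a) \<le> ennreal C\<^sub>2)"
proof -
  obtain M :: nat where M: "2 * pi / \<eta>\<^sub>0 < real M" using reals_Archimedean2 by blast
  hence M\<eta>: "real M * \<eta>\<^sub>0 > 2 * pi" using assms(2) by (simp add: divide_less_eq)
  have "0 < 2 * pi / \<eta>\<^sub>0" using assms(2) by simp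
  hence Mpos: "0 < real M" using M by linarith
  show ?thesis
  proof (rule exI[of _ "\<omega>\<^sub>0\<^sup>2 / 8"], rule exI[of _ "(4 * real M / \<omega>\<^sub>0)\<^sup>2"], intro conjI allI impI)
    show "0 < \<omega>\<^sub>0\<^sup>2 / 8" "0 < (4 * real M / \<omega>\<^sub>0)\<^sup>2" using assms(1) Mpos by simp_all
    fix \<Gamma> E w V a b c d
    assume adm: "admissible_graph \<Gamma> E w \<omega>\<^sub>0 \<eta>\<^sub>0 \<kappa>\<^sub>0" and sc: "simply_connected_domain \<Gamma> E V"
      and pts: "{a, b, c, d} \<subseteq> bd_points E V" and ccw: "listed_ccw E V a b c d"
    interpret planar_domain \<Gamma> E w \<omega>\<^sub>0 \<eta>\<^sub>0 \<kappa>\<^sub>0 V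
      by (intro planar_domain.intro adm planar_domain_axioms.intro sc assms(2))
    have a: "a \<in> bd_points E V" using pts by simp
    show "ennreal (\<omega>\<^sub>0\<^sup>2 / 8) \<le> extremal_length E w V (bd_arc E V a b) (bd_arc E V c d) *
        extremal_length E w V (bd_arc E V b c) (bd_arc E V d a)"
      by (rule extremal_length_product_lower[OF a ccw assms(1)])
    show "extremal_length E w V (bd_arc E V a b) (bd_arc E V c d) *
        extremal_length E w V (bd_arc E V b c) (bd_arc E V d a) \<le> ennreal ((4 * real M / \<omega>\<^sub>0)\<^sup>2)"
      by (rule extremal_length_product_upper[OF a ccw assms(1) M\<eta>])
  qed
qed

end
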